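(* Let $G$ be a trunc. (1) There exist a suitable compactification $q\colon M\to L$, a snugly embedded trunc $\widehat G\subseteq\mathcal E_0 q$, and a trunc isomorphism $\mu_G\colon G\to\widehat G$, $g\mapsto\hat g$. These data are unique up to isomorphism: if $q_1\colon M_1\to L_1$ is another suitable compactification and $\mu_1\colon G\to\widehat G_1$ is a trunc isomorphism onto a snugly embedded trunc $\widehat G_1\subseteq\mathcal E_0 q_1$, then there is an isomorphism of compactifications $(l,m)\colon q\to q_1$ with $m\circ\mu_G(g)=\mu_1(g)$ for all $g\in G$. (2) The representation is functorial: let $\theta\colon G\to H$ be a truncation homomorphism, where $H$ is a trunc with suitable compactification $r\colon N\to Q$ and trunc isomorphism $\mu_H\colon H\to\widehat H\subseteq\mathcal E_0 r$ onto a snugly embedded trunc as in (1). Then there is a unique homomorphism of compactifications $(l,m)\colon q\to r$ such that $\mathcal E_0(l,m)\circ\mu_G=\mu_H\circ\theta$, i.e. $m\circ\mu_G(g)=\mu_H(\theta(g))$ for all $g\in G$.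
   Context: All vector lattices are real. A truncation on an archimedean vector lattice $G$ is a unary operation $g\mapsto\overline g$ on $G^+$ such that for all $g,h\in G^+$: $g\wedge\overline h\le\overline g\le g$; if $\overline g=0$ then $g=0$; if $ng=\overline{ng}$ for all positive integers $n$ then $g=0$. A trunc is an archimedean vector lattice with a truncation; a truncation homomorphism is a vector lattice homomorphism preserving truncation. $\overline G=\{\overline g: g\in G^+\}$. A pointed frame is a frame $L$ with a frame homomorphism $*_L\colon L\to 2=\{\bot,\top\}$; pointed frame homomorphisms are frame homomorphisms commuting with the points. $\mathcal O_*\mathbb R$ and $\mathcal O_*\overline{\mathbb R}$ are the frames of open sets of $\mathbb R$ and of $\overline{\mathbb R}=[-\infty,\infty]$, pointed by $0$ (i.e. $*(U)=\top$ iff $0\in U$). $p\colon\mathcal O_*\overline{\mathbb R}\to\mathcal O_*\mathbb R$ is $U\mapsto U\cap(-\infty,\infty)$. $\mathcal R_0L$ is the set of pointed frame homomorphisms $\mathcal O_*\mathbb R\to L$. It is a trunc: each trunc operation $w\colon\mathbb R^n\to\mathbb R$ (addition, scalar multiplication, $\vee,\wedge$, and truncation $x\mapsto x\wedge1$) acts on $\mathcal R_0L$ by $w(f_1,\dots,f_n)(V)=\bigvee\{\bigwedge_i f_i(U_i): w(U_1\times\dots\times U_n)\subseteq V\}$. For a compact pointed frame $M$, $\mathcal D_0M$ is the set of pointed frame homomorphisms $h'\colon\mathcal O_*\overline{\mathbb R}\to M$ such that $h'(-\infty,\infty)$ is a dense element of $M$ ($y$ is dense if $y\wedge x=\bot$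 implies $x=\bot$). A compactification is a dense (i.e. $q(x)=\bot\Rightarrow x=\bot$) surjective pointed frame homomorphism $q\colon M\to L$ with $M$ compact regular. Let $q_*\colon L\to M$ be its right adjoint; $q_*(L)$ is the associated sublocale of $M$. For $y\in M$ the open sublocale of $y$ is $y\to M=\{y\to x: x\in M\}$ (Heyting implication), which contains $q_*(L)$ iff $q(y)=\top$. A cozero element of a frame $M$ is an element $g(\mathbb R\smallsetminus\{0\})$ with $g\colon\mathcal O\mathbb R\to M$ a frame homomorphism. The compactification $q$ is suitable if $q_*(L)$ is the intersection of the open sublocales $y\to M$ containing it with $y$ a cozero element of $M$. A homomorphism of compactifications from $q\colon M\to L$ to $r\colon N\to Q$ is a pair $(l,m)$ of pointed frame homomorphisms $l\colon M\to N$, $m\colon L\to Q$ with $m\circ q=r\circ l$. $\mathcal E_0q=\{h\in\mathcal R_0L:\exists h'\in\mathcal D_0M\ (q\circ h'=h\circ p)\}$; $h'$ denotes the element of $\mathcal D_0 M$ corresponding to $h$. $\mathcal E_0(l,m)\colon\mathcal E_0q\to\mathcal E_0r$ is $h\mapsto m\circ h$. A trunc in $\mathcal E_0q$ is a subset $G\subseteq\mathcal E_0q$ closed under all trunc operations of $\mathcal R_0L$. It is snugly embedded if every element of $M$ is a join of elements of the form $\operatorname{coz}g=g'(0,\infty]$ or $\operatorname{con}g=g'[-\infty,1)$ with $g\in\overline G$, and $q_*(L)$ is the intersection of the open sublocales $g'(-\infty,\infty)\to M$, $g\in G$. *)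

theory Defs
  imports "HOL-Analysis.Analysis" "HOL-Algebra.Complete_Lattice"
begin

section \<open>Truncs\<close>

text \<open>
  A real vector lattice is a type of sort \<open>{ordered_real_vector, lattice}\<close>.
  The truncation is an operation on the positive cone only: nothing is assumed about, and
  nothing below depends on, the values of \<open>trunc\<close> outside \<open>{g. 0 \<le> g}\<close>.
  The lattice operations of the type are written \<open>sup_class.sup\<close> and \<open>inf_class.inf\<close>, because
  \<open>sup\<close> and \<open>inf\<close> are the carrier-based ones of \<open>HOL-Algebra\<close> here.
\<close>

locale trunc =
  fixes trunc :: "'a::{ordered_real_vector, lattice} \<Rightarrow> 'a"
  assumes archimedean:
      "\<And>g h :: 'a. \<lbrakk>0 \<le> g; 0 \<le> h; \<And>n::nat. real n *\<^sub>R g \<le> h\<rbrakk> \<Longrightarrow> g = 0"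
    and trunc_nonneg: "\<And>g. 0 \<le> g \<Longrightarrow> 0 \<le> trunc g"
    and inf_trunc_le: "\<And>g h. \<lbrakk>0 \<le> g; 0 \<le> h\<rbrakk> \<Longrightarrow> inf_class.inf g (trunc h) \<le> trunc g"
    and trunc_le: "\<And>g. 0 \<le> g \<Longrightarrow> trunc g \<le> g"
    and trunc_eq_0: "\<And>g. \<lbrakk>0 \<le> g; trunc g = 0\<rbrakk> \<Longrightarrow> g = 0"
    and trunc_multiples:
      "\<And>g. \<lbrakk>0 \<le> g; \<And>n::nat. n > 0 \<Longrightarrow> real n *\<^sub>R g = trunc (real n *\<^sub>R g)\<rbrakk> \<Longrightarrow> g = 0"

definition trunc_hom ::
  "('a::{ordered_real_vector, lattice} \<Rightarrow> 'a) \<Rightarrow> ('b::{ordered_real_vector, lattice} \<Rightarrow> 'b)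
    \<Rightarrow> ('a \<Rightarrow> 'b) \<Rightarrow> bool"
  where "trunc_hom t u \<theta> \<longleftrightarrow>
    linear \<theta> \<and>
    (\<forall>g h. \<theta> (sup_class.sup g h) = sup_class.sup (\<theta> g) (\<theta> h)) \<and>
    (\<forall>g h. \<theta> (inf_class.inf g h) = inf_class.inf (\<theta> g) (\<theta> h)) \<and>
    (\<forall>g\<ge>0. \<theta> (t g) = u (\<theta> g))"


section \<open>Pointed frames\<close>

locale frame = complete_lattice L for L (structure) +
  assumes meet_sup_distrib:
    "\<And>x A. \<lbrakk>x \<in> carrier L; A \<subseteq> carrier L\<rbrakk> \<Longrightarrow> x \<sqinter> \<Squnion>A = \<Squnion>((\<lambda>a. x \<sqinter> a) ` A)"

definition frame_hom ::
  "('a, 'c) gorder_scheme \<Rightarrow> ('b, 'd) gorder_scheme \<Rightarrow> ('a \<Rightarrow> 'b) \<Rightarrow> bool"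
  where "frame_hom L M f \<longleftrightarrow>
    f \<in> carrier L \<rightarrow> carrier M \<and>
    f \<top>\<^bsub>L\<^esub> = \<top>\<^bsub>M\<^esub> \<and>
    (\<forall>x\<in>carrier L. \<forall>y\<in>carrier L. f (x \<sqinter>\<^bsub>L\<^esub> y) = f x \<sqinter>\<^bsub>M\<^esub> f y) \<and>
    (\<forall>A\<subseteq>carrier L. f (\<Squnion>\<^bsub>L\<^esub>A) = \<Squnion>\<^bsub>M\<^esub>(f ` A))"

definition two :: "bool gorder"
  where "two = \<lparr>carrier = UNIV, eq = (=), le = (\<le>)\<rparr>"

record 'a pframe = "'a gorder" +
  point :: "'a \<Rightarrow> bool"

locale pointed_frame = frame L for L :: "'a pframe" (structure) +
  assumes point_hom: "frame_hom L two (point L)"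

text \<open>
  Pointed frame homomorphisms are normalised outside the carrier of their domain, so that
  equality of functions is equality of homomorphisms.
\<close>

definition pframe_homs :: "'a pframe \<Rightarrow> 'b pframe \<Rightarrow> ('a \<Rightarrow> 'b) set"
  where "pframe_homs L M =
    {f \<in> extensional (carrier L). frame_hom L M f \<and> (\<forall>x\<in>carrier L. point M (f x) = point L x)}"

definition opens :: "'a::topological_space set gorder"
  where "opens = \<lparr>carrier = {U. open U}, eq = (=), le = (\<subseteq>)\<rparr>"

definition opens_at :: "'a::topological_space \<Rightarrow> 'a set pframe"
  where "opens_at x = \<lparr>carrier = {U. open U}, eq = (=), le = (\<subseteq>), point = (\<lambda>U. x \<in> U)\<rparr>"

abbreviation O_real :: "real set pframe"
  where "O_real \<equiv> opens_at 0"

abbreviation O_ereal :: "ereal set pframe"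
  where "O_ereal \<equiv> opens_at 0"

text \<open>The map \<open>p\<close>, that is \<open>U \<mapsto> U \<inter> (-\<infinity>, \<infinity>)\<close>.\<close>

definition finite_part :: "ereal set \<Rightarrow> real set"
  where "finite_part = (\<lambda>U\<in>carrier O_ereal. ereal -` U)"

definition himp :: "('a, 'c) gorder_scheme \<Rightarrow> 'a \<Rightarrow> 'a \<Rightarrow> 'a"
  where "himp M y x = \<Squnion>\<^bsub>M\<^esub>{z \<in> carrier M. z \<sqinter>\<^bsub>M\<^esub> y \<sqsubseteq>\<^bsub>M\<^esub> x}"

definition open_sublocale :: "('a, 'c) gorder_scheme \<Rightarrow> 'a \<Rightarrow> 'a set"
  where "open_sublocale M y = himp M y ` carrier M"

definition dense_element :: "('a, 'c) gorder_scheme \<Rightarrow> 'a \<Rightarrow> bool"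
  where "dense_element M y \<longleftrightarrow>
    y \<in> carrier M \<and> (\<forall>x\<in>carrier M. y \<sqinter>\<^bsub>M\<^esub> x = \<bottom>\<^bsub>M\<^esub> \<longrightarrow> x = \<bottom>\<^bsub>M\<^esub>)"

definition cozero_element :: "('a, 'c) gorder_scheme \<Rightarrow> 'a \<Rightarrow> bool"
  where "cozero_element M y \<longleftrightarrow>
    (\<exists>g. frame_hom (opens :: real set gorder) M g \<and> y = g (UNIV - {0}))"

definition compact_frame :: "('a, 'c) gorder_scheme \<Rightarrow> bool"
  where "compact_frame M \<longleftrightarrow>
    (\<forall>A\<subseteq>carrier M. \<Squnion>\<^bsub>M\<^esub>A = \<top>\<^bsub>M\<^esub> \<longrightarrow> (\<exists>F\<subseteq>A. finite F \<and> \<Squnion>\<^bsub>M\<^esub>F = \<top>\<^bsub>M\<^esub>))"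

definition rather_below :: "('a, 'c) gorder_scheme \<Rightarrow> 'a \<Rightarrow> 'a \<Rightarrow> bool"
  where "rather_below M y x \<longleftrightarrow> himp M y \<bottom>\<^bsub>M\<^esub> \<squnion>\<^bsub>M\<^esub> x = \<top>\<^bsub>M\<^esub>"

definition regular_frame :: "('a, 'c) gorder_scheme \<Rightarrow> bool"
  where "regular_frame M \<longleftrightarrow>
    (\<forall>x\<in>carrier M. x = \<Squnion>\<^bsub>M\<^esub>{y \<in> carrier M. rather_below M y x})"


section \<open>The trunc of pointed frame homomorphisms\<close>

definition R0 :: "'l pframe \<Rightarrow> (real set \<Rightarrow> 'l) set"
  where "R0 L = pframe_homs O_real L"

text \<open>
  The action of \<open>w : \<real>\<^sup>n \<rightarrow> \<real>\<close> on \<open>R0 L\<close> for the arities \<open>n = 0, 1, 2\<close> that occur among the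
  trunc operations; \<open>R0_zero\<close> is the case \<open>n = 0\<close>, \<open>w = 0\<close>.
\<close>

definition R0_lift1 :: "'l pframe \<Rightarrow> (real \<Rightarrow> real) \<Rightarrow> (real set \<Rightarrow> 'l) \<Rightarrow> real set \<Rightarrow> 'l"
  where "R0_lift1 L w f = (\<lambda>V\<in>carrier O_real. \<Squnion>\<^bsub>L\<^esub>{f U |U. open U \<and> w ` U \<subseteq> V})"

definition R0_lift2 ::
  "'l pframe \<Rightarrow> (real \<Rightarrow> real \<Rightarrow> real) \<Rightarrow> (real set \<Rightarrow> 'l) \<Rightarrow> (real set \<Rightarrow> 'l) \<Rightarrow> real set \<Rightarrow> 'l"
  where "R0_lift2 L w f g = (\<lambda>V\<in>carrier O_real.
    \<Squnion>\<^bsub>L\<^esub>{f U \<sqinter>\<^bsub>L\<^esub> g U' |U U'. open U \<and> open U' \<and> (\<lambda>(x, y). w x y) ` (U \<times> U') \<subseteq> V})"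

definition R0_zero :: "'l pframe \<Rightarrow> real set \<Rightarrow> 'l"
  where "R0_zero L = (\<lambda>V\<in>carrier O_real. if 0 \<in> V then \<top>\<^bsub>L\<^esub> else \<bottom>\<^bsub>L\<^esub>)"

abbreviation "R0_add L \<equiv> R0_lift2 L (+)"
abbreviation "R0_scale L c \<equiv> R0_lift1 L (\<lambda>x. c * x)"
abbreviation "R0_sup L \<equiv> R0_lift2 L max"
abbreviation "R0_inf L \<equiv> R0_lift2 L min"
abbreviation "R0_trunc L \<equiv> R0_lift1 L (\<lambda>x. min x 1)"

definition R0_closed :: "'l pframe \<Rightarrow> (real set \<Rightarrow> 'l) set \<Rightarrow> bool"
  where "R0_closed L G \<longleftrightarrow>
    R0_zero L \<in> G \<and>
    (\<forall>f\<in>G. \<forall>g\<in>G. R0_add L f g \<in> G \<and> R0_sup L f g \<in> G \<and> R0_inf L f g \<in> G) \<and>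
    (\<forall>c. \<forall>f\<in>G. R0_scale L c f \<in> G) \<and>
    (\<forall>f\<in>G. R0_trunc L f \<in> G)"

definition R0_nonneg :: "'l pframe \<Rightarrow> (real set \<Rightarrow> 'l) \<Rightarrow> bool"
  where "R0_nonneg L g \<longleftrightarrow> R0_sup L g (R0_zero L) = g"

definition truncated_elements :: "'l pframe \<Rightarrow> (real set \<Rightarrow> 'l) set \<Rightarrow> (real set \<Rightarrow> 'l) set"
  where "truncated_elements L G = {R0_trunc L g |g. g \<in> G \<and> R0_nonneg L g}"

text \<open>
  \<open>\<mu>\<close> is an isomorphism from the trunc \<open>'a\<close> with truncation \<open>t\<close> onto \<open>G\<close>
  with the trunc operations of \<open>R0 L\<close>.
\<close>

definition trunc_iso_onto ::
  "('a::{ordered_real_vector, lattice} \<Rightarrow> 'a) \<Rightarrow> 'l pframe \<Rightarrow> (real set \<Rightarrow> 'l) set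
    \<Rightarrow> ('a \<Rightarrow> real set \<Rightarrow> 'l) \<Rightarrow> bool"
  where "trunc_iso_onto t L G \<mu> \<longleftrightarrow>
    bij_betw \<mu> UNIV G \<and>
    (\<forall>g h. \<mu> (g + h) = R0_add L (\<mu> g) (\<mu> h)) \<and>
    (\<forall>c g. \<mu> (c *\<^sub>R g) = R0_scale L c (\<mu> g)) \<and>
    (\<forall>g h. \<mu> (sup_class.sup g h) = R0_sup L (\<mu> g) (\<mu> h)) \<and>
    (\<forall>g h. \<mu> (inf_class.inf g h) = R0_inf L (\<mu> g) (\<mu> h)) \<and>
    (\<forall>g\<ge>0. \<mu> (t g) = R0_trunc L (\<mu> g))"


section \<open>Compactifications\<close>

record ('m, 'l) pframe_arrow =
  src :: "'m pframe"
  tgt :: "'l pframe"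
  arr :: "'m \<Rightarrow> 'l"

definition compactification :: "('m, 'l) pframe_arrow \<Rightarrow> bool"
  where "compactification q \<longleftrightarrow>
    pointed_frame (src q) \<and> pointed_frame (tgt q) \<and>
    arr q \<in> pframe_homs (src q) (tgt q) \<and>
    arr q ` carrier (src q) = carrier (tgt q) \<and>
    (\<forall>x\<in>carrier (src q). arr q x = \<bottom>\<^bsub>tgt q\<^esub> \<longrightarrow> x = \<bottom>\<^bsub>src q\<^esub>) \<and>
    compact_frame (src q) \<and> regular_frame (src q)"

definition right_adjoint :: "('m, 'l) pframe_arrow \<Rightarrow> 'l \<Rightarrow> 'm"
  where "right_adjoint q x = \<Squnion>\<^bsub>src q\<^esub>{y \<in> carrier (src q). arr q y \<sqsubseteq>\<^bsub>tgt q\<^esub> x}"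

definition assoc_sublocale :: "('m, 'l) pframe_arrow \<Rightarrow> 'm set"
  where "assoc_sublocale q = right_adjoint q ` carrier (tgt q)"

definition suitable :: "('m, 'l) pframe_arrow \<Rightarrow> bool"
  where "suitable q \<longleftrightarrow>
    assoc_sublocale q =
      \<Inter>{open_sublocale (src q) y |y.
          cozero_element (src q) y \<and> assoc_sublocale q \<subseteq> open_sublocale (src q) y}"

definition compactification_homs ::
  "('m, 'l) pframe_arrow \<Rightarrow> ('n, 'k) pframe_arrow \<Rightarrow> (('m \<Rightarrow> 'n) \<times> ('l \<Rightarrow> 'k)) set"
  where "compactification_homs q r =
    {(l, m). l \<in> pframe_homs (src q) (src r) \<and> m \<in> pframe_homs (tgt q) (tgt r) \<and>
       compose (carrier (src q)) m (arr q) = compose (carrier (src q)) (arr r) l}"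

definition compactification_isos ::
  "('m, 'l) pframe_arrow \<Rightarrow> ('n, 'k) pframe_arrow \<Rightarrow> (('m \<Rightarrow> 'n) \<times> ('l \<Rightarrow> 'k)) set"
  where "compactification_isos q r =
    {(l, m) \<in> compactification_homs q r. \<exists>(l', m') \<in> compactification_homs r q.
       (\<forall>x\<in>carrier (src q). l' (l x) = x) \<and> (\<forall>y\<in>carrier (src r). l (l' y) = y) \<and>
       (\<forall>x\<in>carrier (tgt q). m' (m x) = x) \<and> (\<forall>y\<in>carrier (tgt r). m (m' y) = y)}"


section \<open>Snugly embedded truncs\<close>

definition D0 :: "'m pframe \<Rightarrow> (ereal set \<Rightarrow> 'm) set"
  where "D0 M = {h \<in> pframe_homs O_ereal M. dense_element M (h {-\<infinity><..<\<infinity>})}"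

definition extends ::
  "('m, 'l) pframe_arrow \<Rightarrow> (ereal set \<Rightarrow> 'm) \<Rightarrow> (real set \<Rightarrow> 'l) \<Rightarrow> bool"
  where "extends q h' h \<longleftrightarrow>
    h' \<in> D0 (src q) \<and>
    compose (carrier O_ereal) (arr q) h' = compose (carrier O_ereal) h finite_part"

definition E0 :: "('m, 'l) pframe_arrow \<Rightarrow> (real set \<Rightarrow> 'l) set"
  where "E0 q = {h \<in> R0 (tgt q). \<exists>h'. extends q h' h}"

text \<open>
  The element \<open>h'\<close> corresponding to \<open>h \<in> E0 q\<close>; it is unique when \<open>q\<close> is a compactification,
  since a dense frame homomorphism identifies no two homomorphisms from a regular frame.
\<close>

definition extension :: "('m, 'l) pframe_arrow \<Rightarrow> (real set \<Rightarrow> 'l) \<Rightarrow> ereal set \<Rightarrow> 'm"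
  where "extension q h = (THE h'. extends q h' h)"

definition E0_map ::
  "('m \<Rightarrow> 'n) \<times> ('l \<Rightarrow> 'k) \<Rightarrow> (real set \<Rightarrow> 'l) \<Rightarrow> real set \<Rightarrow> 'k"
  where "E0_map lm h = compose (carrier O_real) (snd lm) h"

definition coz_element :: "('m, 'l) pframe_arrow \<Rightarrow> (real set \<Rightarrow> 'l) \<Rightarrow> 'm"
  where "coz_element q g = extension q g {0<..}"

definition con_element :: "('m, 'l) pframe_arrow \<Rightarrow> (real set \<Rightarrow> 'l) \<Rightarrow> 'm"
  where "con_element q g = extension q g {..<1}"

definition snugly_embedded :: "('m, 'l) pframe_arrow \<Rightarrow> (real set \<Rightarrow> 'l) set \<Rightarrow> bool"
  where "snugly_embedded q G \<longleftrightarrow>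
    G \<subseteq> E0 q \<and> R0_closed (tgt q) G \<and>
    (\<forall>x\<in>carrier (src q).
       \<exists>A \<subseteq> coz_element q ` truncated_elements (tgt q) G
            \<union> con_element q ` truncated_elements (tgt q) G.
         x = \<Squnion>\<^bsub>src q\<^esub>A) \<and>
    assoc_sublocale q = (\<Inter>g\<in>G. open_sublocale (src q) (extension q g {-\<infinity><..<\<infinity>}))"

definition trunc_representation ::
  "('a::{ordered_real_vector, lattice} \<Rightarrow> 'a) \<Rightarrow> ('m, 'l) pframe_arrow
    \<Rightarrow> (real set \<Rightarrow> 'l) set \<Rightarrow> ('a \<Rightarrow> real set \<Rightarrow> 'l) \<Rightarrow> bool"
  where "trunc_representation t q Ghat \<mu> \<longleftrightarrow>
    compactification q \<and> suitable q \<and> snugly_embedded q Ghat \<and>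
    trunc_iso_onto t (tgt q) Ghat \<mu>"

text \<open>
  Quantification over frames has to be over frames carried by subsets of some type. For the
  existence of a representation of the trunc \<open>'a\<close> the type \<open>('a \<Rightarrow> ereal) set\<close> is used. It only
  bounds the size of the carriers: \<open>M\<close> is join-generated by the elements \<open>coz g\<close> and \<open>con g\<close>,
  so it has no more elements than \<open>'a\<close> has pairs of subsets, and \<open>L\<close> is a quotient of \<open>M\<close>.
\<close>

type_synonym 'a rep_carrier = "('a \<Rightarrow> ereal) set"

end

theory Submission
  imports Defs
begin

text \<open>
  Functoriality rests on two conditions that can be read off from the trunc and are preserved by
  truncation homomorphisms: for \<open>g, h \<ge> 0\<close>, \<open>coz g\<close> and \<open>con h\<close> cover \<open>M\<close> iff
  \<open>t (r h - t (r h)) \<le> n g\<close> for some \<open>r > 1\<close> and \<open>n > 0\<close>, and they are disjoint iff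
  \<open>t (n g) \<le> h\<close> for all \<open>n > 0\<close>. Hence \<open>coz g \<mapsto> coz (\<theta> g)\<close>, \<open>con h \<mapsto> con (\<theta> h)\<close> preserves finite
  covers and finite disjoint families, and as the \<open>coz g\<close> and \<open>con h\<close> form a base of the compact
  regular frame \<open>M\<close>, it extends to a frame homomorphism \<open>l : M \<rightarrow> N\<close>. It sends each \<open>g' (-\<infinity>, \<infinity>)\<close> to
  \<open>(\<theta> g)' (-\<infinity>, \<infinity>)\<close>, so \<open>r \<circ> l\<close> factors through \<open>q\<close>. Uniqueness up to isomorphism is the case
  \<open>\<theta> = id\<close>.

  For existence, \<open>M\<close> is the frame of open sets of the space \<open>X\<close> of all maps from the trunc to
  \<open>[-\<infinity>, \<infinity>]\<close> that preserve the trunc operations, addition only as far as it is defined. It is compact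
  by Tychonoff's theorem, and totally ordered quotients by prime ideals show that \<open>X\<close> separates the
  elements of the trunc. The archimedean property then makes each set where \<open>g\<close> is finite dense, and
  \<open>L\<close> is the intersection of the corresponding open sublocales.
\<close>

section \<open>Frames\<close>

text \<open>A trunc need not contain the constant 1, so the level 1 is reached through truncation:
  for h \<ge> 0 the excess \<open>h - t h\<close> is positive exactly where h exceeds 1, and a
  truncated element is real valued, so that a difference such as \<open>t g - h\<close> is defined
  at every point of X. The point of the frame does part of the work of the missing unit. It lies in
  every con and in no coz, so a finite cover by generators contains a con and a finite disjoint
  family contains a coz. Joins and meets with such a member are the only ones that have to be
  brought to one coz and one con. Inside M there is a further obstacle: q is dense, but it reflects
  an inequality only if the right-hand side is enlarged to an element that it is rather below. The
  extensions g' are therefore compared at neighbouring levels of open rays, and the levels are then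
  moved together. The slack r > 1 in the cover criterion is a gap of this kind, supplied by
  compactness. In the disjointness criterion all truncated multiples of g together stand in for the
  characteristic function of coz g.\<close>

context frame
begin

lemma le_meet_iff:
  assumes "x \<in> carrier L" "y \<in> carrier L" "z \<in> carrier L"
  shows "z \<sqsubseteq> x \<sqinter> y \<longleftrightarrow> z \<sqsubseteq> x \<and> z \<sqsubseteq> y"
  using assms by (meson le_trans meet_closed meet_le meet_left meet_right)

lemma join_le_iff:
  assumes "x \<in> carrier L" "y \<in> carrier L" "z \<in> carrier L"
  shows "x \<squnion> y \<sqsubseteq> z \<longleftrightarrow> x \<sqsubseteq> z \<and> y \<sqsubseteq> z"
  using assms by (meson le_trans join_closed join_le join_left join_right)

lemma sup_le_iff:
  assumes "A \<subseteq> carrier L" "z \<in> carrier L"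
  shows "\<Squnion>A \<sqsubseteq> z \<longleftrightarrow> (\<forall>a\<in>A. a \<sqsubseteq> z)"
  using assms by (meson le_trans sup_closed sup_least sup_upper subsetD)

lemma sup_eqI:
  assumes "A \<subseteq> carrier L" "z \<in> carrier L" "\<And>a. a \<in> A \<Longrightarrow> a \<sqsubseteq> z"
    "\<And>y. y \<in> carrier L \<Longrightarrow> (\<And>a. a \<in> A \<Longrightarrow> a \<sqsubseteq> y) \<Longrightarrow> z \<sqsubseteq> y"
  shows "\<Squnion>A = z"
  using assms by (meson le_antisym sup_closed sup_least sup_upper)

lemma le_bot_iff: "x \<in> carrier L \<Longrightarrow> x \<sqsubseteq> \<bottom> \<longleftrightarrow> x = \<bottom>"
  by (meson bottom_closed bottom_lower le_antisym le_refl)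

lemma top_le_iff: "x \<in> carrier L \<Longrightarrow> \<top> \<sqsubseteq> x \<longleftrightarrow> x = \<top>"
  by (meson top_closed top_higher le_antisym le_refl)

lemma sup_empty_eq: "\<Squnion>{} = \<bottom>"
  by (rule sup_eqI) auto

lemma meet_top: "x \<in> carrier L \<Longrightarrow> x \<sqinter> \<top> = x"
  by (meson le_antisym le_refl meet_closed meet_le meet_left top_closed top_higher)

lemma meet_bot: "x \<in> carrier L \<Longrightarrow> x \<sqinter> \<bottom> = \<bottom>"
  by (meson bottom_closed le_bot_iff meet_closed meet_right)

lemma meet_absorb: "x \<in> carrier L \<Longrightarrow> y \<in> carrier L \<Longrightarrow> x \<sqinter> y = x \<longleftrightarrow> x \<sqsubseteq> y"
  using meet_right[of x y] by (auto intro!: le_antisym[of "x \<sqinter> y" x] meet_le meet_left)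

lemma join_absorb: "x \<in> carrier L \<Longrightarrow> y \<in> carrier L \<Longrightarrow> x \<squnion> y = y \<longleftrightarrow> x \<sqsubseteq> y"
  using join_left[of x y] by (auto intro!: le_antisym[of "x \<squnion> y" y] join_le join_right)

lemma meet_mono:
  assumes "x \<in> carrier L" "y \<in> carrier L" "x' \<in> carrier L" "y' \<in> carrier L"
    "x \<sqsubseteq> x'" "y \<sqsubseteq> y'"
  shows "x \<sqinter> y \<sqsubseteq> x' \<sqinter> y'"
  using assms
  by (intro meet_le le_trans[OF meet_left] le_trans[OF meet_right]) auto

lemma join_mono:
  assumes "x \<in> carrier L" "y \<in> carrier L" "x' \<in> carrier L" "y' \<in> carrier L"
    "x \<sqsubseteq> x'" "y \<sqsubseteq> y'"
  shows "x \<squnion> y \<sqsubseteq> x' \<squnion> y'"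
  using assms
  by (intro join_le le_trans[OF _ join_left] le_trans[OF _ join_right]) auto

lemma meet_sup_le:
  assumes "x \<in> carrier L" "A \<subseteq> carrier L" "z \<in> carrier L"
    and "\<And>a. a \<in> A \<Longrightarrow> x \<sqinter> a \<sqsubseteq> z"
  shows "x \<sqinter> \<Squnion>A \<sqsubseteq> z"
proof -
  have "(\<lambda>a. x \<sqinter> a) ` A \<subseteq> carrier L" using assms by auto
  then show ?thesis
    using assms meet_sup_distrib[of x A] by (simp add: sup_le_iff)
qed

lemma sup_meet_sup_le:
  assumes "A \<subseteq> carrier L" "B \<subseteq> carrier L" "z \<in> carrier L"
    and "\<And>a b. a \<in> A \<Longrightarrow> b \<in> B \<Longrightarrow> a \<sqinter> b \<sqsubseteq> z"
  shows "\<Squnion>A \<sqinter> \<Squnion>B \<sqsubseteq> z"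
proof (rule meet_sup_le)
  fix b assume b: "b \<in> B"
  have "b \<sqinter> \<Squnion>A \<sqsubseteq> z"
  proof (rule meet_sup_le)
    show "b \<sqinter> a \<sqsubseteq> z" if "a \<in> A" for a
      using assms(4)[OF that b] by (simp add: meet_comm)
  qed (use assms b in auto)
  then show "\<Squnion>A \<sqinter> b \<sqsubseteq> z" by (simp add: meet_comm)
qed (use assms in auto)

lemma meet_join_distrib:
  assumes "x \<in> carrier L" "y \<in> carrier L" "z \<in> carrier L"
  shows "x \<sqinter> (y \<squnion> z) = (x \<sqinter> y) \<squnion> (x \<sqinter> z)"
  using assms meet_sup_distrib[of x "{y, z}"] by (simp add: join_def)

lemma join_meet_distrib:
  assumes "x \<in> carrier L" "y \<in> carrier L" "z \<in> carrier L"
  shows "(y \<squnion> z) \<sqinter> x = (y \<sqinter> x) \<squnion> (z \<sqinter> x)"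
  using meet_join_distrib[OF assms] by (simp add: meet_comm)

text \<open>Meet x with the top, written as w \<squnion> z, and the part inside w disappears. Most
  inequalities below are obtained in this way from one disjointness and one cover.\<close>

lemma cut:
  assumes "x \<in> carrier L" "w \<in> carrier L" "z \<in> carrier L"
    and "x \<sqinter> w = \<bottom>" "w \<squnion> z = \<top>"
  shows "x \<sqsubseteq> z"
proof -
  have "x = x \<sqinter> (w \<squnion> z)" using assms by (simp add: meet_top)
  also have "\<dots> = (x \<sqinter> w) \<squnion> (x \<sqinter> z)" using assms by (intro meet_join_distrib)
  also have "\<dots> \<sqsubseteq> z" using assms by (simp add: join_le_iff meet_right)
  finally show ?thesis .
qed

lemma himp_closed [simp]: "himp L y x \<in> carrier L"
  unfolding himp_def by (intro sup_closed) auto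

lemma le_himp_iff:
  assumes "x \<in> carrier L" "y \<in> carrier L" "u \<in> carrier L"
  shows "u \<sqsubseteq> himp L y x \<longleftrightarrow> u \<sqinter> y \<sqsubseteq> x"
proof
  let ?A = "{z \<in> carrier L. z \<sqinter> y \<sqsubseteq> x}"
  assume "u \<sqsubseteq> himp L y x"
  then have "y \<sqinter> u \<sqsubseteq> y \<sqinter> himp L y x"
    using assms by (intro meet_mono) auto
  then have "u \<sqinter> y \<sqsubseteq> y \<sqinter> \<Squnion>?A"
    by (simp add: meet_comm himp_def)
  moreover have "y \<sqinter> \<Squnion>?A \<sqsubseteq> x"
    using assms by (intro meet_sup_le) (auto simp: meet_comm)
  ultimately show "u \<sqinter> y \<sqsubseteq> x"
    using assms by (elim le_trans) (auto intro!: meet_closed sup_closed)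
next
  assume "u \<sqinter> y \<sqsubseteq> x"
  then show "u \<sqsubseteq> himp L y x"
    unfolding himp_def using assms by (intro sup_upper) auto
qed

text \<open>The values of \<open>himp L y\<close> are its fixed points. Membership thus becomes a
  closure condition that can be checked without computing an implication.\<close>

lemma mem_open_sublocale_iff:
  assumes "y \<in> carrier L"
  shows "z \<in> open_sublocale L y \<longleftrightarrow>
    z \<in> carrier L \<and> (\<forall>u\<in>carrier L. u \<sqinter> y \<sqsubseteq> z \<longrightarrow> u \<sqsubseteq> z)"
proof
  assume "z \<in> open_sublocale L y"
  then obtain x where x: "x \<in> carrier L" "z = himp L y x"
    by (auto simp: open_sublocale_def)
  have "u \<sqsubseteq> z" if "u \<in> carrier L" "u \<sqinter> y \<sqsubseteq> z" for u
  proof -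
    have "(u \<sqinter> y) \<sqinter> y \<sqsubseteq> x" using that x assms le_himp_iff[of x y "u \<sqinter> y"] by simp
    moreover have "(u \<sqinter> y) \<sqinter> y = u \<sqinter> y"
      using assms that meet_absorb[of "u \<sqinter> y" y] by (simp add: meet_right)
    ultimately show ?thesis using x that assms by (simp add: le_himp_iff)
  qed
  then show "z \<in> carrier L \<and> (\<forall>u\<in>carrier L. u \<sqinter> y \<sqsubseteq> z \<longrightarrow> u \<sqsubseteq> z)"
    using x by simp
next
  assume z: "z \<in> carrier L \<and> (\<forall>u\<in>carrier L. u \<sqinter> y \<sqsubseteq> z \<longrightarrow> u \<sqsubseteq> z)"
  have zC: "z \<in> carrier L" using z by blast
  have "himp L y z \<sqinter> y \<sqsubseteq> z" using le_himp_iff[of z y "himp L y z"] zC assms by simp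
  then have "himp L y z \<sqsubseteq> z" using z himp_closed by blast
  moreover have "z \<sqsubseteq> himp L y z" using zC assms by (simp add: le_himp_iff meet_left)
  ultimately have "z = himp L y z" using zC by (intro le_antisym) auto
  then show "z \<in> open_sublocale L y" using zC by (auto simp: open_sublocale_def)
qed

text \<open>The pseudocomplement of y is the largest element disjoint from y, so any other disjoint
  w that covers together with x is as good a witness.\<close>

lemma rather_below_iff:
  assumes "x \<in> carrier L" "y \<in> carrier L"
  shows "rather_below L y x \<longleftrightarrow> (\<exists>w\<in>carrier L. w \<sqinter> y = \<bottom> \<and> w \<squnion> x = \<top>)"
proof
  assume "rather_below L y x"
  moreover have "himp L y \<bottom> \<sqinter> y = \<bottom>"
    using assms le_himp_iff[of "\<bottom>" y "himp L y \<bottom>"] by (simp add: le_bot_iff)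
  ultimately show "\<exists>w\<in>carrier L. w \<sqinter> y = \<bottom> \<and> w \<squnion> x = \<top>"
    using himp_closed unfolding rather_below_def by blast
next
  assume "\<exists>w\<in>carrier L. w \<sqinter> y = \<bottom> \<and> w \<squnion> x = \<top>"
  then obtain w where w: "w \<in> carrier L" "w \<sqinter> y = \<bottom>" "w \<squnion> x = \<top>" by auto
  then have "w \<sqsubseteq> himp L y \<bottom>" using assms by (simp add: le_himp_iff)
  then have "w \<squnion> x \<sqsubseteq> himp L y \<bottom> \<squnion> x"
    using assms w by (intro join_mono) auto
  then show "rather_below L y x"
    unfolding rather_below_def using assms w by (simp add: top_le_iff)
qed

lemma rather_belowI:
  assumes "x \<in> carrier L" "y \<in> carrier L" "w \<in> carrier L" "w \<sqinter> y = \<bottom>" "w \<squnion> x = \<top>"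
  shows "rather_below L y x"
  using assms rather_below_iff by blast

lemma rather_belowE:
  assumes "rather_below L y x" "x \<in> carrier L" "y \<in> carrier L"
  obtains w where "w \<in> carrier L" "w \<sqinter> y = \<bottom>" "w \<squnion> x = \<top>"
  using assms rather_below_iff by blast

lemma rather_below_le:
  assumes "rather_below L y x" "x \<in> carrier L" "y \<in> carrier L"
  shows "y \<sqsubseteq> x"
  by (rule rather_belowE[OF assms]) (metis assms cut meet_comm)

lemma rather_below_mono:
  assumes "rather_below L y x" "y' \<sqsubseteq> y" "x \<sqsubseteq> x'"
    and C: "x \<in> carrier L" "y \<in> carrier L" "x' \<in> carrier L" "y' \<in> carrier L"
  shows "rather_below L y' x'"
proof -
  obtain w where w: "w \<in> carrier L" "w \<sqinter> y = \<bottom>" "w \<squnion> x = \<top>"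
    using rather_belowE assms by metis
  have "w \<sqinter> y' \<sqsubseteq> w \<sqinter> y" "w \<squnion> x \<sqsubseteq> w \<squnion> x'"
    using assms w by (intro meet_mono join_mono; simp)+
  then show ?thesis
    using w C by (intro rather_belowI[of _ _ w]) (auto simp: le_bot_iff top_le_iff)
qed

text \<open>The join of the two witnesses serves: it is disjoint from the meet of y and y', and the
  cover results from distributing the meet of the two given covers.\<close>

lemma rather_below_meet:
  assumes "rather_below L y x" "rather_below L y' x'"
    and C: "x \<in> carrier L" "y \<in> carrier L" "x' \<in> carrier L" "y' \<in> carrier L"
  shows "rather_below L (y \<sqinter> y') (x \<sqinter> x')"
proof -
  obtain w where w: "w \<in> carrier L" "w \<sqinter> y = \<bottom>" "w \<squnion> x = \<top>"
    using rather_belowE assms by metis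
  obtain v where v: "v \<in> carrier L" "v \<sqinter> y' = \<bottom>" "v \<squnion> x' = \<top>"
    using rather_belowE assms by metis
  let ?u = "w \<squnion> v"
  show ?thesis
  proof (rule rather_belowI[of _ _ ?u])
    have 1: "w \<sqinter> (y \<sqinter> y') \<sqsubseteq> w \<sqinter> y" "v \<sqinter> (y \<sqinter> y') \<sqsubseteq> v \<sqinter> y'"
      using C w v by (intro meet_mono; simp add: meet_left meet_right)+
    then have 2: "w \<sqinter> (y \<sqinter> y') = \<bottom>" "v \<sqinter> (y \<sqinter> y') = \<bottom>"
      using C w v by (simp_all add: le_bot_iff)
    have "?u \<sqinter> (y \<sqinter> y') \<sqsubseteq> \<bottom>"
      using join_meet_distrib[of "y \<sqinter> y'" w v] 2 C w v
      by (simp add: join_le_iff)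
    then show "?u \<sqinter> (y \<sqinter> y') = \<bottom>" using C w v by (simp add: le_bot_iff)
    let ?z = "?u \<squnion> x \<sqinter> x'"
    have z: "?z \<in> carrier L" using C w v by simp
    have "x \<sqinter> x' \<sqsubseteq> ?z" using C w v by (simp add: join_right)
    moreover have "w \<sqsubseteq> ?z" "v \<sqsubseteq> ?z" using C w v z
      by (meson join_closed join_left join_right le_trans meet_closed)+
    ultimately have *: "x \<sqinter> x' \<sqsubseteq> ?z" "w \<sqsubseteq> ?z" "v \<sqsubseteq> ?z" by auto
    have "\<top> = (w \<squnion> x) \<sqinter> (v \<squnion> x')" using w v by (simp add: meet_top)
    also have "\<dots> = \<Squnion>{w, x} \<sqinter> \<Squnion>{v, x'}" by (simp add: join_def)
    also have "\<dots> \<sqsubseteq> ?z"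
    proof (rule sup_meet_sup_le)
      show "a \<sqinter> b \<sqsubseteq> ?z" if "a \<in> {w, x}" "b \<in> {v, x'}" for a b
        using that * C w v z
        by (elim insertE emptyE) (auto intro: le_trans[OF meet_left] le_trans[OF meet_right])
    qed (use C w v in auto)
    finally show "?z = \<top>" using z by (simp add: top_le_iff)
  qed (use C w v in auto)
qed

lemma rather_below_top: "x \<in> carrier L \<Longrightarrow> rather_below L x \<top>"
  by (rule rather_belowI[of _ _ "\<bottom>"]) (auto simp: meet_bot meet_comm top_le_iff[symmetric] join_right)

lemma rather_below_join:
  assumes "rather_below L y x" "rather_below L y' x"
    and C: "x \<in> carrier L" "y \<in> carrier L" "y' \<in> carrier L"
  shows "rather_below L (y \<squnion> y') x"
proof -
  obtain w where w: "w \<in> carrier L" "w \<sqinter> y = \<bottom>" "w \<squnion> x = \<top>"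
    using rather_belowE assms by metis
  obtain v where v: "v \<in> carrier L" "v \<sqinter> y' = \<bottom>" "v \<squnion> x = \<top>"
    using rather_belowE assms by metis
  show ?thesis
  proof (rule rather_belowI[of _ _ "w \<sqinter> v"])
    have "(w \<sqinter> v) \<sqinter> y \<sqsubseteq> w \<sqinter> y" "(w \<sqinter> v) \<sqinter> y' \<sqsubseteq> v \<sqinter> y'"
      using C w v by (intro meet_mono; simp add: meet_left meet_right)+
    then have 2: "(w \<sqinter> v) \<sqinter> y = \<bottom>" "(w \<sqinter> v) \<sqinter> y' = \<bottom>"
      using C w v by (simp_all add: le_bot_iff)
    then have "(w \<sqinter> v) \<sqinter> (y \<squnion> y') \<sqsubseteq> \<bottom>"
      using meet_join_distrib[of "w \<sqinter> v" y y'] C w v by (simp add: join_le_iff)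
    then show "(w \<sqinter> v) \<sqinter> (y \<squnion> y') = \<bottom>" using C w v by (simp add: le_bot_iff)
    let ?z = "w \<sqinter> v \<squnion> x"
    have z: "?z \<in> carrier L" using C w v by simp
    have *: "w \<sqinter> v \<sqsubseteq> ?z" "x \<sqsubseteq> ?z" using C w v by (auto intro: join_left join_right)
    have "\<top> = (w \<squnion> x) \<sqinter> (v \<squnion> x)" using w v by (simp add: meet_top)
    also have "\<dots> = \<Squnion>{w, x} \<sqinter> \<Squnion>{v, x}" by (simp add: join_def)
    also have "\<dots> \<sqsubseteq> ?z"
    proof (rule sup_meet_sup_le)
      show "a \<sqinter> b \<sqsubseteq> ?z" if "a \<in> {w, x}" "b \<in> {v, x}" for a b
        using that * C w v z
        by (elim insertE emptyE) (auto intro: le_trans[OF meet_left] le_trans[OF meet_right])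
    qed (use C w v in auto)
    finally show "?z = \<top>" using z by (simp add: top_le_iff)
  qed (use C w v in auto)
qed

end

section \<open>Frame homomorphisms\<close>

locale frame_morphism = L: frame L + M: frame M
  for L (structure) and M (structure) and f +
  assumes hom: "frame_hom L M f"
begin

lemma map_closed [simp]: "x \<in> carrier L \<Longrightarrow> f x \<in> carrier M"
  using hom by (auto simp: frame_hom_def)

lemma map_top: "f \<top> = \<top>\<^bsub>M\<^esub>"
  using hom by (auto simp: frame_hom_def)

lemma map_meet: "x \<in> carrier L \<Longrightarrow> y \<in> carrier L \<Longrightarrow> f (x \<sqinter> y) = f x \<sqinter>\<^bsub>M\<^esub> f y"
  using hom by (auto simp: frame_hom_def)

lemma map_sup: "A \<subseteq> carrier L \<Longrightarrow> f (\<Squnion>A) = \<Squnion>\<^bsub>M\<^esub>(f ` A)"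
  using hom by (auto simp: frame_hom_def)

lemma map_bot: "f \<bottom> = \<bottom>\<^bsub>M\<^esub>"
  using map_sup[of "{}"] by (simp add: L.sup_empty_eq M.sup_empty_eq)

lemma map_join: "x \<in> carrier L \<Longrightarrow> y \<in> carrier L \<Longrightarrow> f (x \<squnion> y) = f x \<squnion>\<^bsub>M\<^esub> f y"
  using map_sup[of "{x, y}"] by (simp add: join_def)

lemma map_mono:
  assumes "x \<in> carrier L" "y \<in> carrier L" "x \<sqsubseteq> y"
  shows "f x \<sqsubseteq>\<^bsub>M\<^esub> f y"
proof -
  have "x \<sqinter> y = x" using assms L.meet_absorb by blast
  then have "f x \<sqinter>\<^bsub>M\<^esub> f y = f x" using assms map_meet[of x y] by simp
  then show ?thesis using assms M.meet_absorb[of "f x" "f y"] by simp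
qed

text \<open>A dense homomorphism reflects disjointness, though not the order. From the inequality of
  the images, x is disjoint from every w that is disjoint from y, and \<open>cut\<close> puts x
  below z. The gap between y and z is the price.\<close>

lemma dense_reflects_le:
  assumes dense: "\<And>x. x \<in> carrier L \<Longrightarrow> f x = \<bottom>\<^bsub>M\<^esub> \<Longrightarrow> x = \<bottom>"
    and C: "x \<in> carrier L" "y \<in> carrier L" "z \<in> carrier L"
    and le: "f x \<sqsubseteq>\<^bsub>M\<^esub> f y" and "rather_below L y z"
  shows "x \<sqsubseteq> z"
proof -
  obtain w where w: "w \<in> carrier L" "w \<sqinter> y = \<bottom>" "w \<squnion> z = \<top>"
    using L.rather_belowE assms by metis
  have "f (x \<sqinter> w) = f w \<sqinter>\<^bsub>M\<^esub> f x" using C w by (simp add: map_meet meet_comm)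
  also have "\<dots> \<sqsubseteq>\<^bsub>M\<^esub> f w \<sqinter>\<^bsub>M\<^esub> f y" using C w le by (intro M.meet_mono) auto
  also have "f w \<sqinter>\<^bsub>M\<^esub> f y = \<bottom>\<^bsub>M\<^esub>" using C w map_meet[of w y] by (simp add: map_bot)
  finally have "f (x \<sqinter> w) = \<bottom>\<^bsub>M\<^esub>" using C w by (simp add: M.le_bot_iff)
  then have "x \<sqinter> w = \<bottom>" using C w dense by simp
  then show ?thesis using L.cut w C by blast
qed

end

lemma frame_hom_compose:
  assumes "frame_hom L M f" "frame_hom M N g"
  shows "frame_hom L N (\<lambda>x. g (f x))"
proof -
  have *: "f ` A \<subseteq> carrier M" if "A \<subseteq> carrier L" for A
    using assms that by (auto simp: frame_hom_def)
  show ?thesis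
    using assms * unfolding frame_hom_def by (auto simp: Pi_iff image_image)
qed

lemma frame_hom_restrict:
  assumes "frame L" "frame_hom L M f"
  shows "frame_hom L M (restrict f (carrier L))"
proof -
  interpret frame L by fact
  have "restrict f (carrier L) ` A = f ` A" if "A \<subseteq> carrier L" for A
    using that by (intro image_cong) auto
  then show ?thesis using assms(2) by (auto simp: frame_hom_def)
qed

text \<open>Closure under unions and binary intersections is enough: an infinite meet is the union
  of all members below, not the intersection.\<close>

lemma set_frame:
  fixes L :: "('a set, 'b) gorder_scheme"
  assumes carrier: "carrier L = S" and eq: "eq L = (=)" and le: "le L = (\<subseteq>)"
    and Union: "\<And>A. A \<subseteq> S \<Longrightarrow> \<Union>A \<in> S"
    and Int: "\<And>U V. U \<in> S \<Longrightarrow> V \<in> S \<Longrightarrow> U \<inter> V \<in> S"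
    and top: "X \<in> S" "\<And>U. U \<in> S \<Longrightarrow> U \<subseteq> X"
  shows "frame L" "\<And>A. A \<subseteq> S \<Longrightarrow> \<Squnion>\<^bsub>L\<^esub>A = \<Union>A"
    "\<And>U V. U \<in> S \<Longrightarrow> V \<in> S \<Longrightarrow> U \<sqinter>\<^bsub>L\<^esub> V = U \<inter> V"
    "\<And>U V. U \<in> S \<Longrightarrow> V \<in> S \<Longrightarrow> U \<squnion>\<^bsub>L\<^esub> V = U \<union> V"
    "\<top>\<^bsub>L\<^esub> = X" "\<bottom>\<^bsub>L\<^esub> = {}"
proof -
  interpret partial_order L
    by unfold_locales (auto simp: carrier eq le)
  interpret complete_lattice L
  proof
    fix A assume A: "A \<subseteq> carrier L"
    let ?B = "\<Union>{U \<in> S. \<forall>a\<in>A. U \<subseteq> a}"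
    have 1: "\<Union>A \<in> S" and 2: "?B \<in> S"
      using A by (auto intro!: Union simp: carrier)
    have "least L (\<Union>A) (Upper L A)"
      unfolding least_def Upper_def carrier le using A[unfolded carrier] 1
      by (simp add: Sup_upper) blast
    then show "\<exists>s. least L s (Upper L A)" ..
    have "greatest L ?B (Lower L A)"
      unfolding greatest_def Lower_def carrier le using A[unfolded carrier] 2
      by simp blast
    then show "\<exists>i. greatest L i (Lower L A)" ..
  qed
  show sup: "\<Squnion>\<^bsub>L\<^esub>A = \<Union>A" if "A \<subseteq> S" for A
  proof (rule le_antisym)
    show "\<Squnion>\<^bsub>L\<^esub>A \<sqsubseteq>\<^bsub>L\<^esub> \<Union>A" using that Union by (intro sup_least) (auto simp: carrier le)
    show "\<Union>A \<sqsubseteq>\<^bsub>L\<^esub> \<Squnion>\<^bsub>L\<^esub>A" using that sup_upper[of A] by (auto simp: carrier le)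
  qed (use that Union carrier in auto)
  show meet: "U \<sqinter>\<^bsub>L\<^esub> V = U \<inter> V" if "U \<in> S" "V \<in> S" for U V
  proof (rule le_antisym)
    show "U \<sqinter>\<^bsub>L\<^esub> V \<sqsubseteq>\<^bsub>L\<^esub> U \<inter> V" using that meet_left[of U V] meet_right[of U V]
      by (auto simp: carrier le)
    show "U \<inter> V \<sqsubseteq>\<^bsub>L\<^esub> U \<sqinter>\<^bsub>L\<^esub> V" using that Int by (intro meet_le) (auto simp: carrier le)
  qed (use that Int carrier in auto)
  show "U \<squnion>\<^bsub>L\<^esub> V = U \<union> V" if "U \<in> S" "V \<in> S" for U V
    using that sup[of "{U, V}"] by (simp add: join_def)
  show "\<top>\<^bsub>L\<^esub> = X"
    by (rule le_antisym) (use top top_closed top_higher[of X] in \<open>auto simp: carrier le\<close>)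
  show "\<bottom>\<^bsub>L\<^esub> = {}"
    by (rule le_antisym) (use Union[of "{}"] bottom_closed bottom_lower[of "{}"] in \<open>auto simp: carrier le\<close>)
  show "frame L"
  proof
    fix x A assume "x \<in> carrier L" "A \<subseteq> carrier L"
    then have "x \<in> S" "A \<subseteq> S" "\<Union>A \<in> S" "(\<lambda>a. x \<sqinter>\<^bsub>L\<^esub> a) ` A = (\<lambda>a. x \<inter> a) ` A"
      "(\<lambda>a. x \<inter> a) ` A \<subseteq> S"
      using Union Int carrier by (auto simp: meet subset_iff)
    then show "x \<sqinter>\<^bsub>L\<^esub> \<Squnion>\<^bsub>L\<^esub>A = \<Squnion>\<^bsub>L\<^esub>((\<lambda>a. x \<sqinter>\<^bsub>L\<^esub> a) ` A)"
      by (simp add: sup meet)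
  qed
qed

section \<open>Frames of open sets and homomorphisms defined on them\<close>

lemma carrier_opens_at [simp]: "carrier (opens_at x) = {U. open U}"
  by (simp add: opens_at_def)

lemma point_opens_at [simp]: "point (opens_at x) U \<longleftrightarrow> x \<in> U"
  by (simp add: opens_at_def)

lemma
  shows frame_opens_at [simp]: "frame (opens_at x)"
    and sup_opens_at: "\<And>A. \<forall>U\<in>A. open U \<Longrightarrow> \<Squnion>\<^bsub>opens_at x\<^esub>A = \<Union>A"
    and meet_opens_at: "\<And>U V. open U \<Longrightarrow> open V \<Longrightarrow> U \<sqinter>\<^bsub>opens_at x\<^esub> V = U \<inter> V"
    and join_opens_at: "\<And>U V. open U \<Longrightarrow> open V \<Longrightarrow> U \<squnion>\<^bsub>opens_at x\<^esub> V = U \<union> V"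
    and top_opens_at: "\<top>\<^bsub>opens_at x\<^esub> = UNIV"
    and bot_opens_at: "\<bottom>\<^bsub>opens_at x\<^esub> = {}"
    and le_opens_at: "\<And>U V. U \<sqsubseteq>\<^bsub>opens_at x\<^esub> V \<longleftrightarrow> U \<subseteq> V"
proof -
  note * = set_frame[of "opens_at x" "{U. open U}" UNIV]
  show "frame (opens_at x)" by (rule *) (auto simp: opens_at_def)
  show "\<Squnion>\<^bsub>opens_at x\<^esub>A = \<Union>A" if "\<forall>U\<in>A. open U" for A
    by (rule *(2)) (use that in \<open>auto simp: opens_at_def\<close>)
  show "U \<sqinter>\<^bsub>opens_at x\<^esub> V = U \<inter> V" "U \<squnion>\<^bsub>opens_at x\<^esub> V = U \<union> V" if "open U" "open V" for U V
    by (rule *(3) *(4); use that in \<open>auto simp: opens_at_def\<close>)+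
  show "\<top>\<^bsub>opens_at x\<^esub> = UNIV" "\<bottom>\<^bsub>opens_at x\<^esub> = {}"
    by (rule *(5) *(6); auto simp: opens_at_def)+
  show "U \<sqsubseteq>\<^bsub>opens_at x\<^esub> V \<longleftrightarrow> U \<subseteq> V" for U V
    by (simp add: opens_at_def)
qed

locale opens_morphism = frame M for M (structure) and p :: "'x::topological_space" and f +
  assumes opens_hom: "frame_hom (opens_at p) M f"
begin

sublocale mor: frame_morphism "opens_at p" M f
  by (intro frame_morphism.intro frame_morphism_axioms.intro frame_opens_at frame_axioms opens_hom)

lemma map_in [simp]: "open U \<Longrightarrow> f U \<in> carrier M"
  using mor.map_closed by simp

lemma map_UNIV: "f UNIV = \<top>"
  using mor.map_top by (simp add: top_opens_at)

lemma map_empty: "f {} = \<bottom>"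
  using mor.map_bot by (simp add: bot_opens_at)

lemma map_Int: "open U \<Longrightarrow> open V \<Longrightarrow> f (U \<inter> V) = f U \<sqinter> f V"
  using mor.map_meet[of U V] by (simp add: meet_opens_at)

lemma map_Un: "open U \<Longrightarrow> open V \<Longrightarrow> f (U \<union> V) = f U \<squnion> f V"
  using mor.map_join[of U V] by (simp add: join_opens_at)

lemma map_Union: "\<forall>U\<in>A. open U \<Longrightarrow> f (\<Union>A) = \<Squnion>(f ` A)"
  using mor.map_sup[of A] by (auto simp: sup_opens_at subset_iff)

lemma map_subset: "open U \<Longrightarrow> open V \<Longrightarrow> U \<subseteq> V \<Longrightarrow> f U \<sqsubseteq> f V"
  using mor.map_mono[of U V] by (auto simp: le_opens_at)

end

lemma frame_hom_opensI:
  assumes M: "frame M" and f: "\<And>U. open U \<Longrightarrow> f U \<in> carrier M"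
    and "f UNIV = \<top>\<^bsub>M\<^esub>" "\<And>U V. open U \<Longrightarrow> open V \<Longrightarrow> f (U \<inter> V) = f U \<sqinter>\<^bsub>M\<^esub> f V"
    and "\<And>A. \<forall>U\<in>A. open U \<Longrightarrow> f (\<Union>A) = \<Squnion>\<^bsub>M\<^esub>(f ` A)"
  shows "frame_hom (opens_at p) M f"
  unfolding frame_hom_def using assms
  by (auto simp: top_opens_at meet_opens_at sup_opens_at subset_iff)

locale order_morphism = opens_morphism M p f
  for M (structure) and p :: "'x::{linorder_topology, dense_linorder}" and f
begin

lemma map_greaterThan_disjoint: "b \<le> a \<Longrightarrow> f {a<..} \<sqinter> f {..<b} = \<bottom>"
proof -
  assume "b \<le> a"
  then have "{a<..} \<inter> {..<b} = {}" by auto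
  then show ?thesis using map_Int[of "{a<..}" "{..<b}"] map_empty by simp
qed

lemma map_greaterThan_cover: "a < b \<Longrightarrow> f {a<..} \<squnion> f {..<b} = \<top>"
proof -
  assume "a < b"
  then have "{a<..} \<union> {..<b} = UNIV" by auto
  then show ?thesis using map_Un[of "{a<..}" "{..<b}"] map_UNIV by simp
qed

lemma map_greaterThan_sup: "f {a<..} = \<Squnion>{f {b<..} |b. a < b}"
proof -
  have "{a<..} = \<Union>{{b<..} |b. a < b}"
    by (auto simp: setcompr_eq_image dest: dense)
  then have "f {a<..} = \<Squnion>(f ` {{b<..} |b. a < b})" by (subst \<open>{a<..} = _\<close>, subst map_Union) auto
  also have "f ` {{b<..} |b. a < b} = {f {b<..} |b. a < b}" by auto
  finally show ?thesis .
qed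

lemma map_lessThan_sup: "f {..<a} = \<Squnion>{f {..<b} |b. b < a}"
proof -
  have "{..<a} = \<Union>{{..<b} |b. b < a}"
    by (auto simp: setcompr_eq_image dest: dense)
  then have "f {..<a} = \<Squnion>(f ` {{..<b} |b. b < a})" by (subst \<open>{..<a} = _\<close>, subst map_Union) auto
  also have "f ` {{..<b} |b. b < a} = {f {..<b} |b. b < a}" by auto
  finally show ?thesis .
qed

lemma map_greaterThan_rather_below: "a < b \<Longrightarrow> rather_below M (f {b<..}) (f {a<..})"
  using map_greaterThan_disjoint[of b b] map_greaterThan_cover[of a b]
  by (intro rather_belowI[of _ _ "f {..<b}"]) (auto simp: meet_comm join_comm)

lemma map_lessThan_rather_below: "a < b \<Longrightarrow> rather_below M (f {..<a}) (f {..<b})"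
  using map_greaterThan_disjoint[of a a] map_greaterThan_cover[of a b]
  by (intro rather_belowI[of _ _ "f {a<..}"]) auto

end

text \<open>Upper rays control lower rays. For b < a the element \<open>g {..<b}\<close> is disjoint
  from \<open>g {b<..}\<close>, hence from the smaller \<open>f {b<..}\<close>, and the latter
  covers together with \<open>f {..<a}\<close>.\<close>

lemma lessThan_le_of_greaterThan_le:
  assumes "order_morphism M p f" "order_morphism M p g"
    and le: "\<And>a. f {a<..} \<sqsubseteq>\<^bsub>M\<^esub> g {a<..}"
  shows "g {..<a} \<sqsubseteq>\<^bsub>M\<^esub> f {..<a}"
proof -
  interpret f: order_morphism M p f by fact
  interpret g: order_morphism M p g by fact
  have "g {..<b} \<sqsubseteq>\<^bsub>M\<^esub> f {..<a}" if "b < a" for b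
  proof (rule f.cut[of _ "f {b<..}"])
    have "g {..<b} \<sqinter>\<^bsub>M\<^esub> f {b<..} \<sqsubseteq>\<^bsub>M\<^esub> g {..<b} \<sqinter>\<^bsub>M\<^esub> g {b<..}"
      using le by (intro f.meet_mono) auto
    then show "g {..<b} \<sqinter>\<^bsub>M\<^esub> f {b<..} = \<bottom>\<^bsub>M\<^esub>"
      using g.map_greaterThan_disjoint[of b b] by (simp add: meet_comm f.le_bot_iff)
  qed (use f.map_greaterThan_cover[OF that] in auto)
  then show ?thesis
    by (subst g.map_lessThan_sup) (auto intro!: f.sup_least)
qed

text \<open>Agreement on upper rays gives agreement on lower rays by the preceding lemma used in
  both directions, and the rays generate the topology.\<close>

lemma opens_hom_eqI:
  assumes "order_morphism M p f" "order_morphism M p g"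
    and eq: "\<And>a. f {a<..} = g {a<..}" and "open U"
  shows "f U = g U"
proof -
  interpret f: order_morphism M p f by fact
  interpret g: order_morphism M p g by fact
  have lt: "f {..<a} = g {..<a}" for a
    using lessThan_le_of_greaterThan_le[OF assms(1,2)] lessThan_le_of_greaterThan_le[OF assms(2,1)] eq
    by (intro f.le_antisym) auto
  have "generate_topology (range (\<lambda>a. {..<a}) \<union> range (\<lambda>a. {a<..})) U"
    using \<open>open U\<close> by (simp add: open_generated_order)
  then have "open U \<and> f U = g U"
  proof induction
    case UNIV then show ?case by (simp add: f.map_UNIV g.map_UNIV)
  next
    case (Int a b) then show ?case by (simp add: f.map_Int g.map_Int open_Int)
  next
    case (UN K)
    then have "f ` K = g ` K" by (intro image_cong) auto
    then show ?case using UN f.map_Union[of K] g.map_Union[of K] by auto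
  next
    case (Basis s) then show ?case using eq lt by auto
  qed
  then show ?thesis ..
qed

lemma ereal_opens_hom_eqI:
  assumes "order_morphism M p f" "order_morphism M p g"
    and eq: "\<And>a. f {ereal a<..} = g {ereal a<..}" and "open U"
  shows "f U = g U"
proof (rule opens_hom_eqI[OF assms(1,2)])
  interpret f: order_morphism M p f by fact
  interpret g: order_morphism M p g by fact
  have "{-\<infinity><..} = \<Union>(range (\<lambda>a. {ereal a<..}))"
    using ereal_dense2 by (force simp: less_ereal.simps)
  moreover have "f ` range (\<lambda>a. {ereal a<..}) = g ` range (\<lambda>a. {ereal a<..})"
    using eq by (intro image_cong) auto
  ultimately have 1: "f {-\<infinity><..} = g {-\<infinity><..}"
    using f.map_Union[of "range (\<lambda>a. {ereal a<..})"] g.map_Union[of "range (\<lambda>a. {ereal a<..})"] by auto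
  have 2: "{\<infinity>::ereal<..} = {}" by auto
  show "f {a<..} = g {a<..}" for a
    by (cases a) (auto simp: eq 1 2 f.map_empty g.map_empty)
qed (use assms in auto)

section \<open>The operations on pointed homomorphisms\<close>

text \<open>For continuous w the preimage of V is the largest open U with image in V, so the
  defining join is attained.\<close>

lemma R0_lift1_eq:
  assumes "opens_morphism L 0 f" "continuous_on UNIV w" "open V"
  shows "R0_lift1 L w f V = f (w -` V)"
proof -
  interpret opens_morphism L 0 f by fact
  have op: "open (w -` V)" using assms(2,3) by (simp add: continuous_on_open_vimage)
  have "\<Squnion>\<^bsub>L\<^esub>{f U |U. open U \<and> w ` U \<subseteq> V} = f (w -` V)"
  proof (rule sup_eqI)
    show "a \<sqsubseteq>\<^bsub>L\<^esub> f (w -` V)" if "a \<in> {f U |U. open U \<and> w ` U \<subseteq> V}" for a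
      using that op by (auto intro!: map_subset)
    show "f (w -` V) \<sqsubseteq>\<^bsub>L\<^esub> y" if "\<And>a. a \<in> {f U |U. open U \<and> w ` U \<subseteq> V} \<Longrightarrow> a \<sqsubseteq>\<^bsub>L\<^esub> y" for y
      using that op by blast
  qed (use op in auto)
  then show ?thesis using \<open>open V\<close> by (simp add: R0_lift1_def)
qed

lemma R0_lift1_extensional [simp]: "R0_lift1 L w f \<in> extensional {U. open U}"
  by (simp add: R0_lift1_def)

text \<open>If both arguments are lifts of the same f, the boxes inside the preimage of V pull back
  along (a, b) to an open cover of the preimage under the composite. A binary operation is thereby
  reduced to a unary one; this serves \<open>g - t g\<close> and the positive part.\<close>

lemma R0_lift2_lift1_eq:
  assumes "opens_morphism L 0 f" and a: "continuous_on UNIV a" and b: "continuous_on UNIV b"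
    and w: "continuous_on UNIV (\<lambda>(x, y). w x y)" and "open V"
  shows "R0_lift2 L w (R0_lift1 L a f) (R0_lift1 L b f) V = f ((\<lambda>x. w (a x) (b x)) -` V)"
proof -
  interpret opens_morphism L 0 f by fact
  let ?S = "{(U, U'). open U \<and> open U' \<and> (\<lambda>(x, y). w x y) ` (U \<times> U') \<subseteq> V}"
  let ?F = "\<lambda>(U, U'). a -` U \<inter> b -` U'"
  have op: "open (?F s)" if "s \<in> ?S" for s
    using that a b by (auto simp: continuous_on_open_vimage intro!: open_Int)
  have "(\<lambda>x. w (a x) (b x)) -` V = \<Union>(?F ` ?S)"
  proof (intro equalityI subsetI)
    fix x assume x: "x \<in> (\<lambda>x. w (a x) (b x)) -` V"
    have "open ((\<lambda>(x, y). w x y) -` V)"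
      using w \<open>open V\<close> by (simp add: continuous_on_open_vimage)
    moreover have "(a x, b x) \<in> (\<lambda>(x, y). w x y) -` V" using x by simp
    ultimately obtain U U' where "open U" "open U'" "a x \<in> U" "b x \<in> U'" "U \<times> U' \<subseteq> (\<lambda>(x, y). w x y) -` V"
      by (rule open_prod_elim) auto
    then have "(U, U') \<in> ?S" "x \<in> ?F (U, U')" by auto
    then show "x \<in> \<Union>(?F ` ?S)" by blast
  qed force
  then have "f ((\<lambda>x. w (a x) (b x)) -` V) = f (\<Union>(?F ` ?S))" by simp
  also have "\<dots> = \<Squnion>\<^bsub>L\<^esub>(f ` ?F ` ?S)" using op by (intro map_Union) blast
  also have "f ` ?F ` ?S =
     {R0_lift1 L a f U \<sqinter>\<^bsub>L\<^esub> R0_lift1 L b f U' |U U'.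
       open U \<and> open U' \<and> (\<lambda>(x, y). w x y) ` (U \<times> U') \<subseteq> V}" (is "_ = ?R")
  proof -
    have *: "f (a -` U \<inter> b -` U') = R0_lift1 L a f U \<sqinter>\<^bsub>L\<^esub> R0_lift1 L b f U'"
      if "open U" "open U'" for U U'
      using that a b assms(1) by (simp add: R0_lift1_eq map_Int continuous_on_open_vimage)
    have "f ` ?F ` ?S = (\<lambda>(U, U'). R0_lift1 L a f U \<sqinter>\<^bsub>L\<^esub> R0_lift1 L b f U') ` ?S"
      unfolding image_image by (intro image_cong) (auto simp: *)
    then show ?thesis by auto
  qed
  finally show ?thesis using \<open>open V\<close> by (simp add: R0_lift2_def)
qed

text \<open>A box on which max exceeds c has one of its two sides inside the ray above c; otherwise
  a pair of points at most c would contradict it.\<close>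

lemma R0_sup_greaterThan:
  assumes "opens_morphism L 0 f" "opens_morphism L 0 g"
  shows "R0_sup L f g {c<..} = f {c<..} \<squnion>\<^bsub>L\<^esub> g {c<..}"
proof -
  interpret f: opens_morphism L 0 f by fact
  interpret g: opens_morphism L 0 g by fact
  let ?S = "{f U \<sqinter>\<^bsub>L\<^esub> g U' |U U'. open U \<and> open U' \<and> (\<lambda>(x, y). max x y) ` (U \<times> U') \<subseteq> {c<..}}"
  have "\<Squnion>\<^bsub>L\<^esub>?S = f {c<..} \<squnion>\<^bsub>L\<^esub> g {c<..}"
  proof (rule f.sup_eqI)
    show "a \<sqsubseteq>\<^bsub>L\<^esub> f {c<..} \<squnion>\<^bsub>L\<^esub> g {c<..}" if "a \<in> ?S" for a
    proof -
      from that obtain U U' where a: "a = f U \<sqinter>\<^bsub>L\<^esub> g U'" and op: "open U" "open U'"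
        and sub: "(\<lambda>(x, y). max x y) ` (U \<times> U') \<subseteq> {c<..}" by auto
      have "U \<subseteq> {c<..} \<or> U' \<subseteq> {c<..}"
      proof (rule ccontr)
        assume "\<not> ?thesis"
        then obtain x y where "x \<in> U" "y \<in> U'" "x \<le> c" "y \<le> c" by fastforce
        then show False using sub by fastforce
      qed
      then show ?thesis
      proof
        assume "U \<subseteq> {c<..}"
        then have "f U \<sqsubseteq>\<^bsub>L\<^esub> f {c<..}" using op by (intro f.map_subset) auto
        then show ?thesis unfolding a using op
          by (intro f.le_trans[OF f.le_trans[OF f.meet_left] f.join_left]) auto
      next
        assume "U' \<subseteq> {c<..}"
        then have "g U' \<sqsubseteq>\<^bsub>L\<^esub> g {c<..}" using op by (intro g.map_subset) auto
        then show ?thesis unfolding a using op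
          by (intro f.le_trans[OF f.le_trans[OF f.meet_right] f.join_right]) auto
      qed
    qed
    show "f {c<..} \<squnion>\<^bsub>L\<^esub> g {c<..} \<sqsubseteq>\<^bsub>L\<^esub> y"
      if y: "y \<in> carrier L" and le: "\<And>a. a \<in> ?S \<Longrightarrow> a \<sqsubseteq>\<^bsub>L\<^esub> y" for y
    proof -
      have "f {c<..} \<sqinter>\<^bsub>L\<^esub> g UNIV \<sqsubseteq>\<^bsub>L\<^esub> y"
        by (rule le, rule CollectI, rule exI[of _ "{c<..}"], rule exI[of _ UNIV]) auto
      then have 1: "f {c<..} \<sqsubseteq>\<^bsub>L\<^esub> y" by (simp add: g.map_UNIV f.meet_top)
      have "f UNIV \<sqinter>\<^bsub>L\<^esub> g {c<..} \<sqsubseteq>\<^bsub>L\<^esub> y"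
        by (rule le, rule CollectI, rule exI[of _ UNIV], rule exI[of _ "{c<..}"]) auto
      then have "g {c<..} \<sqsubseteq>\<^bsub>L\<^esub> y"
        using f.meet_top[of "g {c<..}"] by (simp add: f.map_UNIV meet_comm)
      with 1 have "f {c<..} \<sqsubseteq>\<^bsub>L\<^esub> y" "g {c<..} \<sqsubseteq>\<^bsub>L\<^esub> y" by auto
      then show ?thesis using y by (simp add: f.join_le_iff)
    qed
  qed auto
  then show ?thesis by (simp add: R0_lift2_def)
qed

section \<open>Compactifications\<close>

locale frame_compactification =
  fixes q :: "('m, 'l) pframe_arrow"
  assumes compactification: "compactification q"
begin

abbreviation M where "M \<equiv> src q"
abbreviation L where "L \<equiv> tgt q"

sublocale M: pointed_frame M using compactification by (simp add: compactification_def)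
sublocale L: pointed_frame L using compactification by (simp add: compactification_def)

sublocale frame_morphism M L "arr q"
  using compactification
  by unfold_locales (simp add: compactification_def pframe_homs_def)

lemma point_arr: "x \<in> carrier M \<Longrightarrow> point L (arr q x) = point M x"
  using compactification by (simp add: compactification_def pframe_homs_def)

lemma surj: "y \<in> carrier L \<Longrightarrow> \<exists>x\<in>carrier M. y = arr q x"
  using compactification by (auto simp: compactification_def)

lemma dense: "x \<in> carrier M \<Longrightarrow> arr q x = \<bottom>\<^bsub>L\<^esub> \<Longrightarrow> x = \<bottom>\<^bsub>M\<^esub>"
  using compactification by (auto simp: compactification_def)

lemma compact: "compact_frame M"
  using compactification by (auto simp: compactification_def)

lemma regular: "regular_frame M"
  using compactification by (auto simp: compactification_def)

lemma reflects_le: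
  assumes "x \<in> carrier M" "y \<in> carrier M" "z \<in> carrier M"
    and "arr q x \<sqsubseteq>\<^bsub>L\<^esub> arr q y" "rather_below M y z"
  shows "x \<sqsubseteq>\<^bsub>M\<^esub> z"
  using dense_reflects_le[of x y z] dense assms by blast

lemma dense_element_of_top:
  assumes "y \<in> carrier M" "arr q y = \<top>\<^bsub>L\<^esub>"
  shows "dense_element M y"
  unfolding dense_element_def
proof (intro conjI ballI impI)
  fix x assume x: "x \<in> carrier M" "y \<sqinter>\<^bsub>M\<^esub> x = \<bottom>\<^bsub>M\<^esub>"
  then have "\<top>\<^bsub>L\<^esub> \<sqinter>\<^bsub>L\<^esub> arr q x = \<bottom>\<^bsub>L\<^esub>" using assms map_meet[of y x] map_bot by simp
  then show "x = \<bottom>\<^bsub>M\<^esub>" using x dense L.meet_top[of "arr q x"] by (simp add: meet_comm)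
qed (use assms in simp)

lemma extends_hom:
  assumes "extends q h' h"
  shows "order_morphism M 0 h'"
  using assms M.frame_axioms
  by (auto simp: extends_def D0_def pframe_homs_def order_morphism_def opens_morphism_def
      opens_morphism_axioms_def)

lemma extends_arr:
  assumes "extends q h' h" "open U"
  shows "arr q (h' U) = h (ereal -` U)"
proof -
  have "compose (carrier O_ereal) (arr q) h' U = compose (carrier O_ereal) h finite_part U"
    using assms by (simp add: extends_def)
  then show ?thesis using assms by (simp add: compose_def finite_part_def)
qed

text \<open>Both extensions have the same image under \<open>arr q\<close>. The ray above b is
  rather below the ray above a when a < b, so density gives the inequality with this gap, and the
  join over all such b closes it.\<close>

lemma extends_unique:
  assumes "extends q h1 h" "extends q h2 h"
  shows "h1 = h2"
proof -
  have le: "f {a<..} \<sqsubseteq>\<^bsub>M\<^esub> g {a<..}" if f: "extends q f h" and g: "extends q g h" for f g and a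
  proof -
    interpret f: order_morphism M 0 f by (rule extends_hom[OF f])
    interpret g: order_morphism M 0 g by (rule extends_hom[OF g])
    have "f {b<..} \<sqsubseteq>\<^bsub>M\<^esub> g {a<..}" if "a < b" for b
      by (rule reflects_le[OF _ _ _ _ g.map_greaterThan_rather_below[OF that]])
        (use map_closed[of "f {b<..}"] in \<open>auto simp: extends_arr[OF f] extends_arr[OF g]\<close>)
    then show ?thesis by (subst f.map_greaterThan_sup) (auto intro!: M.sup_least)
  qed
  interpret h1: order_morphism M 0 h1 by (rule extends_hom[OF assms(1)])
  interpret h2: order_morphism M 0 h2 by (rule extends_hom[OF assms(2)])
  have "h1 U = h2 U" if "open U" for U
    by (rule opens_hom_eqI[OF extends_hom extends_hom, OF assms])
      (auto intro!: M.le_antisym le assms that)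
  moreover have "h1 \<in> extensional {U. open U}" "h2 \<in> extensional {U. open U}"
    using assms by (simp_all add: extends_def D0_def pframe_homs_def)
  ultimately show ?thesis by (auto intro: extensionalityI)
qed

text \<open>Density of the finite part comes for free: \<open>arr q\<close> sends it to
  \<open>h UNIV\<close>, which is top, and \<open>arr q\<close> is dense.\<close>

lemma extendsI:
  assumes hom: "frame_hom O_ereal M f"
    and pt: "\<And>U. open U \<Longrightarrow> point M (f U) \<longleftrightarrow> 0 \<in> U"
    and arr: "\<And>U. open U \<Longrightarrow> arr q (f U) = h (ereal -` U)" and top: "h UNIV = \<top>\<^bsub>L\<^esub>"
  shows "extends q (restrict f {U. open U}) h"
proof -
  have "f {-\<infinity><..<\<infinity>} \<in> carrier M" using hom by (auto simp: frame_hom_def)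
  moreover have "ereal -` {-\<infinity><..<\<infinity>} = UNIV" by auto
  ultimately have "dense_element M (f {-\<infinity><..<\<infinity>})"
    by (intro dense_element_of_top) (simp_all add: arr top)
  moreover have "restrict f {U. open U} \<in> pframe_homs O_ereal M"
    using frame_hom_restrict[OF frame_opens_at hom] pt by (simp add: pframe_homs_def)
  moreover have "compose (carrier O_ereal) (arr q) (restrict f {U. open U})
      = compose (carrier O_ereal) h finite_part"
    using arr by (auto simp: compose_def finite_part_def restrict_def fun_eq_iff)
  ultimately show ?thesis by (simp add: extends_def D0_def)
qed

lemma extension_eq: "extends q h' h \<Longrightarrow> extension q h = h'"
  unfolding extension_def using extends_unique by blast

end

section \<open>Represented truncs\<close>

locale representation = frame_compactification q + trunc t
  for t :: "'a::{ordered_real_vector, lattice} \<Rightarrow> 'a" and q :: "('m, 'l) pframe_arrow" +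
  fixes G and \<mu>
  assumes snug: "snugly_embedded q G" and iso: "trunc_iso_onto t L G \<mu>"
begin

definition ext where "ext g = extension q (\<mu> g)"

abbreviation up where "up g a \<equiv> ext g {ereal a<..}"
abbreviation dn where "dn g a \<equiv> ext g {..<ereal a}"

lemma \<mu>_in: "\<mu> g \<in> G"
  using iso by (auto simp: trunc_iso_onto_def bij_betw_def)

lemma \<mu>_inj: "\<mu> g = \<mu> h \<longleftrightarrow> g = h"
  using iso by (auto simp: trunc_iso_onto_def bij_betw_def inj_on_def)

lemma \<mu>_surj: "f \<in> G \<Longrightarrow> \<exists>g. f = \<mu> g"
  using iso by (auto simp: trunc_iso_onto_def bij_betw_def)

lemma \<mu>_R0: "\<mu> g \<in> R0 L"
  using snug \<mu>_in[of g] by (auto simp: snugly_embedded_def E0_def)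

lemma extends_ext: "extends q (ext g) (\<mu> g)"
proof -
  obtain h' where "extends q h' (\<mu> g)"
    using snug \<mu>_in[of g] by (auto simp: snugly_embedded_def E0_def)
  then show ?thesis using extension_eq by (simp add: ext_def)
qed

sublocale \<mu>: order_morphism L 0 "\<mu> g" for g
  using \<mu>_R0[of g] L.frame_axioms
  by (auto simp: R0_def pframe_homs_def order_morphism_def opens_morphism_def
      opens_morphism_axioms_def)

sublocale ext: order_morphism M 0 "ext g" for g
  by (rule extends_hom[OF extends_ext])

lemmas arr_ext = extends_arr[OF extends_ext]

lemma \<mu>_extensional: "\<mu> g \<in> extensional {U. open U}"
  using \<mu>_R0[of g] by (simp add: R0_def pframe_homs_def)

lemma point_ext: "open U \<Longrightarrow> point M (ext g U) \<longleftrightarrow> 0 \<in> U"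
  using extends_ext[of g] by (auto simp: extends_def D0_def pframe_homs_def)

lemma lift1_id: "R0_lift1 L (\<lambda>x. x) (\<mu> g) = \<mu> g"
proof (rule extensionalityI[OF R0_lift1_extensional \<mu>_extensional])
  fix V :: "real set" assume "V \<in> {U. open U}"
  then show "R0_lift1 L (\<lambda>x. x) (\<mu> g) V = \<mu> g V"
    by (subst R0_lift1_eq) (auto intro: \<mu>.opens_morphism_axioms)
qed

lemma ext_unary:
  assumes w: "continuous_on UNIV w" "w 0 = 0" and W: "continuous_on UNIV W" "\<And>x. W (ereal x) = ereal (w x)"
    and k: "\<And>V. open V \<Longrightarrow> \<mu> k V = \<mu> g (w -` V)" and "open U"
  shows "ext k U = ext g (W -` U)"
proof -
  have op: "open (W -` U)" if "open U" for U using W that by (simp add: continuous_on_open_vimage)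
  let ?h = "\<lambda>U. ext g (W -` U)"
  have vim: "ereal -` W -` U = w -` ereal -` U" for U using W(2) by auto
  have W0: "W 0 = 0" using W(2)[of 0] w(2) by (simp add: zero_ereal_def)
  have "extends q (restrict ?h {U. open U}) (\<mu> k)"
  proof (rule extendsI)
    show "frame_hom O_ereal M ?h"
    proof (rule frame_hom_opensI[OF M.frame_axioms])
      fix A :: "ereal set set" assume A: "\<forall>U\<in>A. open U"
      have "W -` \<Union>A = \<Union>((\<lambda>U. W -` U) ` A)" by auto
      then show "?h (\<Union>A) = \<Squnion>\<^bsub>M\<^esub>(?h ` A)" using A op
        by (simp add: ext.map_Union image_image)
    qed (use op in \<open>auto simp: ext.map_UNIV ext.map_Int\<close>)
    show "arr q (?h U) = \<mu> k (ereal -` U)" if "open U" for U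
      using that op[OF that] by (simp add: arr_ext vim k open_ereal_vimage)
  qed (use op W0 in \<open>auto simp: point_ext \<mu>.map_UNIV\<close>)
  then have "ext k = restrict ?h {U. open U}" unfolding ext_def by (rule extension_eq)
  then show ?thesis using \<open>open U\<close> by simp
qed

lemma \<mu>_scaleR: "open V \<Longrightarrow> \<mu> (c *\<^sub>R g) V = \<mu> g ((\<lambda>x. c * x) -` V)"
  using iso R0_lift1_eq[OF \<mu>.opens_morphism_axioms, of "\<lambda>x. c * x" V g]
  by (simp add: trunc_iso_onto_def continuous_intros)

lemma ext_zero: "open U \<Longrightarrow> ext 0 U = (if 0 \<in> U then \<top>\<^bsub>M\<^esub> else \<bottom>\<^bsub>M\<^esub>)"
proof -
  assume U: "open U"
  have z: "\<mu> 0 V = \<mu> 0 ((\<lambda>x. 0) -` V)" if "open V" for V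
    using \<mu>_scaleR[OF that, of 0 0] by simp
  have "ext 0 U = ext 0 ((\<lambda>x. 0) -` U)"
    by (rule ext_unary[where w="\<lambda>x. 0", OF _ _ _ _ z U]) simp_all
  then show ?thesis by (simp add: ext.map_UNIV ext.map_empty)
qed

lemma \<mu>_zero: "open V \<Longrightarrow> \<mu> 0 V = (if 0 \<in> V then \<top>\<^bsub>L\<^esub> else \<bottom>\<^bsub>L\<^esub>)"
  using \<mu>_scaleR[of V 0 0] by (simp add: \<mu>.map_UNIV \<mu>.map_empty)

lemma ext_scaleR: "c \<noteq> 0 \<Longrightarrow> open U \<Longrightarrow> ext (c *\<^sub>R g) U = ext g ((\<lambda>x. ereal c * x) -` U)"
  by (rule ext_unary[where w="\<lambda>x. c * x"])
    (auto intro!: continuous_intros \<mu>_scaleR simp: continuous_on_def)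

lemma up_scaleR: "c > 0 \<Longrightarrow> up (c *\<^sub>R g) a = up g (a / c)"
proof -
  assume c: "c > 0"
  have "(\<lambda>x. ereal c * x) -` {ereal a<..} = {ereal (a / c)<..}"
  proof (rule Set.set_eqI)
    fix x show "x \<in> (\<lambda>x. ereal c * x) -` {ereal a<..} \<longleftrightarrow> x \<in> {ereal (a / c)<..}"
      using c by (cases x) (auto simp: field_simps)
  qed
  then show ?thesis using c by (simp add: ext_scaleR)
qed

lemma dn_scaleR: "c > 0 \<Longrightarrow> dn (c *\<^sub>R g) a = dn g (a / c)"
proof -
  assume c: "c > 0"
  have "(\<lambda>x. ereal c * x) -` {..<ereal a} = {..<ereal (a / c)}"
  proof (rule Set.set_eqI)
    fix x show "x \<in> (\<lambda>x. ereal c * x) -` {..<ereal a} \<longleftrightarrow> x \<in> {..<ereal (a / c)}"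
      using c by (cases x) (auto simp: field_simps)
  qed
  then show ?thesis using c by (simp add: ext_scaleR)
qed

lemma up_uminus: "up (- g) a = dn g (- a)"
proof -
  have "(\<lambda>x. ereal (-1) * x) -` {ereal a<..} = {..<ereal (- a)}"
  proof (rule Set.set_eqI)
    fix x show "x \<in> (\<lambda>x. ereal (-1) * x) -` {ereal a<..} \<longleftrightarrow> x \<in> {..<ereal (- a)}"
      by (cases x) auto
  qed
  then show ?thesis using ext_scaleR[of "-1" "{ereal a<..}" g] by simp
qed

lemma dn_uminus: "dn (- g) a = up g (- a)"
  using up_uminus[of "- g" "- a"] by simp

lemma ext_trunc: "0 \<le> g \<Longrightarrow> open U \<Longrightarrow> ext (t g) U = ext g ((\<lambda>x. min x 1) -` U)"
proof (rule ext_unary[where w="\<lambda>x. min x 1"])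
  show "\<mu> (t g) V = \<mu> g ((\<lambda>x. min x 1) -` V)" if "0 \<le> g" "open V" for V
    using iso R0_lift1_eq[OF \<mu>.opens_morphism_axioms, of "\<lambda>x. min x 1" V g] that
    by (simp add: trunc_iso_onto_def continuous_intros)
qed (auto intro!: continuous_intros simp: one_ereal_def)

text \<open>Both summands are written as lifts of \<open>\<mu> g\<close>, the first by the identity
  function, so that \<open>R0_lift2_lift1_eq\<close> collapses the sum to a single preimage.\<close>

lemma \<mu>_sub_trunc:
  assumes "0 \<le> g" "open V"
  shows "\<mu> (g - t g) V = \<mu> g ((\<lambda>x. x - min x 1) -` V)"
proof -
  note c = continuous_intros
  have t: "\<mu> (t g) = R0_trunc L (\<mu> g)" using iso assms by (simp add: trunc_iso_onto_def)
  have m: "\<mu> (- t g) = R0_lift1 L (\<lambda>x. - min x 1) (\<mu> g)"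
  proof (rule extensionalityI[OF \<mu>_extensional R0_lift1_extensional])
    fix V :: "real set" assume "V \<in> {U. open U}"
    then have V: "open V" by simp
    then have V': "open (uminus -` V)" by (auto intro!: open_vimage c)
    have "\<mu> (- t g) V = \<mu> (t g) (uminus -` V)" using \<mu>_scaleR[OF V, of "-1" "t g"] by simp
    also have "\<dots> = \<mu> g ((\<lambda>x. min x 1) -` uminus -` V)"
      unfolding t by (intro R0_lift1_eq \<mu>.opens_morphism_axioms V' c)
    also have "(\<lambda>x. min x 1) -` uminus -` V = (\<lambda>x. - min x 1) -` V" by auto
    also have "\<mu> g \<dots> = R0_lift1 L (\<lambda>x. - min x 1) (\<mu> g) V"
      by (intro R0_lift1_eq[symmetric] \<mu>.opens_morphism_axioms V c)
    finally show "\<mu> (- t g) V = R0_lift1 L (\<lambda>x. - min x 1) (\<mu> g) V" .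
  qed
  have "\<mu> (g - t g) = R0_add L (R0_lift1 L (\<lambda>x. x) (\<mu> g)) (R0_lift1 L (\<lambda>x. - min x 1) (\<mu> g))"
    using iso unfolding lift1_id m[symmetric] trunc_iso_onto_def
    by (metis (no_types) add.commute diff_conv_add_uminus)
  moreover have "continuous_on UNIV (\<lambda>(x, y). x + y :: real)"
    by (auto simp: case_prod_unfold intro!: c)
  ultimately show ?thesis
    using R0_lift2_lift1_eq[OF \<mu>.opens_morphism_axioms, of "\<lambda>x. x" "\<lambda>x. - min x 1" "(+)" V g] assms
    by (simp add: c)
qed

text \<open>On the reals max x 1 - 1 agrees with x - min x 1. The first form is continuous at
  -\<infinity>, whereas the second would subtract -\<infinity> from itself there.\<close>

lemma ext_sub_trunc: "0 \<le> g \<Longrightarrow> open U \<Longrightarrow> ext (g - t g) U = ext g ((\<lambda>x. max x 1 + (-1)) -` U)"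
proof (rule ext_unary[where w="\<lambda>x. x - min x 1"])
  show "continuous_on UNIV (\<lambda>x::ereal. max x 1 + - 1)"
    unfolding continuous_on_def
    by (intro ballI tendsto_cadd_ereal tendsto_max tendsto_intros) (auto simp: max_def)
  show "max (ereal x) 1 + - 1 = ereal (x - min x 1)" for x
    by (auto simp: one_ereal_def max_def min_def)
qed (auto intro!: continuous_intros \<mu>_sub_trunc)

lemma \<mu>_sup_greaterThan: "\<mu> (sup_class.sup g h) {a<..} = \<mu> g {a<..} \<squnion>\<^bsub>L\<^esub> \<mu> h {a<..}"
  using iso R0_sup_greaterThan[OF \<mu>.opens_morphism_axioms \<mu>.opens_morphism_axioms]
  by (simp add: trunc_iso_onto_def)

lemma arr_up: "arr q (up g a) = \<mu> g {a<..}"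
proof -
  have "ereal -` {ereal a<..} = {a<..}" by auto
  then show ?thesis by (simp add: arr_ext)
qed

lemma up_rather_below: "a < b \<Longrightarrow> rather_below M (up g b) (up g a)"
  by (intro ext.map_greaterThan_rather_below) simp

lemma dn_rather_below: "a < b \<Longrightarrow> rather_below M (dn g a) (dn g b)"
  by (intro ext.map_lessThan_rather_below) simp

lemma up_le: 
  assumes "x \<in> carrier M" "\<And>b. a < b \<Longrightarrow> up g b \<sqsubseteq>\<^bsub>M\<^esub> x"
  shows "up g a \<sqsubseteq>\<^bsub>M\<^esub> x"
proof -
  have "{ereal a<..} = \<Union>{{ereal b<..} |b. a < b}"
  proof (intro equalityI subsetI)
    fix x assume "x \<in> {ereal a<..}"
    then have "ereal a < x" by simp
    then obtain b where "ereal a < ereal b" "ereal b < x"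
      using ereal_dense2[of "ereal a" x] by blast
    then show "x \<in> \<Union>{{ereal b<..} |b. a < b}" by auto
  next
    fix x assume "x \<in> \<Union>{{ereal b<..} |b. a < b}"
    then obtain b where "a < b" "ereal b < x" by auto
    then show "x \<in> {ereal a<..}" using less_trans[of "ereal a" "ereal b" x] by simp
  qed
  then have "up g a = \<Squnion>\<^bsub>M\<^esub>(ext g ` {{ereal b<..} |b. a < b})"
    by (subst \<open>{ereal a<..} = _\<close>, subst ext.map_Union) auto
  then show ?thesis using assms by (auto intro!: M.sup_least)
qed

text \<open>The identity is known only after \<open>arr q\<close>, which reflects inequalities only
  across a rather-below gap. So level b on the left is compared with level a < b on the right, and
  \<open>up_le\<close> lets b approach a.\<close>

lemma up_sup: "up (sup_class.sup g h) a = up g a \<squnion>\<^bsub>M\<^esub> up h a"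
proof (rule M.le_antisym)
  show "up (sup_class.sup g h) a \<sqsubseteq>\<^bsub>M\<^esub> up g a \<squnion>\<^bsub>M\<^esub> up h a"
  proof (rule up_le)
    fix b assume b: "a < b"
    have "rather_below M (up g b) (up g a \<squnion>\<^bsub>M\<^esub> up h a)"
      by (rule M.rather_below_mono[OF up_rather_below[OF b] M.le_refl]) (simp_all add: M.join_left)
    moreover have "rather_below M (up h b) (up g a \<squnion>\<^bsub>M\<^esub> up h a)"
      by (rule M.rather_below_mono[OF up_rather_below[OF b] M.le_refl]) (simp_all add: M.join_right)
    ultimately have "rather_below M (up g b \<squnion>\<^bsub>M\<^esub> up h b) (up g a \<squnion>\<^bsub>M\<^esub> up h a)"
      by (intro M.rather_below_join) auto
    then show "up (sup_class.sup g h) b \<sqsubseteq>\<^bsub>M\<^esub> up g a \<squnion>\<^bsub>M\<^esub> up h a"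
      by (intro reflects_le) (auto simp: arr_up \<mu>_sup_greaterThan map_join)
  qed simp
  have "up k b \<sqsubseteq>\<^bsub>M\<^esub> up (sup_class.sup g h) a" if "k = g \<or> k = h" "a < b" for k b
  proof (rule reflects_le[OF _ _ _ _ up_rather_below[OF that(2)]])
    have "\<mu> k {b<..} \<sqsubseteq>\<^bsub>L\<^esub> \<mu> g {b<..} \<squnion>\<^bsub>L\<^esub> \<mu> h {b<..}"
      using that(1) L.join_left[of "\<mu> g {b<..}" "\<mu> h {b<..}"]
        L.join_right[of "\<mu> g {b<..}" "\<mu> h {b<..}"] by auto
    then show "arr q (up k b) \<sqsubseteq>\<^bsub>L\<^esub> arr q (up (sup_class.sup g h) b)"
      by (simp add: arr_up \<mu>_sup_greaterThan)
  qed simp_all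
  then have "up k a \<sqsubseteq>\<^bsub>M\<^esub> up (sup_class.sup g h) a" if "k = g \<or> k = h" for k
    using that by (intro up_le[of _ a k]) simp_all
  then show "up g a \<squnion>\<^bsub>M\<^esub> up h a \<sqsubseteq>\<^bsub>M\<^esub> up (sup_class.sup g h) a"
    by (simp add: M.join_le_iff)
qed auto

text \<open>This turns inequalities of the trunc into inequalities of rays in M. For the converse it
  is enough to push the rays to L: there they determine \<open>\<mu>\<close> of the supremum, and
  \<open>\<mu>\<close> is injective.\<close>

lemma le_iff: "g \<le> h \<longleftrightarrow> (\<forall>a. up g a \<sqsubseteq>\<^bsub>M\<^esub> up h a)"
proof
  assume "g \<le> h"
  then have "sup_class.sup g h = h" by (simp add: sup_absorb2)
  then show "\<forall>a. up g a \<sqsubseteq>\<^bsub>M\<^esub> up h a"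
    using up_sup[of g h] by (metis M.join_left ext.map_in open_greaterThan)
next
  assume le: "\<forall>a. up g a \<sqsubseteq>\<^bsub>M\<^esub> up h a"
  have "\<mu> (sup_class.sup g h) = \<mu> h"
  proof (rule extensionalityI[OF \<mu>_extensional \<mu>_extensional])
    fix V :: "real set" assume V: "V \<in> {U. open U}"
    show "\<mu> (sup_class.sup g h) V = \<mu> h V"
    proof (rule opens_hom_eqI[OF \<mu>.order_morphism_axioms[of "sup_class.sup g h"]
          \<mu>.order_morphism_axioms[of h]])
      fix a
      have "\<mu> g {a<..} \<sqsubseteq>\<^bsub>L\<^esub> \<mu> h {a<..}"
        using le map_mono[of "up g a" "up h a"] by (simp add: arr_up)
      then show "\<mu> (sup_class.sup g h) {a<..} = \<mu> h {a<..}"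
        by (simp add: \<mu>_sup_greaterThan L.join_absorb)
    qed (use V in simp)
  qed
  then show "g \<le> h" by (metis \<mu>_inj sup_ge1)
qed

lemma dn_antimono: "g \<le> h \<Longrightarrow> dn h a \<sqsubseteq>\<^bsub>M\<^esub> dn g a"
  using le_iff[of "- h" "- g"] up_uminus[of _ "- a"] by (metis add.inverse_inverse neg_le_iff_le)

lemma up_nonneg: "0 \<le> g \<Longrightarrow> a < 0 \<Longrightarrow> up g a = \<top>\<^bsub>M\<^esub>"
  using le_iff[of 0 g] by (auto simp: ext_zero M.top_le_iff dest!: spec[of _ a])

lemma dn_nonneg: "0 \<le> g \<Longrightarrow> a \<le> 0 \<Longrightarrow> dn g a = \<bottom>\<^bsub>M\<^esub>"
  using dn_antimono[of 0 g a] by (auto simp: ext_zero M.le_bot_iff)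

lemma up_dn_disjoint: "b \<le> a \<Longrightarrow> up g a \<sqinter>\<^bsub>M\<^esub> dn g b = \<bottom>\<^bsub>M\<^esub>"
  by (rule ext.map_greaterThan_disjoint) simp

lemma up_dn_cover: "a < b \<Longrightarrow> up g a \<squnion>\<^bsub>M\<^esub> dn g b = \<top>\<^bsub>M\<^esub>"
  by (rule ext.map_greaterThan_cover) simp

lemma up_antimono: "a \<le> b \<Longrightarrow> up g b \<sqsubseteq>\<^bsub>M\<^esub> up g a"
  by (rule ext.map_subset) auto

lemma dn_mono: "a \<le> b \<Longrightarrow> dn g a \<sqsubseteq>\<^bsub>M\<^esub> dn g b"
  by (rule ext.map_subset) auto

lemma dn_le:
  assumes "x \<in> carrier M" "\<And>b. b < a \<Longrightarrow> dn g b \<sqsubseteq>\<^bsub>M\<^esub> x"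
  shows "dn g a \<sqsubseteq>\<^bsub>M\<^esub> x"
  using up_le[of x "- a" "- g"] assms by (metis add.inverse_inverse minus_less_iff up_uminus)

end

lemma uminus_inf_eq_sup:
  fixes a b :: "'a::{ordered_real_vector, lattice}"
  shows "- inf_class.inf a b = sup_class.sup (- a) (- b)"
proof (rule order_antisym)
  have "- sup_class.sup (- a) (- b) \<le> inf_class.inf a b"
    by (intro le_infI; subst minus_le_iff) simp_all
  then show "- inf_class.inf a b \<le> sup_class.sup (- a) (- b)" by (subst minus_le_iff)
qed (auto intro: le_supI)

lemma (in frame) compact_chain:
  assumes "compact_frame L" and c: "\<And>n::nat. c n \<in> carrier L" "\<And>m n. m \<le> n \<Longrightarrow> c m \<sqsubseteq> c n"
    and top: "\<Squnion>(range c) = \<top>"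
  shows "\<exists>n. c n = \<top>"
proof -
  have "range c \<subseteq> carrier L" using c by auto
  then obtain F where F: "F \<subseteq> range c" "finite F" "\<Squnion>F = \<top>"
    using assms(1) top unfolding compact_frame_def by blast
  then obtain K where K: "finite K" "F = c ` K" by (meson finite_subset_image)
  have "\<Squnion>F \<sqsubseteq> c (Max (insert 0 K))"
    using K c by (intro sup_least) (auto intro!: c(2) Max_ge)
  then show ?thesis using F c by (auto simp: top_le_iff)
qed

section \<open>Positive parts, truncations, joins and meets read on rays\<close>

context representation
begin

lemma \<mu>_pos_part:
  assumes "open V"
  shows "\<mu> (sup_class.sup g 0) V = \<mu> g ((\<lambda>x. max x 0) -` V)"
proof -
  have 0: "\<mu> 0 = R0_lift1 L (\<lambda>x. 0) (\<mu> g)"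
  proof (rule extensionalityI[OF \<mu>_extensional R0_lift1_extensional])
    fix V :: "real set" assume "V \<in> {U. open U}"
    then show "\<mu> 0 V = R0_lift1 L (\<lambda>x. 0) (\<mu> g) V"
      using R0_lift1_eq[OF \<mu>.opens_morphism_axioms, of "\<lambda>x. 0" V g]
      by (simp add: \<mu>_zero \<mu>.map_UNIV \<mu>.map_empty)
  qed
  have "\<mu> (sup_class.sup g 0) = R0_sup L (R0_lift1 L (\<lambda>x. x) (\<mu> g)) (R0_lift1 L (\<lambda>x. 0) (\<mu> g))"
    using iso unfolding lift1_id 0[symmetric] trunc_iso_onto_def by blast
  moreover have "continuous_on UNIV (\<lambda>(x, y). max x y :: real)"
    by (auto simp: case_prod_unfold intro!: continuous_intros)
  ultimately show ?thesis
    using R0_lift2_lift1_eq[OF \<mu>.opens_morphism_axioms, of "\<lambda>x. x" "\<lambda>x. 0" max V g] assms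
    by simp
qed

lemma ext_pos_part: "open U \<Longrightarrow> ext (sup_class.sup g 0) U = ext g ((\<lambda>x. max x 0) -` U)"
  by (rule ext_unary[where w="\<lambda>x. max x 0"])
    (auto intro!: continuous_intros \<mu>_pos_part simp: zero_ereal_def simp del: ereal_eq_0)

lemma up_pos_part: "0 \<le> a \<Longrightarrow> up (sup_class.sup g 0) a = up g a"
proof -
  assume a: "0 \<le> a"
  have "(\<lambda>x. max x 0) -` {ereal a<..} = {ereal a<..}" using a by (auto simp: less_max_iff_disj)
  then show ?thesis by (simp add: ext_pos_part)
qed

lemma dn_pos_part: "0 < a \<Longrightarrow> dn (sup_class.sup g 0) a = dn g a"
proof -
  assume a: "0 < a"
  have "(\<lambda>x. max x 0) -` {..<ereal a} = {..<ereal a}" using a by auto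
  then show ?thesis by (simp add: ext_pos_part)
qed

lemma up_trunc:
  assumes "0 \<le> g"
  shows "up (t g) a = (if a < 1 then up g a else \<bottom>\<^bsub>M\<^esub>)"
proof -
  have "(\<lambda>x. min x 1) -` {ereal a<..} = (if a < 1 then {ereal a<..} else {})"
    by (auto simp: one_ereal_def)
  then show ?thesis using assms by (simp add: ext_trunc ext.map_empty)
qed

lemma dn_trunc: "0 \<le> g \<Longrightarrow> dn (t g) 1 = dn g 1"
proof -
  assume g: "0 \<le> g"
  have "(\<lambda>x. min x 1) -` {..<ereal 1} = {..<ereal 1}"
    by (auto simp: one_ereal_def min_less_iff_disj)
  then show ?thesis using g by (simp add: ext_trunc)
qed

lemma up_sub_trunc:
  assumes "0 \<le> g" "0 \<le> a"
  shows "up (g - t g) a = up g (a + 1)"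
proof -
  have "x \<in> (\<lambda>x. max x 1 + -1) -` {ereal a<..} \<longleftrightarrow> x \<in> {ereal (a + 1)<..}" for x
    using assms(2) by (cases x) (auto simp: max_def one_ereal_def)
  then have "(\<lambda>x. max x 1 + -1) -` {ereal a<..} = {ereal (a + 1)<..}" by blast
  then show ?thesis using assms by (simp add: ext_sub_trunc)
qed

lemma dn_inf: "dn (inf_class.inf g h) a = dn g a \<squnion>\<^bsub>M\<^esub> dn h a"
  using up_uminus[of "inf_class.inf g h" "- a"] up_uminus[of g "- a"] up_uminus[of h "- a"]
    up_sup[of "- g" "- h" "- a"] by (simp add: uminus_inf_eq_sup)

lemma dn_sup: "dn (sup_class.sup g h) a = dn g a \<sqinter>\<^bsub>M\<^esub> dn h a"
proof (rule M.le_antisym)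
  let ?k = "sup_class.sup g h"
  show "dn ?k a \<sqsubseteq>\<^bsub>M\<^esub> dn g a \<sqinter>\<^bsub>M\<^esub> dn h a"
    by (simp add: M.le_meet_iff dn_antimono)
  have "ext g {..<b} \<sqinter>\<^bsub>M\<^esub> ext h {..<c} \<sqsubseteq>\<^bsub>M\<^esub> dn ?k a" if bc: "b < ereal a" "c < ereal a" for b c
  proof -
    \<comment> \<open>A real level between both rays and a: the meet on the left is disjoint from
      \<open>up ?k d\<close>, and this covers together with \<open>dn ?k a\<close>.\<close>
    obtain d where "max b c < ereal d" "ereal d < ereal a"
      using ereal_dense2[of "max b c" "ereal a"] bc by auto
    then have d: "b \<le> d" "c \<le> d" "d < a" by auto
    let ?x = "ext g {..<b} \<sqinter>\<^bsub>M\<^esub> ext h {..<c}"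
    show ?thesis
    proof (rule M.cut[of _ "up ?k d"])
      have "up g d \<sqinter>\<^bsub>M\<^esub> ?x \<sqsubseteq>\<^bsub>M\<^esub> up g d \<sqinter>\<^bsub>M\<^esub> ext g {..<b}"
        "up h d \<sqinter>\<^bsub>M\<^esub> ?x \<sqsubseteq>\<^bsub>M\<^esub> up h d \<sqinter>\<^bsub>M\<^esub> ext h {..<c}"
        by (intro M.meet_mono; simp add: M.meet_left M.meet_right)+
      then have "up g d \<sqinter>\<^bsub>M\<^esub> ?x = \<bottom>\<^bsub>M\<^esub>" "up h d \<sqinter>\<^bsub>M\<^esub> ?x = \<bottom>\<^bsub>M\<^esub>"
        using d by (simp_all add: ext.map_greaterThan_disjoint M.le_bot_iff)
      then have "(up g d \<squnion>\<^bsub>M\<^esub> up h d) \<sqinter>\<^bsub>M\<^esub> ?x \<sqsubseteq>\<^bsub>M\<^esub> \<bottom>\<^bsub>M\<^esub>"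
        by (subst M.join_meet_distrib) (simp_all add: M.join_le_iff)
      then show "?x \<sqinter>\<^bsub>M\<^esub> up ?k d = \<bottom>\<^bsub>M\<^esub>" by (simp add: up_sup meet_comm M.le_bot_iff)
      show "up ?k d \<squnion>\<^bsub>M\<^esub> dn ?k a = \<top>\<^bsub>M\<^esub>" using d by (intro up_dn_cover)
    qed auto
  qed
  then show "dn g a \<sqinter>\<^bsub>M\<^esub> dn h a \<sqsubseteq>\<^bsub>M\<^esub> dn ?k a"
    unfolding ext.map_lessThan_sup[of g "ereal a"] ext.map_lessThan_sup[of h "ereal a"]
    by (intro M.sup_meet_sup_le) auto
qed auto

lemma up_inf: "up (inf_class.inf g h) a = up g a \<sqinter>\<^bsub>M\<^esub> up h a"
  using dn_uminus[of "inf_class.inf g h" "- a"] dn_uminus[of g "- a"] dn_uminus[of h "- a"]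
    dn_sup[of "- g" "- h" "- a"] by (simp add: uminus_inf_eq_sup)

text \<open>The index \<open>(True, g)\<close> stands for \<open>coz g\<close> and \<open>(False, g)\<close> for \<open>con g\<close>.\<close>

definition gen where "gen i = (if fst i then up (snd i) 0 else dn (snd i) 1)"

lemma gen_closed [simp]: "gen i \<in> carrier M"
  by (simp add: gen_def)

lemma point_gen: "point M (gen i) \<longleftrightarrow> \<not> fst i"
  by (simp add: gen_def point_ext)

section \<open>Covers and disjointness of two generators, expressed in the trunc\<close>

lemma sub_trunc_nonneg: "0 \<le> g \<Longrightarrow> 0 \<le> g - t g"
  using trunc_le by simp

text \<open>The cover says that g > 0 wherever h \<ge> 1. Compactness sharpens this to g > e
  wherever h > 1 - e, for some e > 0. With r = 1/(1 - e) the excess of r h over 1 lives where h > 1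
  - e, and truncating it makes it comparable with a multiple of g. Conversely the inequality puts
  the region h > 1/r inside coz g, and since 1/r < 1 this region covers together with con h.\<close>

lemma cover_iff:
  assumes g: "0 \<le> g" and h: "0 \<le> h"
  shows "up g 0 \<squnion>\<^bsub>M\<^esub> dn h 1 = \<top>\<^bsub>M\<^esub> \<longleftrightarrow>
    (\<exists>r>1. \<exists>n>0. t (r *\<^sub>R h - t (r *\<^sub>R h)) \<le> n *\<^sub>R g)"
proof
  assume top: "up g 0 \<squnion>\<^bsub>M\<^esub> dn h 1 = \<top>\<^bsub>M\<^esub>"
  \<comment> \<open>The summand 2 keeps the level e = 1/(n + 2) below 1 for every n, so that 1 - e
    is positive and has an inverse greater than 1.\<close>
  define c where "c n = up g (1 / (real n + 2)) \<squnion>\<^bsub>M\<^esub> dn h (1 - 1 / (real n + 2))" for n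
  have "\<exists>n. c n = \<top>\<^bsub>M\<^esub>"
  proof (rule M.compact_chain[OF compact])
    show cC: "c n \<in> carrier M" for n by (simp add: c_def)
    show "c m \<sqsubseteq>\<^bsub>M\<^esub> c n" if "m \<le> n" for m n
      unfolding c_def using that
      by (intro M.join_mono up_antimono dn_mono) (simp_all add: frac_le)
    have C: "range c \<subseteq> carrier M" using cC by auto
    have c_le: "c n \<sqsubseteq>\<^bsub>M\<^esub> \<Squnion>\<^bsub>M\<^esub>(range c)" for n using C by (intro M.sup_upper) auto
    have ex: "\<exists>n. 1 / (real n + 2) \<le> e" if "e > 0" for e :: real
    proof -
      obtain n where "1 / e < real n" using reals_Archimedean2 by blast
      then show ?thesis using that by (intro exI[of _ n]) (simp add: field_simps)
    qed
    have "up g 0 \<sqsubseteq>\<^bsub>M\<^esub> \<Squnion>\<^bsub>M\<^esub>(range c)"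
    proof (rule up_le)
      fix b :: real assume "0 < b"
      then obtain n where n: "1 / (real n + 2) \<le> b" using ex by blast
      have "up g b \<sqsubseteq>\<^bsub>M\<^esub> up g (1 / (real n + 2))" using n by (rule up_antimono)
      also have "\<dots> \<sqsubseteq>\<^bsub>M\<^esub> c n" by (simp add: c_def M.join_left)
      also note c_le
      finally show "up g b \<sqsubseteq>\<^bsub>M\<^esub> \<Squnion>\<^bsub>M\<^esub>(range c)" using cC C by simp
    qed (use C in simp)
    moreover have "dn h 1 \<sqsubseteq>\<^bsub>M\<^esub> \<Squnion>\<^bsub>M\<^esub>(range c)"
    proof (rule dn_le)
      fix b :: real assume "b < 1"
      then obtain n where n: "1 / (real n + 2) \<le> 1 - b" using ex[of "1 - b"] by auto
      then have "dn h b \<sqsubseteq>\<^bsub>M\<^esub> dn h (1 - 1 / (real n + 2))" by (intro dn_mono) simp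
      also have "\<dots> \<sqsubseteq>\<^bsub>M\<^esub> c n" by (simp add: c_def M.join_right)
      also note c_le
      finally show "dn h b \<sqsubseteq>\<^bsub>M\<^esub> \<Squnion>\<^bsub>M\<^esub>(range c)" using cC C by simp
    qed (use C in simp)
    ultimately have "up g 0 \<squnion>\<^bsub>M\<^esub> dn h 1 \<sqsubseteq>\<^bsub>M\<^esub> \<Squnion>\<^bsub>M\<^esub>(range c)"
      using C by (simp add: M.join_le_iff)
    then show "\<Squnion>\<^bsub>M\<^esub>(range c) = \<top>\<^bsub>M\<^esub>" using top C by (simp add: M.top_le_iff)
  qed
  then obtain n where n: "c n = \<top>\<^bsub>M\<^esub>" ..
  define e where "e = 1 / (real n + 2)"
  have e: "0 < e" "e < 1" by (auto simp: e_def)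
  have hg: "up h (1 - e) \<sqsubseteq>\<^bsub>M\<^esub> up g e"
    using n by (intro M.cut[of _ "dn h (1 - e)"]) (auto simp: c_def e_def up_dn_disjoint join_comm)
  \<comment> \<open>With this r, the multiple r h exceeds 1 exactly where h exceeds 1 - e.\<close>
  define r where "r = 1 / (1 - e)"
  have r: "r > 1" "1 / r = 1 - e" using e by (auto simp: r_def)
  let ?h = "r *\<^sub>R h"
  have h1: "0 \<le> ?h" using h r by (intro scaleR_nonneg_nonneg) auto
  have h': "0 \<le> ?h" "0 \<le> ?h - t ?h" using h1 sub_trunc_nonneg[OF h1] by auto
  have g': "0 \<le> (1 / e) *\<^sub>R g" using g e by (intro scaleR_nonneg_nonneg) auto
  \<comment> \<open>Only levels in [0, 1) matter, as the right side is top below 0 and the left side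
    is bottom from 1 on. At these levels g > e already makes (1/e) g exceed 1.\<close>
  have "t (?h - t ?h) \<le> (1 / e) *\<^sub>R g"
    unfolding le_iff
  proof
    fix a :: real
    consider "a < 0" | "a \<ge> 1" | "0 \<le> a" "a < 1" by linarith
    then show "up (t (?h - t ?h)) a \<sqsubseteq>\<^bsub>M\<^esub> up ((1 / e) *\<^sub>R g) a"
    proof cases
      case 1 then show ?thesis using up_nonneg[OF g' 1] by simp
    next
      case 2 then show ?thesis using h' by (simp add: up_trunc)
    next
      case 3
      have "up (t (?h - t ?h)) a = up ?h (a + 1)" using 3 h' by (simp add: up_trunc up_sub_trunc)
      also have "\<dots> \<sqsubseteq>\<^bsub>M\<^esub> up ?h 1" using 3 by (intro up_antimono) simp
      also have "up ?h 1 = up h (1 - e)" using r by (simp add: up_scaleR)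
      also note hg
      also have "up g e \<sqsubseteq>\<^bsub>M\<^esub> up g (a / (1 / e))" using 3 e by (intro up_antimono) (simp add: mult_le_cancel_right1)
      also have "up g (a / (1 / e)) = up ((1 / e) *\<^sub>R g) a" using e by (simp add: up_scaleR)
      finally show ?thesis by simp
    qed
  qed
  then show "\<exists>r>1. \<exists>n>0. t (r *\<^sub>R h - t (r *\<^sub>R h)) \<le> n *\<^sub>R g"
    using r(1) e(1) by (metis zero_less_divide_1_iff)
next
  assume "\<exists>r>1. \<exists>n>0. t (r *\<^sub>R h - t (r *\<^sub>R h)) \<le> n *\<^sub>R g"
  then obtain r n where r: "r > 1" and n: "n > 0" and le: "t (r *\<^sub>R h - t (r *\<^sub>R h)) \<le> n *\<^sub>R g"
    by blast
  have h1: "0 \<le> r *\<^sub>R h" using h r by (intro scaleR_nonneg_nonneg) auto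
  have h': "0 \<le> r *\<^sub>R h" "0 \<le> r *\<^sub>R h - t (r *\<^sub>R h)" using h1 sub_trunc_nonneg[OF h1] by auto
  have "up h (1 / r) = up (t (r *\<^sub>R h - t (r *\<^sub>R h))) 0"
    using h' r by (simp add: up_trunc up_sub_trunc up_scaleR)
  also have "\<dots> \<sqsubseteq>\<^bsub>M\<^esub> up (n *\<^sub>R g) 0" using le le_iff by blast
  also have "\<dots> = up g 0" using n by (simp add: up_scaleR)
  finally have "up h (1 / r) \<squnion>\<^bsub>M\<^esub> dn h 1 \<sqsubseteq>\<^bsub>M\<^esub> up g 0 \<squnion>\<^bsub>M\<^esub> dn h 1"
    by (intro M.join_mono) auto
  moreover have "up h (1 / r) \<squnion>\<^bsub>M\<^esub> dn h 1 = \<top>\<^bsub>M\<^esub>" using r by (intro up_dn_cover) simp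
  ultimately show "up g 0 \<squnion>\<^bsub>M\<^esub> dn h 1 = \<top>\<^bsub>M\<^esub>" by (simp add: M.top_le_iff)
qed

text \<open>Disjointness means h \<ge> 1 wherever g > 0. Then \<open>t (n g)\<close>, which is at
  most 1 and vanishes where g does, lies below h. Conversely the truncated multiples approach 1 on
  all of coz g as n grows, which forces h \<ge> 1 there.\<close>

lemma disjoint_iff:
  assumes g: "0 \<le> g" and h: "0 \<le> h"
  shows "up g 0 \<sqinter>\<^bsub>M\<^esub> dn h 1 = \<bottom>\<^bsub>M\<^esub> \<longleftrightarrow> (\<forall>n>0. t (n *\<^sub>R g) \<le> h)"
proof
  assume bot: "up g 0 \<sqinter>\<^bsub>M\<^esub> dn h 1 = \<bottom>\<^bsub>M\<^esub>"
  show "\<forall>n>0. t (n *\<^sub>R g) \<le> h"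
  proof (intro allI impI)
    fix n :: real assume n: "n > 0"
    have g': "0 \<le> n *\<^sub>R g" using g n by (intro scaleR_nonneg_nonneg) auto
    show "t (n *\<^sub>R g) \<le> h"
      unfolding le_iff
    proof
      fix a :: real
      consider "a < 0" | "a \<ge> 1" | "0 \<le> a" "a < 1" by linarith
      then show "up (t (n *\<^sub>R g)) a \<sqsubseteq>\<^bsub>M\<^esub> up h a"
      proof cases
        case 1 then show ?thesis using up_nonneg[OF h 1] by simp
      next
        case 2 then show ?thesis using g' by (simp add: up_trunc)
      next
        case 3
        have "up (t (n *\<^sub>R g)) a = up g (a / n)" using 3 g' n by (simp add: up_trunc up_scaleR)
        also have "\<dots> \<sqsubseteq>\<^bsub>M\<^esub> up g 0" using 3 n by (intro up_antimono) simp
        also have "up g 0 \<sqsubseteq>\<^bsub>M\<^esub> up h a"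
          using bot 3 up_dn_cover[of a 1 h] by (intro M.cut[of _ "dn h 1"]) (auto simp: join_comm)
        finally show ?thesis by simp
      qed
    qed
  qed
next
  assume le: "\<forall>n>0. t (n *\<^sub>R g) \<le> h"
  have "ext g {a<..} \<sqinter>\<^bsub>M\<^esub> ext h {..<b} \<sqsubseteq>\<^bsub>M\<^esub> \<bottom>\<^bsub>M\<^esub>" if ab: "a > ereal 0" "b < ereal 1" for a b
  proof -
    obtain a' where a': "0 < a'" "ereal a' < a" using ereal_dense2[of "ereal 0" a] ab by auto
    obtain b' where b': "b < ereal b'" "b' < 1" using ereal_dense2[of b "ereal 1"] ab by auto
    \<comment> \<open>The factor is chosen so that g > a' makes the multiple exceed 1; its
      truncation, and with it h, then exceeds b' < 1.\<close>
    have g': "0 \<le> (1 / a') *\<^sub>R g" using g a' by (intro scaleR_nonneg_nonneg) auto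
    have "ext g {a<..} \<sqsubseteq>\<^bsub>M\<^esub> up g (b' / (1 / a'))"
    proof (rule ext.map_subset)
      have "b' * a' \<le> a'" using a' b' by (simp add: mult_le_cancel_right1)
      then have "ereal (b' * a') < a" using a' by (metis ereal_less_eq(3) le_less_trans)
      then show "{a<..} \<subseteq> {ereal (b' / (1 / a'))<..}" by (auto intro: less_trans)
    qed auto
    also have "\<dots> = up ((1 / a') *\<^sub>R g) b'" using a' by (simp add: up_scaleR)
    also have "\<dots> = up (t ((1 / a') *\<^sub>R g)) b'" using g' b' by (simp add: up_trunc)
    also have "\<dots> \<sqsubseteq>\<^bsub>M\<^esub> up h b'" using le a' le_iff by (meson zero_less_divide_1_iff)
    finally have "ext g {a<..} \<sqinter>\<^bsub>M\<^esub> ext h {..<b} \<sqsubseteq>\<^bsub>M\<^esub> up h b' \<sqinter>\<^bsub>M\<^esub> ext h {..<b}"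
      by (intro M.meet_mono) auto
    also have "up h b' \<sqinter>\<^bsub>M\<^esub> ext h {..<b} = \<bottom>\<^bsub>M\<^esub>"
      using b' by (intro ext.map_greaterThan_disjoint) simp
    finally show ?thesis .
  qed
  then have "up g 0 \<sqinter>\<^bsub>M\<^esub> dn h 1 \<sqsubseteq>\<^bsub>M\<^esub> \<bottom>\<^bsub>M\<^esub>"
    unfolding ext.map_lessThan_sup[of h "ereal 1"] ext.map_greaterThan_sup[of g "ereal 0"]
    by (intro M.sup_meet_sup_le) auto
  then show "up g 0 \<sqinter>\<^bsub>M\<^esub> dn h 1 = \<bottom>\<^bsub>M\<^esub>" by (simp add: M.le_bot_iff)
qed

text \<open>Truncation changes neither coz nor con, so although snugness speaks of truncated
  elements the generators can be indexed by the whole positive cone.\<close>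

lemma generators_base:
  assumes "x \<in> carrier M"
  shows "\<exists>A\<subseteq>UNIV \<times> {g. 0 \<le> g}. x = \<Squnion>\<^bsub>M\<^esub>(gen ` A)"
proof -
  have tr: "\<exists>g. 0 \<le> g \<and> f = \<mu> (t g)" if f: "f \<in> truncated_elements L G" for f
  proof -
    from f obtain f' where f': "f = R0_trunc L f'" "f' \<in> G" "R0_nonneg L f'"
      by (auto simp: truncated_elements_def)
    obtain g where g: "f' = \<mu> g" using \<mu>_surj f' by blast
    have "R0_zero L = \<mu> 0"
      by (rule extensionalityI[OF _ \<mu>_extensional]) (auto simp: R0_zero_def \<mu>_zero)
    then have "\<mu> (sup_class.sup g 0) = \<mu> g"
      using f' g iso by (simp add: R0_nonneg_def trunc_iso_onto_def)
    then have "sup_class.sup g 0 = g" by (simp add: \<mu>_inj)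
    then have "0 \<le> g" using sup_ge2[of 0 g] by simp
    moreover have "f = \<mu> (t g)" using f' g iso \<open>0 \<le> g\<close> by (simp add: trunc_iso_onto_def)
    ultimately show ?thesis by blast
  qed
  obtain A where A: "A \<subseteq> coz_element q ` truncated_elements L G \<union> con_element q ` truncated_elements L G"
    "x = \<Squnion>\<^bsub>M\<^esub>A" using assms snug by (auto simp: snugly_embedded_def)
  have "\<exists>i\<in>UNIV \<times> {g. 0 \<le> g}. a = gen i" if a: "a \<in> A" for a
  proof -
    from a A obtain f where f: "f \<in> truncated_elements L G" "a = coz_element q f \<or> a = con_element q f"
      by auto
    then obtain g where g: "0 \<le> g" "f = \<mu> (t g)" using tr[OF f(1)] by auto
    have "coz_element q f = up (t g) 0" "con_element q f = dn (t g) 1"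
      by (simp_all add: coz_element_def con_element_def ext_def g(2) zero_ereal_def one_ereal_def)
    then have "a = gen (True, g) \<or> a = gen (False, g)"
      using f g by (simp add: gen_def up_trunc dn_trunc)
    then show ?thesis using g by blast
  qed
  then have "A \<subseteq> gen ` (UNIV \<times> {g. 0 \<le> g})" by blast
  then obtain B where "B \<subseteq> UNIV \<times> {g. 0 \<le> g}" "A = gen ` B" by (meson subset_imageE)
  then show ?thesis using A by blast
qed

end

section \<open>Extending a map of generators to a frame homomorphism\<close>

lemma (in frame) sup_insert_eq:
  assumes "x \<in> carrier L" "A \<subseteq> carrier L"
  shows "\<Squnion>(insert x A) = x \<squnion> \<Squnion>A"
  using assms
  by (intro sup_eqI)
    (auto simp: join_le_iff sup_le_iff intro: join_left sup_upper le_trans[OF _ join_right])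

lemma
  shows sup_two: "\<And>B. \<Squnion>\<^bsub>two\<^esub>B \<longleftrightarrow> True \<in> B"
    and meet_two: "\<And>a b. a \<sqinter>\<^bsub>two\<^esub> b \<longleftrightarrow> a \<and> b"
    and top_two: "\<top>\<^bsub>two\<^esub> = True"
proof -
  interpret partial_order two
    by unfold_locales (auto simp: two_def)
  interpret complete_lattice two
  proof
    fix A :: "bool set"
    have "least two (True \<in> A) (Upper two A)"
      by (auto simp: least_def Upper_def two_def)
    then show "\<exists>s. least two s (Upper two A)" ..
    have "greatest two (False \<notin> A) (Lower two A)"
      by (auto simp: greatest_def Lower_def two_def) (metis (full_types))+
    then show "\<exists>i. greatest two i (Lower two A)" ..
  qed
  have C: "carrier two = UNIV" and le: "\<And>a b. a \<sqsubseteq>\<^bsub>two\<^esub> b \<longleftrightarrow> (a \<longrightarrow> b)"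
    by (auto simp: two_def)
  show sup: "\<Squnion>\<^bsub>two\<^esub>B \<longleftrightarrow> True \<in> B" for B
    using sup_upper[of B True] sup_least[of B False] unfolding C le by (metis subset_UNIV UNIV_I)
  show meet: "a \<sqinter>\<^bsub>two\<^esub> b \<longleftrightarrow> a \<and> b" for a b
    using meet_left[of a b] meet_right[of a b] meet_le[of "a \<and> b" a b] unfolding C le by auto
  show "\<top>\<^bsub>two\<^esub> = True"
    using top_higher[of True] unfolding C le by simp
qed

context pointed_frame
begin

lemma point_sup: "A \<subseteq> carrier L \<Longrightarrow> point L (\<Squnion>A) \<longleftrightarrow> (\<exists>a\<in>A. point L a)"
  using point_hom by (auto simp: frame_hom_def sup_two image_iff)

lemma point_top: "point L \<top>"
  using point_hom by (simp add: frame_hom_def top_two)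

lemma point_bot: "\<not> point L \<bottom>"
  using point_sup[of "{}"] by (simp add: sup_empty_eq)

lemma point_meet: "x \<in> carrier L \<Longrightarrow> y \<in> carrier L \<Longrightarrow> point L (x \<sqinter> y) \<longleftrightarrow> point L x \<and> point L y"
  using point_hom by (simp add: frame_hom_def meet_two)

end

text \<open>Lists of indices are used instead of finite sets of elements: different indices may name
  the same element, and the normal forms of joins and meets are computed by recursion along the
  list.\<close>

definition joins where "joins L f is = foldr (\<lambda>i y. f i \<squnion>\<^bsub>L\<^esub> y) is \<bottom>\<^bsub>L\<^esub>"
definition meets where "meets L f is = foldr (\<lambda>i y. f i \<sqinter>\<^bsub>L\<^esub> y) is \<top>\<^bsub>L\<^esub>"

lemma joins_simps [simp]:
  "joins L f [] = \<bottom>\<^bsub>L\<^esub>" "joins L f (i # is) = f i \<squnion>\<^bsub>L\<^esub> joins L f is"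
  by (simp_all add: joins_def)

lemma meets_simps [simp]:
  "meets L f [] = \<top>\<^bsub>L\<^esub>" "meets L f (i # is) = f i \<sqinter>\<^bsub>L\<^esub> meets L f is"
  by (simp_all add: meets_def)

context frame
begin

lemma joins_eq_sup:
  "(\<And>i. i \<in> set is \<Longrightarrow> f i \<in> carrier L) \<Longrightarrow> joins L f is = \<Squnion>(f ` set is)"
  by (induction "is") (auto simp: sup_empty_eq sup_insert_eq image_subset_iff)

lemma joins_closed [simp]:
  "(\<And>i. i \<in> set is \<Longrightarrow> f i \<in> carrier L) \<Longrightarrow> joins L f is \<in> carrier L"
  by (induction "is") auto

lemma meets_closed [simp]:
  "(\<And>i. i \<in> set is \<Longrightarrow> f i \<in> carrier L) \<Longrightarrow> meets L f is \<in> carrier L"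
  by (induction "is") auto

lemma compact_joins:
  assumes "compact_frame L" and C: "\<And>i. i \<in> A \<Longrightarrow> f i \<in> carrier L" "x \<in> carrier L"
    and top: "x \<squnion> \<Squnion>(f ` A) = \<top>"
  obtains "is" where "set is \<subseteq> A" "x \<squnion> joins L f is = \<top>"
proof -
  have "\<Squnion>(insert x (f ` A)) = \<top>" using C top by (subst sup_insert_eq) auto
  moreover have "insert x (f ` A) \<subseteq> carrier L" using C by auto
  ultimately obtain F where F: "F \<subseteq> insert x (f ` A)" "finite F" "\<Squnion>F = \<top>"
    using assms(1) unfolding compact_frame_def by blast
  have "F - {x} \<subseteq> f ` A" "finite (F - {x})" using F by auto
  then obtain B where B: "B \<subseteq> A" "finite B" "F - {x} = f ` B"
    by (meson finite_subset_image)
  then obtain "is" where is_: "set is = B" using finite_list by blast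
  have sub: "f ` B \<subseteq> carrier L" using B C by auto
  have "F \<subseteq> insert x (f ` B)" using B by auto
  then have "\<Squnion>F \<sqsubseteq> \<Squnion>(insert x (f ` B))"
    using sub C F(1) by (intro sup_least) (auto intro!: sup_upper)
  then have "\<Squnion>(insert x (f ` B)) = \<top>"
    using F sub C by (simp add: top_le_iff)
  then have "x \<squnion> joins L f is = \<top>"
    using sub C is_ by (subst joins_eq_sup) (auto simp: sup_insert_eq)
  then show ?thesis using that is_ B by blast
qed

lemma joins_append:
  assumes "\<And>i. i \<in> set is \<Longrightarrow> f i \<in> carrier L" "\<And>i. i \<in> set js \<Longrightarrow> f i \<in> carrier L"
  shows "joins L f (is @ js) = joins L f is \<squnion> joins L f js"
proof -
  have "\<bottom> \<squnion> x = x" if "x \<in> carrier L" for x using that join_absorb[of "\<bottom>" x] by simp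
  then show ?thesis using assms
    by (induction "is") (auto simp: join_assoc)
qed

lemma joins_le:
  assumes "\<And>i. i \<in> set is \<Longrightarrow> f i \<in> carrier L" "x \<in> carrier L" "\<And>i. i \<in> set is \<Longrightarrow> f i \<sqsubseteq> x"
  shows "joins L f is \<sqsubseteq> x"
  using assms by (induction "is") (auto simp: join_le_iff)

end

text \<open>
  If \<open>\<alpha> i\<close> is rather below \<open>\<alpha> j\<close>, then by compactness finitely many generators disjoint from \<open>\<alpha> i\<close>
  cover together with \<open>\<alpha> j\<close>; both facts are carried to \<open>N\<close>, and give \<open>\<beta> i \<le> \<beta> j\<close>.
\<close>

locale base_extension = M: frame M + N: frame N for M (structure) and N (structure) +
  fixes I :: "'i set" and \<alpha> \<beta>
  assumes compact: "compact_frame M" and regular: "regular_frame M"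
    and \<alpha>_closed [simp]: "i \<in> I \<Longrightarrow> \<alpha> i \<in> carrier M"
    and \<beta>_closed [simp]: "i \<in> I \<Longrightarrow> \<beta> i \<in> carrier N"
    and base: "x \<in> carrier M \<Longrightarrow> \<exists>A\<subseteq>I. x = \<Squnion>(\<alpha> ` A)"
    and cover: "set is \<subseteq> I \<Longrightarrow> joins M \<alpha> is = \<top> \<Longrightarrow> joins N \<beta> is = \<top>\<^bsub>N\<^esub>"
    and disjoint: "set is \<subseteq> I \<Longrightarrow> meets M \<alpha> is = \<bottom> \<Longrightarrow> meets N \<beta> is = \<bottom>\<^bsub>N\<^esub>"
begin

text \<open>Taking the generators rather below \<open>x\<close>, and not all those below it, makes
  preservation of joins a matter of compactness (\<open>interpolate\<close>). That generators have
  the intended image is then a separate question, answered by \<open>lift_generator\<close>.\<close>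

definition lift where
  "lift = (\<lambda>x\<in>carrier M. \<Squnion>\<^bsub>N\<^esub>(\<beta> ` {i\<in>I. rather_below M (\<alpha> i) x}))"

lemma meets_le_joins:
  assumes I: "set is \<subseteq> I" "set js \<subseteq> I" and rb: "rather_below M (meets M \<alpha> is) (joins M \<alpha> js)"
  shows "meets N \<beta> is \<sqsubseteq>\<^bsub>N\<^esub> joins N \<beta> js"
proof -
  have [simp]: "meets M \<alpha> is \<in> carrier M" "joins M \<alpha> js \<in> carrier M"
    "meets N \<beta> is \<in> carrier N" "joins N \<beta> js \<in> carrier N"
    using I by (auto intro!: M.meets_closed M.joins_closed N.meets_closed N.joins_closed)
  obtain w where w: "w \<in> carrier M" "w \<sqinter> meets M \<alpha> is = \<bottom>" "w \<squnion> joins M \<alpha> js = \<top>"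
    by (rule M.rather_belowE[OF rb]) auto
  obtain A where A: "A \<subseteq> I" "w = \<Squnion>(\<alpha> ` A)" using base w by blast
  have "joins M \<alpha> js \<squnion> \<Squnion>(\<alpha> ` A) = \<top>" using w A by (simp add: join_comm)
  then obtain ks where ks: "set ks \<subseteq> A" "joins M \<alpha> js \<squnion> joins M \<alpha> ks = \<top>"
    using A by (elim M.compact_joins[OF compact, rotated 2]) auto
  have ksI: "set ks \<subseteq> I" using ks A by auto
  have [simp]: "joins N \<beta> ks \<in> carrier N" using ksI by (intro N.joins_closed) auto
  have "joins M \<alpha> (ks @ js) = joins M \<alpha> js \<squnion> joins M \<alpha> ks"
    using ksI I by (subst M.joins_append) (auto simp: join_comm)
  then have "joins N \<beta> (ks @ js) = \<top>\<^bsub>N\<^esub>" using ks ksI I by (intro cover) auto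
  then have 1: "joins N \<beta> ks \<squnion>\<^bsub>N\<^esub> joins N \<beta> js = \<top>\<^bsub>N\<^esub>"
    using ksI I by (subst (asm) N.joins_append) auto
  have 2: "meets N \<beta> is \<sqinter>\<^bsub>N\<^esub> \<beta> k \<sqsubseteq>\<^bsub>N\<^esub> \<bottom>\<^bsub>N\<^esub>" if k: "k \<in> set ks" for k
  proof -
    have kI: "k \<in> I" "k \<in> A" using k ks ksI by auto
    have "\<alpha> k \<sqsubseteq> w" unfolding A(2) using A(1) kI by (intro M.sup_upper) auto
    then have "\<alpha> k \<sqinter> meets M \<alpha> is \<sqsubseteq> w \<sqinter> meets M \<alpha> is"
      using kI w by (intro M.meet_mono) auto
    then have "meets M \<alpha> (k # is) = \<bottom>" using w kI by (simp add: M.le_bot_iff)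
    then have "meets N \<beta> (k # is) = \<bottom>\<^bsub>N\<^esub>" using kI I by (intro disjoint) auto
    then show ?thesis by (simp add: meet_comm)
  qed
  have "meets N \<beta> is \<sqinter>\<^bsub>N\<^esub> joins N \<beta> ks \<sqsubseteq>\<^bsub>N\<^esub> \<bottom>\<^bsub>N\<^esub>"
    using 2 ksI by (subst N.joins_eq_sup) (auto intro!: N.meet_sup_le)
  then have "meets N \<beta> is \<sqinter>\<^bsub>N\<^esub> joins N \<beta> ks = \<bottom>\<^bsub>N\<^esub>" by (simp add: N.le_bot_iff)
  then show ?thesis using 1 by (intro N.cut[of _ "joins N \<beta> ks"]) auto
qed

text \<open>By regularity a member x of X is the join of the elements rather below it. Each of these
  is a join of generators, and they are rather below x as well.\<close>

lemma sup_eq_rather_below: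
  assumes "X \<subseteq> carrier M"
  shows "\<Squnion>X = \<Squnion>(\<alpha> ` {i\<in>I. \<exists>x\<in>X. rather_below M (\<alpha> i) x})" (is "_ = \<Squnion>(\<alpha> ` ?J)")
proof (rule M.sup_eqI)
  have J: "\<alpha> ` ?J \<subseteq> carrier M" by auto
  show "x \<sqsubseteq> \<Squnion>(\<alpha> ` ?J)" if x: "x \<in> X" for x
  proof -
    have xC: "x \<in> carrier M" using x assms by auto
    have "y \<sqsubseteq> \<Squnion>(\<alpha> ` ?J)" if y: "y \<in> carrier M" "rather_below M y x" for y
    proof -
      obtain A where A: "A \<subseteq> I" "y = \<Squnion>(\<alpha> ` A)" using base y by blast
      have "\<alpha> i \<sqsubseteq> \<Squnion>(\<alpha> ` ?J)" if i: "i \<in> A" for i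
      proof -
        have iI: "i \<in> I" using i A by auto
        have "\<alpha> i \<sqsubseteq> y" unfolding A(2) using A(1) i by (intro M.sup_upper) auto
        then have "rather_below M (\<alpha> i) x"
          using y xC iI by (intro M.rather_below_mono[OF y(2)]) auto
        then have "i \<in> ?J" using x iI by blast
        then show ?thesis using J by (intro M.sup_upper) auto
      qed
      then show ?thesis unfolding A(2) using A(1) J by (intro M.sup_least) auto
    qed
    then have "\<Squnion>{y \<in> carrier M. rather_below M y x} \<sqsubseteq> \<Squnion>(\<alpha> ` ?J)"
      using J by (intro M.sup_least) auto
    moreover have "x = \<Squnion>{y \<in> carrier M. rather_below M y x}"
      using regular xC unfolding regular_frame_def by blast
    ultimately show ?thesis by simp
  qed
  show "\<Squnion>(\<alpha> ` ?J) \<sqsubseteq> z" if z: "z \<in> carrier M" "\<And>x. x \<in> X \<Longrightarrow> x \<sqsubseteq> z" for z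
  proof (rule M.sup_least[OF J z(1)])
    fix y assume "y \<in> \<alpha> ` ?J"
    then obtain i x where i: "i \<in> I" "y = \<alpha> i" "x \<in> X" "rather_below M (\<alpha> i) x" by auto
    have "x \<in> carrier M" using i assms by auto
    then have "\<alpha> i \<sqsubseteq> x" using i M.rather_below_le by simp
    then show "y \<sqsubseteq> z"
      using z(2)[OF i(3)] i z(1) \<open>x \<in> carrier M\<close> M.le_trans[of "\<alpha> i" x z] by simp
  qed
qed (use assms in \<open>auto intro!: M.sup_closed\<close>)

text \<open>The witness for a being rather below the join covers together with the generators rather
  below members of X; by compactness finitely many of these suffice, with the same witness.\<close>

lemma interpolate:
  assumes "X \<subseteq> carrier M" "a \<in> carrier M" "rather_below M a (\<Squnion>X)"
  obtains js where "set js \<subseteq> {i\<in>I. \<exists>x\<in>X. rather_below M (\<alpha> i) x}" "rather_below M a (joins M \<alpha> js)"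
proof -
  let ?J = "{i\<in>I. \<exists>x\<in>X. rather_below M (\<alpha> i) x}"
  obtain w where w: "w \<in> carrier M" "w \<sqinter> a = \<bottom>" "w \<squnion> \<Squnion>X = \<top>"
    by (rule M.rather_belowE[OF assms(3)]) (use assms in auto)
  have "w \<squnion> \<Squnion>(\<alpha> ` ?J) = \<top>" using w(3) sup_eq_rather_below[OF assms(1)] by simp
  then obtain js where js: "set js \<subseteq> ?J" "w \<squnion> joins M \<alpha> js = \<top>"
    using w by (elim M.compact_joins[OF compact, rotated 2]) auto
  have "joins M \<alpha> js \<in> carrier M" using js by (intro M.joins_closed) auto
  then have "rather_below M a (joins M \<alpha> js)"
    using w js assms by (intro M.rather_belowI[of _ _ w]) auto
  then show ?thesis using that js by blast
qed

lemma lift_closed [simp]: "x \<in> carrier M \<Longrightarrow> lift x \<in> carrier N"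
  by (auto simp: lift_def intro!: N.sup_closed)

lemma le_lift: "i \<in> I \<Longrightarrow> x \<in> carrier M \<Longrightarrow> rather_below M (\<alpha> i) x \<Longrightarrow> \<beta> i \<sqsubseteq>\<^bsub>N\<^esub> lift x"
  by (auto simp: lift_def intro!: N.sup_upper)

lemma lift_le:
  assumes "x \<in> carrier M" "z \<in> carrier N"
    and "\<And>i. i \<in> I \<Longrightarrow> rather_below M (\<alpha> i) x \<Longrightarrow> \<beta> i \<sqsubseteq>\<^bsub>N\<^esub> z"
  shows "lift x \<sqsubseteq>\<^bsub>N\<^esub> z"
  using assms by (auto simp: lift_def intro!: N.sup_least)

text \<open>The one estimate behind \<open>lift_hom\<close>: the empty list gives the top, a list of
  two gives binary meets, and a list of one gives arbitrary joins.\<close>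

lemma meets_le_sup_lift:
  assumes "X \<subseteq> carrier M" "set is \<subseteq> I" "rather_below M (meets M \<alpha> is) (\<Squnion>X)"
  shows "meets N \<beta> is \<sqsubseteq>\<^bsub>N\<^esub> \<Squnion>\<^bsub>N\<^esub>(lift ` X)"
proof -
  have "meets M \<alpha> is \<in> carrier M" using assms by (intro M.meets_closed) auto
  then obtain js where js: "set js \<subseteq> {i\<in>I. \<exists>x\<in>X. rather_below M (\<alpha> i) x}"
    "rather_below M (meets M \<alpha> is) (joins M \<alpha> js)"
    using interpolate assms by blast
  have X: "lift ` X \<subseteq> carrier N" using assms by auto
  have "meets N \<beta> is \<sqsubseteq>\<^bsub>N\<^esub> joins N \<beta> js" using js assms by (intro meets_le_joins) auto
  also have "joins N \<beta> js \<sqsubseteq>\<^bsub>N\<^esub> \<Squnion>\<^bsub>N\<^esub>(lift ` X)"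
  proof (rule N.joins_le)
    fix j assume "j \<in> set js"
    then obtain x where x: "j \<in> I" "x \<in> X" "rather_below M (\<alpha> j) x" using js by auto
    then have xC: "x \<in> carrier M" using assms by auto
    have "\<beta> j \<sqsubseteq>\<^bsub>N\<^esub> lift x" using x xC by (intro le_lift)
    also have "lift x \<sqsubseteq>\<^bsub>N\<^esub> \<Squnion>\<^bsub>N\<^esub>(lift ` X)" using x X by (intro N.sup_upper) auto
    finally show "\<beta> j \<sqsubseteq>\<^bsub>N\<^esub> \<Squnion>\<^bsub>N\<^esub>(lift ` X)" using x X xC by auto
  qed (use js X in auto)
  finally show ?thesis
  proof this
    have "\<And>i. i \<in> set is \<Longrightarrow> i \<in> I" "\<And>i. i \<in> set js \<Longrightarrow> i \<in> I" using assms js by auto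
    then show "meets N \<beta> is \<in> carrier N" "joins N \<beta> js \<in> carrier N" "\<Squnion>\<^bsub>N\<^esub>(lift ` X) \<in> carrier N"
      using X by (auto intro!: N.meets_closed N.joins_closed)
  qed
qed

lemma lift_mono: "x \<in> carrier M \<Longrightarrow> y \<in> carrier M \<Longrightarrow> x \<sqsubseteq> y \<Longrightarrow> lift x \<sqsubseteq>\<^bsub>N\<^esub> lift y"
  by (rule lift_le) (auto intro!: le_lift elim: M.rather_below_mono)

lemma lift_hom: "frame_hom M N lift"
  unfolding frame_hom_def
proof (intro conjI ballI allI impI)
  show "lift \<in> carrier M \<rightarrow> carrier N" by auto
  have "meets N \<beta> [] \<sqsubseteq>\<^bsub>N\<^esub> \<Squnion>\<^bsub>N\<^esub>(lift ` {\<top>})"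
    by (rule meets_le_sup_lift) (auto simp: M.rather_below_top)
  then show "lift \<top> = \<top>\<^bsub>N\<^esub>" by (simp add: N.top_le_iff)
next
  fix x y assume xy: "x \<in> carrier M" "y \<in> carrier M"
  show "lift (x \<sqinter> y) = lift x \<sqinter>\<^bsub>N\<^esub> lift y"
  proof (rule N.le_antisym)
    show "lift (x \<sqinter> y) \<sqsubseteq>\<^bsub>N\<^esub> lift x \<sqinter>\<^bsub>N\<^esub> lift y"
      using xy by (simp add: N.le_meet_iff lift_mono M.meet_left M.meet_right)
    have "\<beta> i \<sqinter>\<^bsub>N\<^esub> \<beta> j \<sqsubseteq>\<^bsub>N\<^esub> lift (x \<sqinter> y)"
      if ij: "i \<in> I" "rather_below M (\<alpha> i) x" "j \<in> I" "rather_below M (\<alpha> j) y" for i j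
    proof -
      have "rather_below M (\<alpha> i \<sqinter> \<alpha> j) (x \<sqinter> y)"
        using ij xy by (intro M.rather_below_meet) auto
      then have "meets N \<beta> [i, j] \<sqsubseteq>\<^bsub>N\<^esub> \<Squnion>\<^bsub>N\<^esub>(lift ` {x \<sqinter> y})"
        using ij xy by (intro meets_le_sup_lift) (auto simp: M.meet_top)
      then show ?thesis using ij xy by (simp add: N.meet_top)
    qed
    then show "lift x \<sqinter>\<^bsub>N\<^esub> lift y \<sqsubseteq>\<^bsub>N\<^esub> lift (x \<sqinter> y)"
      using xy unfolding lift_def[THEN fun_cong, of x] lift_def[THEN fun_cong, of y]
      by (auto intro!: N.sup_meet_sup_le)
  qed (use xy in auto)
next
  fix X assume X: "X \<subseteq> carrier M"
  then have lX: "lift ` X \<subseteq> carrier N" by auto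
  show "lift (\<Squnion>X) = \<Squnion>\<^bsub>N\<^esub>(lift ` X)"
  proof (rule N.le_antisym)
    show "lift (\<Squnion>X) \<sqsubseteq>\<^bsub>N\<^esub> \<Squnion>\<^bsub>N\<^esub>(lift ` X)"
    proof (rule lift_le)
      fix i assume i: "i \<in> I" "rather_below M (\<alpha> i) (\<Squnion>X)"
      then have "meets N \<beta> [i] \<sqsubseteq>\<^bsub>N\<^esub> \<Squnion>\<^bsub>N\<^esub>(lift ` X)"
        using X by (intro meets_le_sup_lift) (auto simp: M.meet_top)
      then show "\<beta> i \<sqsubseteq>\<^bsub>N\<^esub> \<Squnion>\<^bsub>N\<^esub>(lift ` X)" using i by (simp add: N.meet_top)
    qed (use X lX in auto)
    show "\<Squnion>\<^bsub>N\<^esub>(lift ` X) \<sqsubseteq>\<^bsub>N\<^esub> lift (\<Squnion>X)"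
      using X lX by (intro N.sup_least) (auto intro!: lift_mono M.sup_upper)
  qed (use X lX in auto)
qed

text \<open>One inequality is \<open>meets_le_joins\<close> for single generators. The other is the
  hypothesis that the images of the generators rather below \<alpha> i exhaust \<beta> i.\<close>

lemma lift_generator:
  assumes "i \<in> I" "\<beta> i \<sqsubseteq>\<^bsub>N\<^esub> \<Squnion>\<^bsub>N\<^esub>(\<beta> ` {j\<in>I. rather_below M (\<alpha> j) (\<alpha> i)})"
  shows "lift (\<alpha> i) = \<beta> i"
proof (rule N.le_antisym)
  show "lift (\<alpha> i) \<sqsubseteq>\<^bsub>N\<^esub> \<beta> i"
  proof (rule lift_le)
    fix j assume j: "j \<in> I" "rather_below M (\<alpha> j) (\<alpha> i)"
    have "\<alpha> i \<squnion> \<bottom> = \<alpha> i" "\<beta> i \<squnion>\<^bsub>N\<^esub> \<bottom>\<^bsub>N\<^esub> = \<beta> i"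
      using assms M.join_absorb[of "\<bottom>" "\<alpha> i"] N.join_absorb[of "\<bottom>\<^bsub>N\<^esub>" "\<beta> i"]
      by (simp_all add: join_comm)
    then show "\<beta> j \<sqsubseteq>\<^bsub>N\<^esub> \<beta> i"
      using meets_le_joins[of "[j]" "[i]"] j assms by (simp add: M.meet_top N.meet_top)
  qed (use assms in auto)
  show "\<beta> i \<sqsubseteq>\<^bsub>N\<^esub> lift (\<alpha> i)" using assms by (simp add: lift_def)
qed (use assms in auto)

end

section \<open>Functoriality\<close>

text \<open>
  A finite join of generators among which \<open>con h\<close> occurs is of the form \<open>coz g' \<squnion> con h'\<close>,
  and a finite meet among which \<open>coz g\<close> occurs is of the form \<open>coz g' \<sqinter> con h'\<close>.
\<close>

definition join_nf :: "'a::{ordered_real_vector, lattice} \<Rightarrow> (bool \<times> 'a) list \<Rightarrow> 'a \<times> 'a" where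
  "join_nf h is = foldr (\<lambda>(b, g) (g', h'). if b then (sup_class.sup g g', h') else (g', inf_class.inf g h'))
    is (0, h)"

definition meet_nf :: "'a::{ordered_real_vector, lattice} \<Rightarrow> (bool \<times> 'a) list \<Rightarrow> 'a \<times> 'a" where
  "meet_nf g is = foldr (\<lambda>(b, k) (g', h'). if b then (inf_class.inf k g', h') else (g', sup_class.sup k h'))
    is (g, 0)"

lemma join_nf_nonneg:
  assumes "set is \<subseteq> UNIV \<times> {g. 0 \<le> g}" "0 \<le> h"
  shows "0 \<le> fst (join_nf h is) \<and> 0 \<le> snd (join_nf h is)"
  using assms by (induction "is") (auto simp: join_nf_def split: prod.splits intro: le_supI1)

lemma meet_nf_nonneg:
  assumes "set is \<subseteq> UNIV \<times> {g. 0 \<le> g}" "0 \<le> g"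
  shows "0 \<le> fst (meet_nf g is) \<and> 0 \<le> snd (meet_nf g is)"
  using assms by (induction "is") (auto simp: meet_nf_def split: prod.splits intro: le_supI1)

context representation
begin

text \<open>The fold starts from the pair (0, h). Here \<open>up 0 0\<close> is bottom, and the seed
  con h is accounted for by the extra join on the left, which \<open>joins_gen_mem\<close> absorbs
  when con h occurs in the list.\<close>

lemma joins_gen:
  "joins M gen is \<squnion>\<^bsub>M\<^esub> dn h 1 = up (fst (join_nf h is)) 0 \<squnion>\<^bsub>M\<^esub> dn (snd (join_nf h is)) 1"
proof (induction "is")
  case Nil
  then show ?case by (simp add: join_nf_def ext_zero)
next
  case (Cons i "is")
  obtain b g where i: "i = (b, g)" by force
  obtain G H where nf: "join_nf h is = (G, H)" by force
  have nf': "join_nf h (i # is) = (if b then (sup_class.sup g G, H) else (G, inf_class.inf g H))"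
    using nf by (simp add: join_nf_def i)
  have C: "joins M gen is \<in> carrier M" by simp
  have "joins M gen (i # is) \<squnion>\<^bsub>M\<^esub> dn h 1 = gen i \<squnion>\<^bsub>M\<^esub> (joins M gen is \<squnion>\<^bsub>M\<^esub> dn h 1)"
    using C by (simp add: M.join_assoc)
  also have "\<dots> = gen i \<squnion>\<^bsub>M\<^esub> (up G 0 \<squnion>\<^bsub>M\<^esub> dn H 1)" using Cons.IH nf by simp
  also have "\<dots> = up (fst (join_nf h (i # is))) 0 \<squnion>\<^bsub>M\<^esub> dn (snd (join_nf h (i # is))) 1"
  proof (cases b)
    case True
    then show ?thesis unfolding nf' by (simp add: i gen_def up_sup M.join_assoc)
  next
    case False
    have "dn g 1 \<squnion>\<^bsub>M\<^esub> (up G 0 \<squnion>\<^bsub>M\<^esub> dn H 1) = (up G 0 \<squnion>\<^bsub>M\<^esub> dn g 1) \<squnion>\<^bsub>M\<^esub> dn H 1"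
      using M.join_assoc[of "dn g 1" "up G 0" "dn H 1"] by (simp add: join_comm)
    then show ?thesis using False unfolding nf' by (simp add: i gen_def dn_inf M.join_assoc)
  qed
  finally show ?case .
qed

text \<open>Now the seed is (k, 0), and \<open>dn 0 1\<close> is top.\<close>

lemma meets_gen:
  "meets M gen is \<sqinter>\<^bsub>M\<^esub> up k 0 = up (fst (meet_nf k is)) 0 \<sqinter>\<^bsub>M\<^esub> dn (snd (meet_nf k is)) 1"
proof (induction "is")
  case Nil
  then show ?case by (simp add: meet_nf_def ext_zero meet_comm)
next
  case (Cons i "is")
  obtain b g where i: "i = (b, g)" by force
  obtain G H where nf: "meet_nf k is = (G, H)" by force
  have nf': "meet_nf k (i # is) = (if b then (inf_class.inf g G, H) else (G, sup_class.sup g H))"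
    using nf by (simp add: meet_nf_def i)
  have C: "meets M gen is \<in> carrier M" by simp
  have "meets M gen (i # is) \<sqinter>\<^bsub>M\<^esub> up k 0 = gen i \<sqinter>\<^bsub>M\<^esub> (meets M gen is \<sqinter>\<^bsub>M\<^esub> up k 0)"
    using C by (simp add: M.meet_assoc)
  also have "\<dots> = gen i \<sqinter>\<^bsub>M\<^esub> (up G 0 \<sqinter>\<^bsub>M\<^esub> dn H 1)" using Cons.IH nf by simp
  also have "\<dots> = up (fst (meet_nf k (i # is))) 0 \<sqinter>\<^bsub>M\<^esub> dn (snd (meet_nf k (i # is))) 1"
  proof (cases b)
    case True
    then show ?thesis unfolding nf' by (simp add: i gen_def up_inf M.meet_assoc)
  next
    case False
    have "dn g 1 \<sqinter>\<^bsub>M\<^esub> (up G 0 \<sqinter>\<^bsub>M\<^esub> dn H 1) = (up G 0 \<sqinter>\<^bsub>M\<^esub> dn g 1) \<sqinter>\<^bsub>M\<^esub> dn H 1"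
      using M.meet_assoc[of "dn g 1" "up G 0" "dn H 1"] by (simp add: meet_comm)
    then show ?thesis using False unfolding nf' by (simp add: i gen_def dn_sup M.meet_assoc)
  qed
  finally show ?case .
qed

lemma joins_gen_mem:
  assumes "(False, h) \<in> set is"
  shows "joins M gen is = up (fst (join_nf h is)) 0 \<squnion>\<^bsub>M\<^esub> dn (snd (join_nf h is)) 1"
proof -
  have "gen (False, h) \<sqsubseteq>\<^bsub>M\<^esub> joins M gen is"
    using assms by (subst M.joins_eq_sup) (auto intro!: M.sup_upper)
  then have "dn h 1 \<squnion>\<^bsub>M\<^esub> joins M gen is = joins M gen is"
    by (subst M.join_absorb) (auto simp: gen_def)
  then show ?thesis using joins_gen[of "is" h] by (simp add: join_comm)
qed

lemma meets_le_gen: "i \<in> set is \<Longrightarrow> meets M gen is \<sqsubseteq>\<^bsub>M\<^esub> gen i"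
proof (induction "is")
  case (Cons j "is")
  have C: "meets M gen is \<in> carrier M" by simp
  show ?case
  proof (cases "i = j")
    case True then show ?thesis using C by (simp add: M.meet_left)
  next
    case False
    then have "meets M gen is \<sqsubseteq>\<^bsub>M\<^esub> gen i" using Cons by simp
    then show ?thesis using C M.le_trans[OF M.meet_right[of "gen j" "meets M gen is"]] by simp
  qed
qed simp

lemma meets_gen_mem:
  assumes "(True, k) \<in> set is"
  shows "meets M gen is = up (fst (meet_nf k is)) 0 \<sqinter>\<^bsub>M\<^esub> dn (snd (meet_nf k is)) 1"
proof -
  have "meets M gen is \<sqinter>\<^bsub>M\<^esub> up k 0 = meets M gen is"
    using meets_le_gen[OF assms] by (subst M.meet_absorb) (auto simp: gen_def)
  then show ?thesis using meets_gen[of "is" k] by simp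
qed

text \<open>The top contains the point of M, and a coz never does.\<close>

lemma joins_gen_top:
  assumes "joins M gen is = \<top>\<^bsub>M\<^esub>"
  obtains h where "(False, h) \<in> set is"
proof -
  have "point M (joins M gen is)" using assms M.point_top by simp
  then have "\<exists>i\<in>set is. point M (gen i)"
    by (subst (asm) M.joins_eq_sup) (auto simp: M.point_sup image_subset_iff)
  then show ?thesis using that by (auto simp: point_gen)
qed

text \<open>The point lies in every con, hence in every finite meet of cons, whereas the bottom
  misses it.\<close>

lemma meets_gen_bot:
  assumes "meets M gen is = \<bottom>\<^bsub>M\<^esub>"
  obtains g where "(True, g) \<in> set is"
proof -
  have "\<not> point M (meets M gen is)" using assms M.point_bot by simp
  moreover have "point M (meets M gen is) \<longleftrightarrow> (\<forall>i\<in>set is. point M (gen i))"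
    by (induction "is") (auto simp: M.point_top M.point_meet)
  ultimately show ?thesis using that by (auto simp: point_gen)
qed

text \<open>Rays at positive levels are generators again. The levels b > 0 for coz and 0 < b < 1 for
  con supply the generators rather below a given one in \<open>lift_gen\<close>.\<close>

lemma gen_below_coz:
  assumes "0 < b" "0 \<le> g"
  shows "gen (True, (1 / b) *\<^sub>R g - t ((1 / b) *\<^sub>R g)) = up g b"
proof -
  have "0 \<le> (1 / b) *\<^sub>R g" using assms by (intro scaleR_nonneg_nonneg) auto
  then show ?thesis using assms by (simp add: gen_def up_sub_trunc up_scaleR)
qed

lemma gen_below_con: "0 < b \<Longrightarrow> gen (False, (1 / b) *\<^sub>R h) = dn h b"
  by (simp add: gen_def dn_scaleR)

end

section \<open>The frame homomorphism induced by a truncation homomorphism\<close>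

locale trunc_morphism = A: representation t q G \<mu> + B: representation u r H \<nu>
  for t :: "'a::{ordered_real_vector, lattice} \<Rightarrow> 'a" and q :: "('m, 'l) pframe_arrow" and G \<mu>
    and u :: "'b::{ordered_real_vector, lattice} \<Rightarrow> 'b" and r :: "('n, 'k) pframe_arrow" and H \<nu> +
  fixes \<theta>
  assumes \<theta>: "trunc_hom t u \<theta>"
begin

lemma \<theta>_linear: "linear \<theta>" using \<theta> by (simp add: trunc_hom_def)

lemma \<theta>_simps:
  "\<theta> (c *\<^sub>R g) = c *\<^sub>R \<theta> g" "\<theta> (g - h) = \<theta> g - \<theta> h" "\<theta> 0 = 0" "\<theta> (- g) = - \<theta> g"
  "\<theta> (sup_class.sup g h) = sup_class.sup (\<theta> g) (\<theta> h)"
  "\<theta> (inf_class.inf g h) = inf_class.inf (\<theta> g) (\<theta> h)"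
  "0 \<le> g \<Longrightarrow> \<theta> (t g) = u (\<theta> g)"
  using \<theta> \<theta>_linear linear_cmul linear_diff linear_0 linear_neg by (auto simp: trunc_hom_def)

lemma \<theta>_mono: "g \<le> h \<Longrightarrow> \<theta> g \<le> \<theta> h"
  using \<theta>_simps(5)[of g h] by (simp add: sup_absorb2 le_iff_sup)

lemma \<theta>_nonneg: "0 \<le> g \<Longrightarrow> 0 \<le> \<theta> g"
  using \<theta>_mono[of 0 g] by (simp add: \<theta>_simps)

lemma \<theta>_join_nf: "join_nf (\<theta> h) (map (apsnd \<theta>) is) = map_prod \<theta> \<theta> (join_nf h is)"
  by (induction "is") (auto simp: join_nf_def \<theta>_simps split: prod.splits)

lemma \<theta>_meet_nf: "meet_nf (\<theta> h) (map (apsnd \<theta>) is) = map_prod \<theta> \<theta> (meet_nf h is)"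
  by (induction "is") (auto simp: meet_nf_def \<theta>_simps split: prod.splits)

definition gen' where "gen' i = B.gen (apsnd \<theta> i)"

lemma joins_gen': "joins L gen' is = joins L B.gen (map (apsnd \<theta>) is)"
  by (simp add: joins_def foldr_map gen'_def comp_def)

lemma meets_gen': "meets L gen' is = meets L B.gen (map (apsnd \<theta>) is)"
  by (simp add: meets_def foldr_map gen'_def comp_def)

lemma cover:
  assumes I: "set is \<subseteq> UNIV \<times> {g. 0 \<le> g}" and top: "joins A.M A.gen is = \<top>\<^bsub>A.M\<^esub>"
  shows "joins B.M gen' is = \<top>\<^bsub>B.M\<^esub>"
proof -
  obtain h where h: "(False, h) \<in> set is" using A.joins_gen_top[OF top] .
  then have h0: "0 \<le> h" using I by auto
  obtain g' h' where nf: "join_nf h is = (g', h')" by force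
  have nn: "0 \<le> g'" "0 \<le> h'" using join_nf_nonneg[of "is" h] I h0 nf by auto
  have "A.up g' 0 \<squnion>\<^bsub>A.M\<^esub> A.dn h' 1 = \<top>\<^bsub>A.M\<^esub>" using A.joins_gen_mem[OF h] top nf by simp
  then obtain c n where c: "c > 1" "n > 0" and le: "t (c *\<^sub>R h' - t (c *\<^sub>R h')) \<le> n *\<^sub>R g'"
    using A.cover_iff nn by blast
  have ch: "0 \<le> c *\<^sub>R h'" using c nn by (intro scaleR_nonneg_nonneg) auto
  have "u (c *\<^sub>R \<theta> h' - u (c *\<^sub>R \<theta> h')) \<le> n *\<^sub>R \<theta> g'"
    using \<theta>_mono[OF le] ch A.sub_trunc_nonneg[OF ch] by (simp add: \<theta>_simps)
  then have "B.up (\<theta> g') 0 \<squnion>\<^bsub>B.M\<^esub> B.dn (\<theta> h') 1 = \<top>\<^bsub>B.M\<^esub>"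
    using B.cover_iff \<theta>_nonneg nn c by blast
  moreover have "(False, \<theta> h) \<in> set (map (apsnd \<theta>) is)" using h by force
  ultimately show ?thesis
    using B.joins_gen_mem[of "\<theta> h" "map (apsnd \<theta>) is"] nf by (simp add: joins_gen' \<theta>_join_nf)
qed

lemma disjoint:
  assumes I: "set is \<subseteq> UNIV \<times> {g. 0 \<le> g}" and bot: "meets A.M A.gen is = \<bottom>\<^bsub>A.M\<^esub>"
  shows "meets B.M gen' is = \<bottom>\<^bsub>B.M\<^esub>"
proof -
  obtain g where g: "(True, g) \<in> set is" using A.meets_gen_bot[OF bot] .
  then have g0: "0 \<le> g" using I by auto
  obtain g' h' where nf: "meet_nf g is = (g', h')" by force
  have nn: "0 \<le> g'" "0 \<le> h'" using meet_nf_nonneg[of "is" g] I g0 nf by auto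
  have "A.up g' 0 \<sqinter>\<^bsub>A.M\<^esub> A.dn h' 1 = \<bottom>\<^bsub>A.M\<^esub>" using A.meets_gen_mem[OF g] bot nf by simp
  then have le: "t (n *\<^sub>R g') \<le> h'" if "n > 0" for n
    using A.disjoint_iff nn that by blast
  have "u (n *\<^sub>R \<theta> g') \<le> \<theta> h'" if n: "n > 0" for n
  proof -
    have "0 \<le> n *\<^sub>R g'" using n nn by (intro scaleR_nonneg_nonneg) auto
    then show ?thesis using \<theta>_mono[OF le[OF n]] by (simp add: \<theta>_simps)
  qed
  then have "B.up (\<theta> g') 0 \<sqinter>\<^bsub>B.M\<^esub> B.dn (\<theta> h') 1 = \<bottom>\<^bsub>B.M\<^esub>"
    using B.disjoint_iff \<theta>_nonneg nn by blast
  moreover have "(True, \<theta> g) \<in> set (map (apsnd \<theta>) is)" using g by force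
  ultimately show ?thesis
    using B.meets_gen_mem[of "\<theta> g" "map (apsnd \<theta>) is"] nf by (simp add: meets_gen' \<theta>_meet_nf)
qed

sublocale base_extension A.M B.M "UNIV \<times> {g. 0 \<le> g}" A.gen gen'
proof
  show "compact_frame A.M" "regular_frame A.M" by (rule A.compact A.regular)+
qed (use A.generators_base cover disjoint in \<open>simp_all add: gen'_def\<close>)

text \<open>A generator of N is the join of the rays at slightly stricter levels, and each of these
  is the image of a generator rather below the given one in M, because \<theta> commutes with the
  terms that produce those levels.\<close>

lemma lift_gen:
  assumes "0 \<le> g"
  shows "lift (A.gen (b, g)) = B.gen (b, \<theta> g)"
proof -
  let ?I = "UNIV \<times> {g. 0 \<le> g} :: (bool \<times> 'a) set"
  let ?J = "{j\<in>?I. rather_below A.M (A.gen j) (A.gen (b, g))}"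
  have C: "gen' ` ?J \<subseteq> carrier B.M" by (auto simp: gen'_def)
  have up: "gen' j \<sqsubseteq>\<^bsub>B.M\<^esub> \<Squnion>\<^bsub>B.M\<^esub>(gen' ` ?J)" if "j \<in> ?J" for j
    using that C by (intro B.M.sup_upper) auto
  have "gen' (b, g) \<sqsubseteq>\<^bsub>B.M\<^esub> \<Squnion>\<^bsub>B.M\<^esub>(gen' ` ?J)"
  proof (cases b)
    case True
    have "B.up (\<theta> g) 0 \<sqsubseteq>\<^bsub>B.M\<^esub> \<Squnion>\<^bsub>B.M\<^esub>(gen' ` ?J)"
    proof (rule B.up_le)
      fix a :: real assume a: "0 < a"
      let ?k = "(1 / a) *\<^sub>R g - t ((1 / a) *\<^sub>R g)"
      have g': "0 \<le> (1 / a) *\<^sub>R g" using assms a by (intro scaleR_nonneg_nonneg) auto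
      have "A.gen (True, ?k) = A.up g a" using a assms by (rule A.gen_below_coz)
      then have mem: "(True, ?k) \<in> ?J"
        using A.up_rather_below[OF a] A.sub_trunc_nonneg[OF g'] True by (simp add: A.gen_def)
      have "gen' (True, ?k) = B.up (\<theta> g) a"
        using B.gen_below_coz[OF a \<theta>_nonneg[OF assms]] g' by (simp add: gen'_def \<theta>_simps)
      then show "B.up (\<theta> g) a \<sqsubseteq>\<^bsub>B.M\<^esub> \<Squnion>\<^bsub>B.M\<^esub>(gen' ` ?J)" using up[OF mem] by (simp only:)
    qed (use C in simp)
    then show ?thesis using True by (simp add: gen'_def B.gen_def)
  next
    case False
    have "B.dn (\<theta> g) 1 \<sqsubseteq>\<^bsub>B.M\<^esub> \<Squnion>\<^bsub>B.M\<^esub>(gen' ` ?J)"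
    proof (rule B.dn_le)
      fix a :: real assume a1: "a < 1"
      show "B.dn (\<theta> g) a \<sqsubseteq>\<^bsub>B.M\<^esub> \<Squnion>\<^bsub>B.M\<^esub>(gen' ` ?J)"
      \<comment> \<open>A level a \<le> 0 cannot be rescaled to 1, but there the lower ray of
        \<open>\<theta> g\<close> is bottom since \<open>\<theta> g\<close> \<ge> 0.\<close>
      proof (cases "a \<le> 0")
        case True
        then show ?thesis using B.dn_nonneg[OF \<theta>_nonneg[OF assms]] C by simp
      next
        case a: False
        have g': "0 \<le> (1 / a) *\<^sub>R g" using assms a by (intro scaleR_nonneg_nonneg) auto
        have "A.gen (False, (1 / a) *\<^sub>R g) = A.dn g a" using a by (intro A.gen_below_con) simp
        then have mem: "(False, (1 / a) *\<^sub>R g) \<in> ?J"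
          using A.dn_rather_below[OF a1] g' False by (simp add: A.gen_def)
        have "gen' (False, (1 / a) *\<^sub>R g) = B.dn (\<theta> g) a"
          using B.gen_below_con[of a "\<theta> g"] a by (simp add: gen'_def \<theta>_simps)
        then show ?thesis using up[OF mem] by (simp only:)
      qed
    qed (use C in simp)
    then show ?thesis using False by (simp add: gen'_def B.gen_def)
  qed
  then show ?thesis using lift_generator[of "(b, g)"] assms by (simp add: gen'_def)
qed

end

section \<open>Rays as generators, and factorization through the quotient map\<close>

context representation
begin

text \<open>Every upper ray at a real level is one generator, taken at a nonnegative element built
  from g by trunc operations; the sign of the level decides its form. Since \<theta> preserves these
  terms, \<open>hom_ext\<close> can transport all rays.\<close>

lemma up_pos_gen:
  assumes "0 < a"
  shows "up g a = gen (True, (1 / a) *\<^sub>R sup_class.sup g 0 - t ((1 / a) *\<^sub>R sup_class.sup g 0))"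
  using gen_below_coz[OF assms, of "sup_class.sup g 0"] assms by (simp add: up_pos_part)

lemma up_0_gen: "up g 0 = gen (True, sup_class.sup g 0)"
  by (simp add: gen_def up_pos_part)

lemma up_neg_gen:
  assumes "a < 0"
  shows "up g a = gen (False, (1 / - a) *\<^sub>R sup_class.sup (- g) 0)"
  using gen_below_con[of "- a" "sup_class.sup (- g) 0"] assms
  by (simp add: dn_pos_part dn_uminus)

lemma ext_finite_part:
  assumes "open V"
  shows "open (ereal ` V)" "arr q (ext g (ereal ` V)) = \<mu> g V"
proof -
  show op: "open (ereal ` V)" using assms by (rule open_ereal)
  have "ereal -` ereal ` V = V" by auto
  then show "arr q (ext g (ereal ` V)) = \<mu> g V" using arr_ext[OF op] by simp
qed

lemma image_ereal_UNIV: "ereal ` UNIV = {-\<infinity><..<\<infinity>}"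
proof (rule Set.set_eqI)
  fix x show "x \<in> ereal ` UNIV \<longleftrightarrow> x \<in> {-\<infinity><..<\<infinity>}" by (cases x) auto
qed

lemma arr_ext_finite: "arr q (ext g {-\<infinity><..<\<infinity>}) = \<top>\<^bsub>L\<^esub>"
  using ext_finite_part(2)[of UNIV g] by (simp only: image_ereal_UNIV \<mu>.map_UNIV open_UNIV)

lemma assoc_sublocale_eq:
  "assoc_sublocale q = (\<Inter>g. open_sublocale M (ext g {-\<infinity><..<\<infinity>}))"
proof -
  have "G = range \<mu>" using iso by (simp add: trunc_iso_onto_def bij_betw_def)
  then show ?thesis using snug by (auto simp: snugly_embedded_def ext_def)
qed

text \<open>
  The congruence of \<open>arr q\<close> is the least one that identifies every \<open>g' (-\<infinity>, \<infinity>)\<close> with \<open>\<top>\<close>: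
  the right adjoint of \<open>f\<close> takes its values in all these open sublocales, hence in
  \<open>assoc_sublocale q\<close>.
\<close>

lemma arr_le_imp_hom_le:
  assumes "frame P" and hom: "frame_hom M P f"
    and fin: "\<And>g. f (ext g {-\<infinity><..<\<infinity>}) = \<top>\<^bsub>P\<^esub>"
    and C: "x \<in> carrier M" "y \<in> carrier M" and le: "arr q x \<sqsubseteq>\<^bsub>L\<^esub> arr q y"
  shows "f x \<sqsubseteq>\<^bsub>P\<^esub> f y"
proof -
  interpret P: frame P by fact
  interpret f: frame_morphism M P f by unfold_locales (rule hom)
  let ?A = "{v \<in> carrier M. f v \<sqsubseteq>\<^bsub>P\<^esub> f y}"
  \<comment> \<open>This is the value at \<open>f y\<close> of the right adjoint of f, as
    \<open>le_z\<close> records.\<close>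
  define z where "z = \<Squnion>\<^bsub>M\<^esub>?A"
  have zC: "z \<in> carrier M" unfolding z_def by (intro M.sup_closed) auto
  have fz: "f z \<sqsubseteq>\<^bsub>P\<^esub> f y"
  proof -
    have "f z = \<Squnion>\<^bsub>P\<^esub>(f ` ?A)" unfolding z_def by (intro f.map_sup) auto
    then show ?thesis using C by (auto intro!: P.sup_least)
  qed
  have le_z: "v \<sqsubseteq>\<^bsub>M\<^esub> z \<longleftrightarrow> f v \<sqsubseteq>\<^bsub>P\<^esub> f y" if v: "v \<in> carrier M" for v
  proof
    assume "v \<sqsubseteq>\<^bsub>M\<^esub> z"
    then have "f v \<sqsubseteq>\<^bsub>P\<^esub> f z" using v zC by (intro f.map_mono)
    then show "f v \<sqsubseteq>\<^bsub>P\<^esub> f y" using fz v zC C P.le_trans[of "f v" "f z" "f y"] by simp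
  qed (use v in \<open>auto simp: z_def intro!: M.sup_upper\<close>)
  have "z \<in> open_sublocale M (ext g {-\<infinity><..<\<infinity>})" for g
  proof (subst M.mem_open_sublocale_iff)
    let ?y = "ext g {-\<infinity><..<\<infinity>}"
    have "v \<sqsubseteq>\<^bsub>M\<^esub> z" if v: "v \<in> carrier M" "v \<sqinter>\<^bsub>M\<^esub> ?y \<sqsubseteq>\<^bsub>M\<^esub> z" for v
    proof -
      have "f (v \<sqinter>\<^bsub>M\<^esub> ?y) \<sqsubseteq>\<^bsub>P\<^esub> f y" using v le_z[of "v \<sqinter>\<^bsub>M\<^esub> ?y"] by simp
      then have "f v \<sqsubseteq>\<^bsub>P\<^esub> f y" using v by (simp add: f.map_meet fin P.meet_top)
      then show ?thesis using le_z v by simp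
    qed
    then show "z \<in> carrier M \<and> (\<forall>v\<in>carrier M. v \<sqinter>\<^bsub>M\<^esub> ?y \<sqsubseteq>\<^bsub>M\<^esub> z \<longrightarrow> v \<sqsubseteq>\<^bsub>M\<^esub> z)" using zC by blast
  qed simp
  then have "z \<in> assoc_sublocale q" by (simp add: assoc_sublocale_eq)
  \<comment> \<open>As a value of the right adjoint of \<open>arr q\<close>, z lies above every v
    with \<open>arr q v\<close> \<le> c. The element x is one of these, since arr q x \<le> arr q y
    \<le> arr q z \<le> c.\<close>
  then obtain c where c: "c \<in> carrier L" "z = \<Squnion>\<^bsub>M\<^esub>{v \<in> carrier M. arr q v \<sqsubseteq>\<^bsub>L\<^esub> c}"
    by (auto simp: assoc_sublocale_def right_adjoint_def)
  let ?B = "{v \<in> carrier M. arr q v \<sqsubseteq>\<^bsub>L\<^esub> c}"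
  have "arr q z = \<Squnion>\<^bsub>L\<^esub>(arr q ` ?B)" unfolding c(2) by (intro map_sup) auto
  then have qz: "arr q z \<sqsubseteq>\<^bsub>L\<^esub> c" using c(1) by (auto intro!: L.sup_least)
  have "y \<sqsubseteq>\<^bsub>M\<^esub> z" using le_z[of y] C by simp
  then have "arr q y \<sqsubseteq>\<^bsub>L\<^esub> arr q z" using C zC by (intro map_mono)
  then have "arr q x \<sqsubseteq>\<^bsub>L\<^esub> c"
    using le qz C zC c(1) L.le_trans[of "arr q x" "arr q y" "arr q z"] L.le_trans[of "arr q x" "arr q z" c]
    by simp
  then have "x \<sqsubseteq>\<^bsub>M\<^esub> z" unfolding c(2) using C by (intro M.sup_upper) auto
  then show ?thesis using le_z C by simp
qed

lemma arr_factor: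
  assumes P: "pointed_frame P" and hom: "frame_hom M P f"
    and pt: "\<And>x. x \<in> carrier M \<Longrightarrow> point P (f x) = point M x"
    and fin: "\<And>g. f (ext g {-\<infinity><..<\<infinity>}) = \<top>\<^bsub>P\<^esub>"
  obtains m where "m \<in> pframe_homs L P" "\<And>x. x \<in> carrier M \<Longrightarrow> m (arr q x) = f x"
proof -
  interpret P: pointed_frame P by fact
  interpret f: frame_morphism M P f by unfold_locales (rule hom)
  \<comment> \<open>Any section of the surjection \<open>arr q\<close> will do: by
    \<open>arr_le_imp_hom_le\<close> the value of f does not depend on the chosen preimage.\<close>
  define s where "s y = (SOME x. x \<in> carrier M \<and> y = arr q x)" for y
  have s: "s y \<in> carrier M" "arr q (s y) = y" if "y \<in> carrier L" for y
  proof -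
    have "s y \<in> carrier M \<and> y = arr q (s y)"
      unfolding s_def by (rule someI_ex) (use surj[OF that] in blast)
    then show "s y \<in> carrier M" "arr q (s y) = y" by auto
  qed
  define m where "m = (\<lambda>y\<in>carrier L. f (s y))"
  have m: "m (arr q x) = f x" if x: "x \<in> carrier M" for x
  proof -
    have "f (s (arr q x)) = f x"
      using x s[of "arr q x"]
      by (intro P.le_antisym arr_le_imp_hom_le[OF P.frame_axioms hom fin]) auto
    then show ?thesis using x by (simp add: m_def)
  qed
  have "frame_hom L P m"
    unfolding frame_hom_def
  proof (intro conjI ballI allI impI)
    show "m \<in> carrier L \<rightarrow> carrier P" using s by (auto simp: m_def)
    show "m \<top>\<^bsub>L\<^esub> = \<top>\<^bsub>P\<^esub>" using m[of "\<top>\<^bsub>M\<^esub>"] by (simp add: map_top f.map_top)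
    show "m (x \<sqinter>\<^bsub>L\<^esub> y) = m x \<sqinter>\<^bsub>P\<^esub> m y" if xy: "x \<in> carrier L" "y \<in> carrier L" for x y
    proof -
      have "m (arr q (s x \<sqinter>\<^bsub>M\<^esub> s y)) = f (s x) \<sqinter>\<^bsub>P\<^esub> f (s y)"
        using s xy by (simp add: m f.map_meet)
      moreover have "arr q (s x \<sqinter>\<^bsub>M\<^esub> s y) = x \<sqinter>\<^bsub>L\<^esub> y" using s xy by (simp add: map_meet)
      ultimately show ?thesis using xy by (simp add: m_def)
    qed
    show "m (\<Squnion>\<^bsub>L\<^esub>Y) = \<Squnion>\<^bsub>P\<^esub>(m ` Y)" if Y: "Y \<subseteq> carrier L" for Y
    proof -
      have sY: "s ` Y \<subseteq> carrier M" using Y s by auto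
      have "arr q ` s ` Y = (\<lambda>y. y) ` Y"
        unfolding image_image using Y s(2) by (intro image_cong) auto
      then have 1: "arr q ` s ` Y = Y" by simp
      have 2: "f ` s ` Y = m ` Y"
        unfolding image_image using Y by (intro image_cong) (auto simp: m_def)
      have "m (arr q (\<Squnion>\<^bsub>M\<^esub>(s ` Y))) = \<Squnion>\<^bsub>P\<^esub>(f ` s ` Y)"
        using sY by (subst m) (auto intro!: f.map_sup M.sup_closed)
      then show ?thesis using sY by (simp add: map_sup 1 2)
    qed
  qed
  moreover have "point P (m y) = point L y" if "y \<in> carrier L" for y
    using s[OF that] that pt[of "s y"] point_arr[of "s y"] by (simp add: m_def)
  ultimately have "m \<in> pframe_homs L P" by (auto simp: pframe_homs_def m_def)
  then show ?thesis using that m by blast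
qed

end

section \<open>Existence and uniqueness of the induced homomorphism of compactifications\<close>

context trunc_morphism
begin

lemma hom_ext:
  assumes hom: "frame_hom A.M B.M f"
    and gen: "\<And>b g. 0 \<le> g \<Longrightarrow> f (A.gen (b, g)) = B.gen (b, \<theta> g)" and "open U"
  shows "f (A.ext g U) = B.ext (\<theta> g) U"
proof (rule ereal_opens_hom_eqI)
  have "frame_hom (O_ereal) B.M (\<lambda>U. f (A.ext g U))"
    by (rule frame_hom_compose[OF A.ext.opens_hom hom])
  then show "order_morphism B.M 0 (\<lambda>U. f (A.ext g U))"
    using B.M.frame_axioms by (simp add: order_morphism_def opens_morphism_def opens_morphism_axioms_def)
  show "order_morphism B.M 0 (B.ext (\<theta> g))" by (rule B.ext.order_morphism_axioms)
  fix a :: real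
  consider "a < 0" | "a = 0" | "0 < a" by linarith
  then show "f (A.up g a) = B.up (\<theta> g) a"
  proof cases
    case 1
    have "0 \<le> (1 / - a) *\<^sub>R sup_class.sup (- g) 0" using 1 by (intro scaleR_nonneg_nonneg) auto
    then show ?thesis using 1 by (simp only: A.up_neg_gen[OF 1] B.up_neg_gen[OF 1] gen \<theta>_simps)
  next
    case 2
    then show ?thesis using gen[of "sup_class.sup g 0" True]
      by (simp only: A.up_0_gen B.up_0_gen \<theta>_simps sup_ge2)
  next
    case 3
    have nn: "0 \<le> (1 / a) *\<^sub>R sup_class.sup g 0" using 3 by (intro scaleR_nonneg_nonneg) auto
    show ?thesis
      using gen[OF A.sub_trunc_nonneg[OF nn], of True] nn
      by (simp only: A.up_pos_gen[OF 3] B.up_pos_gen[OF 3] \<theta>_simps)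
  qed
qed fact

text \<open>Here nothing is known about l on generators. Instead, l composed with the extension of
  \<open>\<mu> g\<close> is an extension of \<open>\<nu> (\<theta> g)\<close>, and extensions are
  unique. This is what forces l.\<close>

lemma compactification_hom_ext:
  assumes lm: "(l, m) \<in> compactification_homs q r" and E: "\<And>g. E0_map (l, m) (\<mu> g) = \<nu> (\<theta> g)"
    and U: "open U"
  shows "l (A.ext g U) = B.ext (\<theta> g) U"
proof -
  from lm have l: "frame_hom A.M B.M l" "\<And>x. x \<in> carrier A.M \<Longrightarrow> point B.M (l x) = point A.M x"
    and comm: "compose (carrier A.M) m (arr q) = compose (carrier A.M) (arr r) l"
    by (auto simp: compactification_homs_def pframe_homs_def)
  have comm: "m (arr q x) = arr r (l x)" if "x \<in> carrier A.M" for x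
    using fun_cong[OF comm, of x] that by (simp add: compose_def)
  have E: "m (\<mu> g V) = \<nu> (\<theta> g) V" if "open V" for V
    using fun_cong[OF E[of g], of V] that by (simp add: E0_map_def compose_def)
  have "extends r (restrict (\<lambda>U. l (A.ext g U)) {U. open U}) (\<nu> (\<theta> g))"
  proof (rule B.extendsI)
    show "arr r (l (A.ext g U)) = \<nu> (\<theta> g) (ereal -` U)" if "open U" for U
      using that E[of "ereal -` U"] by (simp add: comm[symmetric] A.arr_ext open_ereal_vimage)
    show "frame_hom O_ereal B.M (\<lambda>U. l (A.ext g U))"
      by (rule frame_hom_compose[OF A.ext.opens_hom l(1)])
  qed (simp_all add: l A.point_ext B.\<mu>.map_UNIV)
  then have "B.ext (\<theta> g) = restrict (\<lambda>U. l (A.ext g U)) {U. open U}" unfolding B.ext_def by (rule B.extension_eq)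
  then show ?thesis using U by simp
qed

lemma compactification_hom_gen:
  assumes "(l, m) \<in> compactification_homs q r" "\<And>g. E0_map (l, m) (\<mu> g) = \<nu> (\<theta> g)"
  shows "l (A.gen i) = B.gen (apsnd \<theta> i)"
  using compactification_hom_ext[OF assms] by (cases i) (simp add: A.gen_def B.gen_def)

lemma ex_compactification_hom:
  obtains l m where "(l, m) \<in> compactification_homs q r" "\<And>g. E0_map (l, m) (\<mu> g) = \<nu> (\<theta> g)"
proof -
  have ext: "lift (A.ext g U) = B.ext (\<theta> g) U" if "open U" for g U
    using lift_hom lift_gen that by (rule hom_ext)
  \<comment> \<open>Whether a generator contains the point depends only on its Boolean tag, which
    \<theta> leaves alone, and the point of a join is read off its members.\<close>
  have pt: "point B.M (lift x) = point A.M x" if x: "x \<in> carrier A.M" for x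
  proof -
    let ?J = "{i \<in> UNIV \<times> {g. 0 \<le> g}. rather_below A.M (A.gen i) x}"
    have "x = \<Squnion>\<^bsub>A.M\<^esub>(A.gen ` ?J)" using sup_eq_rather_below[of "{x}"] x by simp
    then have "point A.M x \<longleftrightarrow> (\<exists>i\<in>?J. point A.M (A.gen i))"
      using A.M.point_sup[of "A.gen ` ?J"] by (simp add: image_subset_iff)
    moreover have "point B.M (lift x) \<longleftrightarrow> (\<exists>i\<in>?J. point B.M (gen' i))"
      using B.M.point_sup[of "gen' ` ?J"] x by (simp add: image_subset_iff lift_def gen'_def)
    ultimately show ?thesis by (simp add: A.point_gen B.point_gen gen'_def)
  qed
  have hom: "frame_hom A.M B.L (\<lambda>x. arr r (lift x))"
    by (rule frame_hom_compose[OF lift_hom B.hom])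
  obtain m where m: "m \<in> pframe_homs A.L B.L" "\<And>x. x \<in> carrier A.M \<Longrightarrow> m (arr q x) = arr r (lift x)"
    by (rule A.arr_factor[OF B.L.pointed_frame_axioms hom])
      (auto simp: B.point_arr pt ext B.arr_ext_finite)
  have "lift \<in> pframe_homs A.M B.M"
    using lift_hom pt by (auto simp: pframe_homs_def lift_def)
  then have "(lift, m) \<in> compactification_homs q r"
    using m by (auto simp: compactification_homs_def compose_def restrict_def fun_eq_iff)
  moreover have "E0_map (lift, m) (\<mu> g) = \<nu> (\<theta> g)" for g
  proof (rule extensionalityI[OF _ B.\<mu>_extensional])
    show "E0_map (lift, m) (\<mu> g) \<in> extensional {U. open U}" by (simp add: E0_map_def)
    fix V :: "real set" assume "V \<in> {U. open U}"
    then have V: "open V" by simp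
    have "m (\<mu> g V) = arr r (lift (A.ext g (ereal ` V)))"
      using A.ext_finite_part[OF V] m(2) by (metis A.ext.map_in)
    also have "\<dots> = \<nu> (\<theta> g) V" using A.ext_finite_part(1)[OF V] B.ext_finite_part(2)[OF V] by (simp add: ext)
    finally show "E0_map (lift, m) (\<mu> g) V = \<nu> (\<theta> g) V" using V by (simp add: E0_map_def compose_def)
  qed
  ultimately show ?thesis using that by blast
qed

text \<open>The map l is forced on generators, which are join-dense, and m by surjectivity of
  \<open>arr q\<close>.\<close>

lemma compactification_hom_unique:
  assumes 1: "(l1, m1) \<in> compactification_homs q r" "\<And>g. E0_map (l1, m1) (\<mu> g) = \<nu> (\<theta> g)"
    and 2: "(l2, m2) \<in> compactification_homs q r" "\<And>g. E0_map (l2, m2) (\<mu> g) = \<nu> (\<theta> g)"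
  shows "l1 = l2 \<and> m1 = m2"
proof
  have l: "frame_hom A.M B.M l" "l \<in> extensional (carrier A.M)" "m \<in> extensional (carrier A.L)"
    "\<And>x. x \<in> carrier A.M \<Longrightarrow> m (arr q x) = arr r (l x)"
    if "(l, m) \<in> compactification_homs q r" for l m
    using that by (auto simp: compactification_homs_def pframe_homs_def compose_def restrict_def fun_eq_iff)
      metis
  interpret l1: frame_morphism A.M B.M l1 by unfold_locales (rule l[OF 1(1)])
  interpret l2: frame_morphism A.M B.M l2 by unfold_locales (rule l[OF 2(1)])
  have eq: "l1 x = l2 x" if x: "x \<in> carrier A.M" for x
  proof -
    obtain J where J: "x = \<Squnion>\<^bsub>A.M\<^esub>(A.gen ` J)" using A.generators_base[OF x] by blast
    have "l1 ` A.gen ` J = l2 ` A.gen ` J"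
      unfolding image_image using compactification_hom_gen[OF 1] compactification_hom_gen[OF 2] by simp
    then show ?thesis unfolding J
      by (subst l1.map_sup, blast intro: A.gen_closed, subst l2.map_sup) auto
  qed
  then show "l1 = l2" using l(2)[OF 1(1)] l(2)[OF 2(1)] by (auto intro: extensionalityI)
  have "m1 y = m2 y" if y: "y \<in> carrier A.L" for y
    using A.surj[OF y] l(4)[OF 1(1)] l(4)[OF 2(1)] eq by auto
  then show "m1 = m2" using l(3)[OF 1(1)] l(3)[OF 2(1)] by (auto intro: extensionalityI)
qed

end

lemma trunc_hom_id: "trunc_hom t t (\<lambda>g. g)"
  by (simp add: trunc_hom_def linear_id[unfolded id_def])

lemma representationI:
  assumes "trunc t" "trunc_representation t q G \<mu>"
  shows "representation t q G \<mu>"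
  using assms by (simp add: representation_def frame_compactification_def representation_axioms_def trunc_representation_def)

text \<open>The homomorphisms induced by the identity in the two directions exchange corresponding
  generators. Their composites fix all joins of generators, and surjectivity of the quotient maps
  carries this over to the targets.\<close>

lemma representation_unique:
  assumes "representation t q G \<mu>" "representation t r H \<nu>"
  shows "\<exists>lm\<in>compactification_isos q r. \<forall>g. compose (carrier O_real) (snd lm) (\<mu> g) = \<nu> g"
proof -
  interpret A: representation t q G \<mu> by fact
  interpret B: representation t r H \<nu> by fact
  interpret AB: trunc_morphism t q G \<mu> t r H \<nu> "\<lambda>g. g" by unfold_locales (rule trunc_hom_id)
  interpret BA: trunc_morphism t r H \<nu> t q G \<mu> "\<lambda>g. g" by unfold_locales (rule trunc_hom_id)
  obtain l m where lm: "(l, m) \<in> compactification_homs q r" "\<And>g. E0_map (l, m) (\<mu> g) = \<nu> g"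
    using AB.ex_compactification_hom by blast
  obtain l' m' where lm': "(l', m') \<in> compactification_homs r q" "\<And>g. E0_map (l', m') (\<nu> g) = \<mu> g"
    using BA.ex_compactification_hom by blast
  have hom: "frame_hom A.M B.M l" "\<And>x. x \<in> carrier A.M \<Longrightarrow> m (arr q x) = arr r (l x)"
    and hom': "frame_hom B.M A.M l'" "\<And>x. x \<in> carrier B.M \<Longrightarrow> m' (arr r x) = arr q (l' x)"
    using lm(1) lm'(1)
    by (auto simp: compactification_homs_def pframe_homs_def compose_def restrict_def fun_eq_iff) metis+
  interpret l: frame_morphism A.M B.M l by unfold_locales (rule hom)
  interpret l': frame_morphism B.M A.M l' by unfold_locales (rule hom')
  have gen: "l (A.gen i) = B.gen i" "l' (B.gen i) = A.gen i" for i
    using AB.compactification_hom_gen[OF lm, of i] BA.compactification_hom_gen[OF lm', of i]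
    by (cases i; simp)+
  have 1: "l' (l x) = x" if x: "x \<in> carrier A.M" for x
  proof -
    obtain J where J: "x = \<Squnion>\<^bsub>A.M\<^esub>(A.gen ` J)" using A.generators_base[OF x] by blast
    have "l x = \<Squnion>\<^bsub>B.M\<^esub>(B.gen ` J)" unfolding J by (subst l.map_sup) (auto simp: image_image gen)
    also have "l' \<dots> = x" unfolding J by (subst l'.map_sup) (auto simp: image_image gen)
    finally show ?thesis .
  qed
  have 2: "l (l' x) = x" if x: "x \<in> carrier B.M" for x
  proof -
    obtain J where J: "x = \<Squnion>\<^bsub>B.M\<^esub>(B.gen ` J)" using B.generators_base[OF x] by blast
    have "l' x = \<Squnion>\<^bsub>A.M\<^esub>(A.gen ` J)" unfolding J by (subst l'.map_sup) (auto simp: image_image gen)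
    also have "l \<dots> = x" unfolding J by (subst l.map_sup) (auto simp: image_image gen)
    finally show ?thesis .
  qed
  have 3: "m' (m y) = y" if y: "y \<in> carrier A.L" for y
  proof -
    obtain x where x: "x \<in> carrier A.M" "y = arr q x" using A.surj[OF y] by auto
    then show ?thesis using hom(2) hom'(2) 1 by simp
  qed
  have 4: "m (m' y) = y" if y: "y \<in> carrier B.L" for y
  proof -
    obtain x where x: "x \<in> carrier B.M" "y = arr r x" using B.surj[OF y] by auto
    then show ?thesis using hom(2) hom'(2) 2 by simp
  qed
  have "(l, m) \<in> compactification_isos q r"
    unfolding compactification_isos_def using lm(1) lm'(1) 1 2 3 4 by blast
  then show ?thesis using lm(2) by (auto simp: E0_map_def intro!: bexI[of _ "(l, m)"])
qed

lemma representation_functorial: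
  assumes "representation t q G \<mu>" "representation u r H \<nu>" "trunc_hom t u \<theta>"
  shows "\<exists>!lm. lm \<in> compactification_homs q r \<and> (\<forall>g. E0_map lm (\<mu> g) = \<nu> (\<theta> g))"
proof -
  interpret A: representation t q G \<mu> by fact
  interpret B: representation u r H \<nu> by fact
  interpret trunc_morphism t q G \<mu> u r H \<nu> \<theta> by unfold_locales fact
  obtain l m where lm: "(l, m) \<in> compactification_homs q r" "\<And>g. E0_map (l, m) (\<mu> g) = \<nu> (\<theta> g)"
    using ex_compactification_hom by blast
  show ?thesis
  proof (rule ex1I[of _ "(l, m)"])
    show "(l, m) \<in> compactification_homs q r \<and> (\<forall>g. E0_map (l, m) (\<mu> g) = \<nu> (\<theta> g))"
      using lm by blast
    fix lm' assume lm': "lm' \<in> compactification_homs q r \<and> (\<forall>g. E0_map lm' (\<mu> g) = \<nu> (\<theta> g))"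
    obtain l' m' where eq: "lm' = (l', m')" by force
    have "l' = l \<and> m' = m"
      by (rule compactification_hom_unique) (use lm lm' in \<open>simp_all add: eq\<close>)
    then show "lm' = (l, m)" by (simp add: eq)
  qed
qed

section \<open>The spectrum of a trunc\<close>

subsection \<open>Vector lattices\<close>

abbreviation pos :: "'a::{ordered_real_vector, lattice} \<Rightarrow> 'a" where
  "pos x \<equiv> sup_class.sup x 0"

lemma add_inf_distrib:
  fixes a b c :: "'a::{ordered_real_vector, lattice}"
  shows "a + inf_class.inf b c = inf_class.inf (a + b) (a + c)"
proof (rule order_antisym)
  have "inf_class.inf (a + b) (a + c) - a \<le> inf_class.inf b c"
    by (intro le_infI) (simp_all add: diff_le_eq add.commute)
  then show "inf_class.inf (a + b) (a + c) \<le> a + inf_class.inf b c"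
    by (simp only: diff_le_eq add.commute[of a])
qed simp

text \<open>From \<open>pos (- z) = pos z - z\<close> the infimum is \<open>pos z\<close> plus the
  infimum of 0 and - z, and the latter is \<open>- pos z\<close>.\<close>

lemma inf_pos_pos_uminus:
  fixes z :: "'a::{ordered_real_vector, lattice}"
  shows "inf_class.inf (pos z) (pos (- z)) = 0"
proof -
  have 1: "pos (- z) = - inf_class.inf z 0" using uminus_inf_eq_sup[of z 0] by simp
  have 2: "z + inf_class.inf 0 (- z) = inf_class.inf z 0" using add_inf_distrib[of z 0 "- z"] by simp
  have 3: "pos z = - inf_class.inf 0 (- z)"
    using uminus_inf_eq_sup[of "- z" 0] by (simp add: inf_commute)
  have "pos (- z) = pos z - z" using 1 2 3 by (metis add.commute diff_conv_add_uminus minus_add)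
  then have "inf_class.inf (pos z) (pos (- z)) = inf_class.inf (pos z + 0) (pos z + - z)" by simp
  also have "\<dots> = pos z + inf_class.inf 0 (- z)" by (rule add_inf_distrib[symmetric])
  also have "\<dots> = 0" using 3 by simp
  finally show ?thesis .
qed

lemma pos_add_le:
  fixes x y :: "'a::{ordered_real_vector, lattice}"
  shows "pos (x + y) \<le> pos x + pos y"
  by (intro le_supI add_mono add_nonneg_nonneg) auto

lemma pos_sup_le:
  fixes x y z :: "'a::{ordered_real_vector, lattice}"
  shows "pos (sup_class.sup x y - z) \<le> pos (x - z) + pos (y - z)"
proof (rule le_supI)
  have "x \<le> pos (x - z) + pos (y - z) + z" "y \<le> pos (x - z) + pos (y - z) + z"
    using add_mono[of "x - z" "pos (x - z)" 0 "pos (y - z)"]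
      add_mono[of 0 "pos (x - z)" "y - z" "pos (y - z)"]
    by (simp_all add: diff_le_eq)
  then show "sup_class.sup x y - z \<le> pos (x - z) + pos (y - z)" by (simp add: diff_le_eq)
qed (simp add: add_nonneg_nonneg)

lemma pos_scaleR_le:
  fixes x :: "'a::{ordered_real_vector, lattice}"
  shows "0 \<le> c \<Longrightarrow> pos (c *\<^sub>R x) \<le> c *\<^sub>R pos x"
  by (intro le_supI scaleR_left_mono scaleR_nonneg_nonneg) auto

lemma inf_scaleR_eq_0:
  fixes a b :: "'a::{ordered_real_vector, lattice}"
  assumes "inf_class.inf a b = 0" "0 \<le> a" "0 \<le> b" "0 \<le> c"
  shows "inf_class.inf (c *\<^sub>R a) (c *\<^sub>R b) = 0"
proof (cases "c = 0")
  case False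
  then have c: "0 < c" using assms by simp
  let ?x = "inf_class.inf (c *\<^sub>R a) (c *\<^sub>R b)"
  have "(1 / c) *\<^sub>R ?x \<le> (1 / c) *\<^sub>R (c *\<^sub>R a)" "(1 / c) *\<^sub>R ?x \<le> (1 / c) *\<^sub>R (c *\<^sub>R b)"
    using c by (intro scaleR_left_mono; simp)+
  then have "(1 / c) *\<^sub>R ?x \<le> inf_class.inf a b" using c by simp
  then have "c *\<^sub>R ((1 / c) *\<^sub>R ?x) \<le> c *\<^sub>R 0" using assms(1) c by (intro scaleR_left_mono) auto
  then have "?x \<le> 0" using c by simp
  moreover have "0 \<le> ?x" using assms by (intro le_infI scaleR_nonneg_nonneg) auto
  ultimately show ?thesis by simp
qed simp

subsection \<open>Prime ideals\<close>

text \<open>Only the positive part of a lattice ideal is recorded, since the congruence will be read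
  off from \<open>pos (x - y)\<close>. Closure under nonnegative scalars follows, see
  \<open>lideal_scaleR\<close>.\<close>

definition lideal :: "'a::{ordered_real_vector, lattice} set \<Rightarrow> bool" where
  "lideal P \<longleftrightarrow> 0 \<in> P \<and> (\<forall>a\<in>P. 0 \<le> a) \<and> (\<forall>a\<in>P. \<forall>b\<in>P. a + b \<in> P) \<and>
    (\<forall>a\<in>P. \<forall>b. 0 \<le> b \<and> b \<le> a \<longrightarrow> b \<in> P)"

lemma lidealD:
  assumes "lideal P"
  shows "0 \<in> P" "a \<in> P \<Longrightarrow> 0 \<le> a" "a \<in> P \<Longrightarrow> b \<in> P \<Longrightarrow> a + b \<in> P"
    "a \<in> P \<Longrightarrow> 0 \<le> b \<Longrightarrow> b \<le> a \<Longrightarrow> b \<in> P"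
proof -
  note * = assms[unfolded lideal_def]
  show "0 \<in> P" by (rule *[THEN conjunct1])
  show "a \<in> P \<Longrightarrow> 0 \<le> a" by (rule *[THEN conjunct2, THEN conjunct1, THEN bspec])
  show "a \<in> P \<Longrightarrow> b \<in> P \<Longrightarrow> a + b \<in> P"
    by (rule *[THEN conjunct2, THEN conjunct2, THEN conjunct1, THEN bspec, THEN bspec])
  show "a \<in> P \<Longrightarrow> 0 \<le> b \<Longrightarrow> b \<le> a \<Longrightarrow> b \<in> P"
    by (rule *[THEN conjunct2, THEN conjunct2, THEN conjunct2, THEN bspec, THEN spec, THEN mp, OF _ conjI])
qed

lemma lidealI:
  assumes "0 \<in> P" "\<And>a. a \<in> P \<Longrightarrow> 0 \<le> a" "\<And>a b. a \<in> P \<Longrightarrow> b \<in> P \<Longrightarrow> a + b \<in> P"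
    "\<And>a b. a \<in> P \<Longrightarrow> 0 \<le> b \<Longrightarrow> b \<le> a \<Longrightarrow> b \<in> P"
  shows "lideal P"
  unfolding lideal_def by (intro conjI ballI allI impI; (elim conjE)?; rule assms; assumption)

lemma lideal_scaleR:
  assumes P: "lideal P" and a: "a \<in> P" and c: "0 \<le> c"
  shows "c *\<^sub>R a \<in> P"
proof -
  have n: "real n *\<^sub>R a \<in> P" for n
  proof (induction n)
    case (Suc n)
    then show ?case using lidealD(3)[OF P a] by (simp add: scaleR_add_left)
  qed (simp add: lidealD(1)[OF P])
  obtain n where "c \<le> real n" using real_arch_simple by blast
  then have "c *\<^sub>R a \<le> real n *\<^sub>R a" using lidealD(2)[OF P a] by (intro scaleR_right_mono) auto
  moreover have "0 \<le> c *\<^sub>R a" using lidealD(2)[OF P a] c by (rule scaleR_nonneg_nonneg[rotated])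
  ultimately show ?thesis using lidealD(4)[OF P n] by blast
qed

text \<open>The ideal generated by P and a, against which maximality is tested in
  \<open>ex_prime_lideal\<close>.\<close>

lemma lideal_insert:
  assumes P: "lideal P" and a: "0 \<le> a"
  shows "lideal {x. 0 \<le> x \<and> (\<exists>p\<in>P. \<exists>n\<ge>0. x \<le> p + n *\<^sub>R a)}" (is "lideal ?Q")
proof (rule lidealI)
  have QI: "x \<in> ?Q" if "0 \<le> x" "p \<in> P" "0 \<le> n" "x \<le> p + n *\<^sub>R a" for x p n
    using that by blast
  show "0 \<in> ?Q" by (rule QI[of _ 0 0]) (use lidealD(1)[OF P] in auto)
  fix x assume x: "x \<in> ?Q"
  then show "0 \<le> x" by simp
  show "y \<in> ?Q" if "0 \<le> y" "y \<le> x" for y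
  proof -
    obtain p n where "p \<in> P" "0 \<le> n" "x \<le> p + n *\<^sub>R a" using x by blast
    then show ?thesis using that by (intro QI[of y p n]) auto
  qed
  fix y assume "y \<in> ?Q"
  with x obtain p n p' n' where *: "p \<in> P" "0 \<le> n" "x \<le> p + n *\<^sub>R a" "0 \<le> x"
    "p' \<in> P" "0 \<le> n'" "y \<le> p' + n' *\<^sub>R a" "0 \<le> y" by blast
  have "x + y \<le> (p + p') + (n + n') *\<^sub>R a"
    using add_mono[OF *(3,7)] by (simp add: scaleR_add_left algebra_simps)
  then show "x + y \<in> ?Q"
    using * lidealD(3)[OF P *(1,5)] by (intro QI[of _ "p + p'" "n + n'"]) auto
qed

text \<open>An ideal maximal among those missing f is prime. If a and b both lie outside, f lies in
  both enlarged ideals; with a common q in P and a common multiple N this gives f \<le> q + N a and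
  f \<le> q + N b, so f \<le> q, because N a and N b are disjoint when a and b are.\<close>

lemma ex_prime_lideal:
  fixes f :: "'a::{ordered_real_vector, lattice}"
  assumes f: "0 \<le> f" "f \<noteq> 0"
  obtains P where "lideal P" "f \<notin> P"
    "\<And>a b. 0 \<le> a \<Longrightarrow> 0 \<le> b \<Longrightarrow> inf_class.inf a b = 0 \<Longrightarrow> a \<in> P \<or> b \<in> P"
proof -
  let ?A = "{P. lideal P \<and> f \<notin> P}"
  have "{0} \<in> ?A" using f by (auto simp: lideal_def)
  then have "\<exists>P\<in>?A. \<forall>Q\<in>?A. P \<subseteq> Q \<longrightarrow> Q = P"
  proof (intro subset_Zorn_nonempty)
    fix C assume C: "C \<noteq> {}" "subset.chain ?A C"
    then have I: "lideal P" "f \<notin> P" if "P \<in> C" for P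
      using that by (auto simp: subset.chain_def)
    have "a + b \<in> \<Union>C" if ab: "a \<in> \<Union>C" "b \<in> \<Union>C" for a b
    proof -
      from ab obtain P Q where PQ: "P \<in> C" "a \<in> P" "Q \<in> C" "b \<in> Q" by auto
      then have "P \<subseteq> Q \<or> Q \<subseteq> P" using C by (auto simp: subset.chain_def)
      then show ?thesis using PQ I lidealD(3) by blast
    qed
    moreover have "0 \<in> \<Union>C" using C(1) I(1) lidealD(1) by blast
    moreover have "0 \<le> a" if "a \<in> \<Union>C" for a
      using that I(1) lidealD(2) by blast
    moreover have "b \<in> \<Union>C" if b: "a \<in> \<Union>C" "0 \<le> b" "b \<le> a" for a b
    proof -
      obtain P where "P \<in> C" "a \<in> P" using b(1) by blast
      then show ?thesis using lidealD(4)[OF I(1) _ b(2,3), of P] by blast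
    qed
    ultimately have "lideal (\<Union>C)" by (intro lidealI)
    then show "\<Union>C \<in> ?A" using I by auto
  qed auto
  then obtain P where P: "lideal P" "f \<notin> P" and max: "\<And>Q. lideal Q \<Longrightarrow> f \<notin> Q \<Longrightarrow> P \<subseteq> Q \<Longrightarrow> Q = P"
    by blast
  have ex: "\<exists>p\<in>P. \<exists>n\<ge>0. f \<le> p + n *\<^sub>R a" if a: "0 \<le> a" "a \<notin> P" for a
  proof (rule ccontr)
    assume no: "\<not> ?thesis"
    let ?Q = "{x. 0 \<le> x \<and> (\<exists>p\<in>P. \<exists>n\<ge>0. x \<le> p + n *\<^sub>R a)}"
    have "P \<subseteq> ?Q"
    proof
      fix p assume "p \<in> P"
      moreover have "p \<le> p + 0 *\<^sub>R a" "(0::real) \<le> 0" by simp_all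
      moreover have "0 \<le> p" using lidealD(2)[OF P(1) \<open>p \<in> P\<close>] .
      ultimately show "p \<in> ?Q" by blast
    qed
    moreover have "a \<in> ?Q"
    proof -
      have "a \<le> 0 + 1 *\<^sub>R a" "(0::real) \<le> 1" by simp_all
      then show ?thesis using a lidealD(1)[OF P(1)] by blast
    qed
    moreover have "?Q = P" using no \<open>P \<subseteq> ?Q\<close> by (intro max lideal_insert[OF P(1) a(1)]) blast+
    ultimately show False using a by blast
  qed
  have "a \<in> P \<or> b \<in> P" if ab: "0 \<le> a" "0 \<le> b" "inf_class.inf a b = 0" for a b
  proof (rule ccontr)
    assume "\<not> ?thesis"
    then have "a \<notin> P" "b \<notin> P" by simp_all
    obtain p n where p: "p \<in> P" "0 \<le> n" "f \<le> p + n *\<^sub>R a"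
      using ex[OF ab(1) \<open>a \<notin> P\<close>] by blast
    obtain p' n' where p': "p' \<in> P" "0 \<le> n'" "f \<le> p' + n' *\<^sub>R b"
      using ex[OF ab(2) \<open>b \<notin> P\<close>] by blast
    note * = p p'
    let ?q = "p + p'" and ?N = "max n n'"
    have q: "?q \<in> P" by (rule lidealD(3)[OF P(1) p(1) p'(1)])
    have q': "p \<le> ?q" "p' \<le> ?q" using lidealD(2)[OF P(1) p(1)] lidealD(2)[OF P(1) p'(1)] by simp_all
    have "f \<le> ?q + ?N *\<^sub>R a"
      by (rule order_trans[OF *(3)]) (intro add_mono scaleR_right_mono q' ab max.cobounded1)
    moreover have "f \<le> ?q + ?N *\<^sub>R b"
      by (rule order_trans[OF *(6)]) (intro add_mono scaleR_right_mono q' ab max.cobounded2)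
    ultimately have "f \<le> ?q + inf_class.inf (?N *\<^sub>R a) (?N *\<^sub>R b)" by (simp add: add_inf_distrib)
    then have "f \<le> ?q" using inf_scaleR_eq_0[OF ab(3,1,2), of ?N] * by simp
    then show False using P(2) lidealD(4)[OF P(1) q f(1)] by blast
  qed
  then show ?thesis using that P by blast
qed

subsection \<open>Points\<close>

text \<open>Every clause is a closed condition. The sum \<infinity> + (-\<infinity>) has no
  continuous value, so additivity is stated through real strict lower bounds; together with the
  clause for negation this gives additivity as soon as one summand is real
  (\<open>spectrum_add\<close>). Meets follow from joins and negation.\<close>

definition spectrum :: "('a::{ordered_real_vector, lattice} \<Rightarrow> 'a) \<Rightarrow> ('a \<Rightarrow> ereal) set" where
  "spectrum t = {\<phi>.
    (\<forall>c>0. \<forall>g. \<phi> (c *\<^sub>R g) = ereal c * \<phi> g) \<and>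
    (\<forall>g. \<phi> (- g) = - \<phi> g) \<and>
    (\<forall>g h. \<phi> (sup_class.sup g h) = max (\<phi> g) (\<phi> h)) \<and>
    (\<forall>g h a b. ereal a < \<phi> g \<longrightarrow> ereal b < \<phi> h \<longrightarrow> ereal (a + b) \<le> \<phi> (g + h)) \<and>
    (\<forall>g\<ge>0. \<phi> (t g) = min (\<phi> g) 1)}"

lemma ereal_le_dense:
  fixes x y :: ereal
  assumes "\<And>r. ereal r < x \<Longrightarrow> ereal r \<le> y"
  shows "x \<le> y"
proof (rule ccontr)
  assume "\<not> x \<le> y"
  then have "y < x" by simp
  then obtain r where "y < ereal r" "ereal r < x" using ereal_dense2 by blast
  then show False using assms[of r] by simp
qed

locale truncation = trunc t for t :: "'a::{ordered_real_vector, lattice} \<Rightarrow> 'a"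
begin

text \<open>The first truncation axiom with g and h in both roles. In this symmetric form it yields
  monotonicity of t and the comparison of t x with u modulo P.\<close>

lemma inf_trunc_eq:
  assumes "0 \<le> g" "0 \<le> h"
  shows "inf_class.inf g (t h) = inf_class.inf (t g) h"
  by (intro order_antisym le_infI)
    (use assms inf_trunc_le[of g h] inf_trunc_le[of h g] trunc_le[of g] trunc_le[of h] in
      \<open>auto simp: inf_commute intro: le_infI1 le_infI2\<close>)

lemma trunc_mono:
  assumes "0 \<le> g" "g \<le> h"
  shows "t g \<le> t h"
proof -
  have "t g = inf_class.inf (t g) h" using assms trunc_le[of g] by (simp add: inf_absorb1)
  also have "\<dots> = inf_class.inf g (t h)" using assms by (simp add: inf_trunc_eq)
  also have "\<dots> \<le> t h" by simp
  finally show ?thesis .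
qed

end

text \<open>
  The quotient by a prime ideal is totally ordered. Excluding \<open>t (k - t k)\<close> makes \<open>u = t k\<close> a unit
  of it, in the sense that \<open>t x\<close> and \<open>inf x u\<close> agree modulo \<open>P\<close>.
\<close>

locale prime_quotient = truncation t
  for t :: "'a::{ordered_real_vector, lattice} \<Rightarrow> 'a" +
  fixes P k
  assumes P: "lideal P"
    and prime: "\<And>a b. 0 \<le> a \<Longrightarrow> 0 \<le> b \<Longrightarrow> inf_class.inf a b = 0 \<Longrightarrow> a \<in> P \<or> b \<in> P"
    and k: "0 \<le> k" and excl: "t (k - t k) \<notin> P"
begin

definition le_mod (infix \<open>\<preceq>\<close> 50) where "x \<preceq> y \<longleftrightarrow> pos (x - y) \<in> P"

abbreviation u where "u \<equiv> t k"

lemma le_imp_le_mod: "x \<le> y \<Longrightarrow> x \<preceq> y"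
  using lidealD(1)[OF P] by (simp add: le_mod_def sup_absorb2)

lemma le_mod_add:
  assumes "x \<preceq> y" "x' \<preceq> y'"
  shows "x + x' \<preceq> y + y'"
proof -
  have "pos ((x - y) + (x' - y')) \<in> P"
    using assms lidealD(3)[OF P] unfolding le_mod_def
    by (intro lidealD(4)[OF P _ _ pos_add_le]) auto
  then show ?thesis by (simp add: le_mod_def algebra_simps)
qed

lemma le_mod_trans: "x \<preceq> y \<Longrightarrow> y \<preceq> z \<Longrightarrow> x \<preceq> z"
  using le_mod_add[of x y y z] by (simp add: le_mod_def)

lemma le_mod_total: "x \<preceq> y \<or> y \<preceq> x"
  using prime[of "pos (x - y)" "pos (- (x - y))"] inf_pos_pos_uminus[of "x - y"]
  by (simp add: le_mod_def)

lemma le_mod_scaleR: "x \<preceq> y \<Longrightarrow> 0 \<le> c \<Longrightarrow> c *\<^sub>R x \<preceq> c *\<^sub>R y"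
  using lidealD(4)[OF P lideal_scaleR[OF P], of "pos (x - y)" c "pos (c *\<^sub>R (x - y))"]
    pos_scaleR_le[of c "x - y"] by (simp add: le_mod_def scaleR_diff_right)

lemma le_mod_uminus: "- x \<preceq> - y \<longleftrightarrow> y \<preceq> x"
  by (simp add: le_mod_def)

lemma le_mod_sup: "x \<preceq> z \<Longrightarrow> y \<preceq> z \<Longrightarrow> sup_class.sup x y \<preceq> z"
  unfolding le_mod_def using lidealD(3)[OF P] by (intro lidealD(4)[OF P _ _ pos_sup_le]) auto

lemma le_mod_inf: "z \<preceq> x \<Longrightarrow> z \<preceq> y \<Longrightarrow> z \<preceq> inf_class.inf x y"
  using le_mod_sup[of "- x" "- z" "- y"] by (metis le_mod_uminus uminus_inf_eq_sup)

lemma u_nonneg: "0 \<le> u"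
  using k by (rule trunc_nonneg)

lemma k_sub_u_nonneg: "0 \<le> k - u"
  using trunc_le[OF k] by simp

text \<open>Monotonicity gives \<open>t (k - u)\<close> \<le> u, so u in P would put the excluded
  element into P.\<close>

lemma not_u_le_mod: "\<not> u \<preceq> 0"
proof
  assume "u \<preceq> 0"
  then have "u \<in> P" using u_nonneg by (simp add: le_mod_def sup_absorb1)
  moreover have "t (k - u) \<le> u"
    by (rule trunc_mono[OF k_sub_u_nonneg]) (simp add: u_nonneg)
  ultimately show False using excl trunc_nonneg[OF k_sub_u_nonneg] lidealD(4)[OF P] by blast
qed

lemma not_k_le_mod: "\<not> k \<preceq> u"
proof
  assume "k \<preceq> u"
  then have "k - u \<in> P" using k_sub_u_nonneg by (simp add: le_mod_def sup_absorb1)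
  then show False
    using excl trunc_nonneg[OF k_sub_u_nonneg] trunc_le[OF k_sub_u_nonneg] lidealD(4)[OF P] by blast
qed

text \<open>The infimum of x and u equals that of t x and k. If k were below t x modulo P, it would
  be below this infimum and hence below u, which is excluded. By totality t x is below k, so t x is
  below the infimum.\<close>

lemma trunc_le_mod: "0 \<le> x \<Longrightarrow> t x \<preceq> inf_class.inf x u"
proof -
  assume x: "0 \<le> x"
  have eq: "inf_class.inf x u = inf_class.inf (t x) k" using inf_trunc_eq[OF x k] .
  have "\<not> k \<preceq> t x"
  proof
    assume "k \<preceq> t x"
    then have "k \<preceq> inf_class.inf x u" unfolding eq by (intro le_mod_inf) (auto simp: le_imp_le_mod)
    moreover have "inf_class.inf x u \<preceq> u" by (intro le_imp_le_mod) simp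
    ultimately show False using not_k_le_mod le_mod_trans[of k] by blast
  qed
  then have "t x \<preceq> k" using le_mod_total by blast
  then show ?thesis unfolding eq by (intro le_mod_inf) (auto simp: le_imp_le_mod)
qed

text \<open>The Hoelder map of the totally ordered quotient with unit u. The quotient need not be
  archimedean, hence the extended reals as values.\<close>

definition \<phi> :: "'a \<Rightarrow> ereal" where "\<phi> x = (SUP r\<in>{r. r *\<^sub>R u \<preceq> x}. ereal r)"

lemma le_\<phi>: "r *\<^sub>R u \<preceq> x \<Longrightarrow> ereal r \<le> \<phi> x"
  unfolding \<phi>_def by (rule SUP_upper) simp

lemma less_\<phi>D:
  assumes "ereal r < \<phi> x"
  shows "r *\<^sub>R u \<preceq> x"
proof -
  obtain s where s: "s *\<^sub>R u \<preceq> x" "r < s" using assms by (auto simp: \<phi>_def less_SUP_iff)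
  then have "r *\<^sub>R u \<le> s *\<^sub>R u" using u_nonneg by (intro scaleR_right_mono) auto
  then show ?thesis using s le_imp_le_mod le_mod_trans by blast
qed

lemma \<phi>_le: 
  assumes "x \<preceq> s *\<^sub>R u"
  shows "\<phi> x \<le> ereal s"
  unfolding \<phi>_def
proof (rule SUP_least)
  fix r assume "r \<in> {r. r *\<^sub>R u \<preceq> x}"
  then have "r *\<^sub>R u \<preceq> s *\<^sub>R u" using assms le_mod_trans by blast
  then have le: "(r - s) *\<^sub>R u \<preceq> 0" by (simp add: le_mod_def scaleR_diff_left)
  show "ereal r \<le> ereal s"
  proof (rule ccontr)
    assume "\<not> ereal r \<le> ereal s"
    then have "0 < r - s" by simp
    then show False using le_mod_scaleR[OF le, of "1 / (r - s)"] not_u_le_mod by simp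
  qed
qed

lemma \<phi>_lessD: "\<phi> x < ereal s \<Longrightarrow> x \<preceq> s *\<^sub>R u"
  using le_mod_total[of x "s *\<^sub>R u"] le_\<phi>[of s x] by auto

lemma \<phi>_mono: "x \<preceq> y \<Longrightarrow> \<phi> x \<le> \<phi> y"
  by (rule ereal_le_dense) (use less_\<phi>D le_\<phi> le_mod_trans in blast)

lemma \<phi>_scaleR_le: "0 < c \<Longrightarrow> \<phi> (c *\<^sub>R x) \<le> ereal c * \<phi> x"
proof (rule ereal_le_dense)
  fix r assume c: "0 < c" and "ereal r < \<phi> (c *\<^sub>R x)"
  then have "r *\<^sub>R u \<preceq> c *\<^sub>R x" by (intro less_\<phi>D)
  then have "(r / c) *\<^sub>R u \<preceq> x" using le_mod_scaleR[of "r *\<^sub>R u" "c *\<^sub>R x" "1 / c"] c by simp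
  then have "ereal c * ereal (r / c) \<le> ereal c * \<phi> x"
    using c by (intro ereal_mult_left_mono le_\<phi>) auto
  then show "ereal r \<le> ereal c * \<phi> x" using c by simp
qed

lemma \<phi>_scaleR: 
  assumes c: "0 < c"
  shows "\<phi> (c *\<^sub>R x) = ereal c * \<phi> x"
proof (rule antisym)
  have "\<phi> ((1 / c) *\<^sub>R (c *\<^sub>R x)) \<le> ereal (1 / c) * \<phi> (c *\<^sub>R x)"
    using c by (intro \<phi>_scaleR_le) simp
  then have "ereal c * \<phi> x \<le> ereal c * (ereal (1 / c) * \<phi> (c *\<^sub>R x))"
    using c by (intro ereal_mult_left_mono) auto
  also have "\<dots> = \<phi> (c *\<^sub>R x)" using c by (simp add: mult.assoc[symmetric] one_ereal_def[symmetric])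
  finally show "ereal c * \<phi> x \<le> \<phi> (c *\<^sub>R x)" .
qed (use \<phi>_scaleR_le c in auto)

lemma \<phi>_uminus_le: "\<phi> (- x) \<le> - \<phi> x"
proof (rule ereal_le_dense)
  fix r assume "ereal r < \<phi> (- x)"
  then have "r *\<^sub>R u \<preceq> - x" by (rule less_\<phi>D)
  then have "- (- x) \<preceq> - (r *\<^sub>R u)" by (simp only: le_mod_uminus)
  then have "x \<preceq> (- r) *\<^sub>R u" by simp
  then have "\<phi> x \<le> ereal (- r)" by (rule \<phi>_le)
  then have "- ereal (- r) \<le> - \<phi> x" by (simp only: ereal_minus_le_minus)
  then show "ereal r \<le> - \<phi> x" by simp
qed

lemma \<phi>_uminus: "\<phi> (- x) = - \<phi> x"
proof (rule antisym[OF \<phi>_uminus_le])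
  show "- \<phi> x \<le> \<phi> (- x)"
  proof (rule ereal_le_dense)
    fix r assume "ereal r < - \<phi> x"
    then have "\<phi> x < ereal (- r)" using ereal_less_uminus_reorder[of "ereal r" "\<phi> x"] by simp
    then have "x \<preceq> (- r) *\<^sub>R u" by (rule \<phi>_lessD)
    then have "- ((- r) *\<^sub>R u) \<preceq> - x" by (simp only: le_mod_uminus)
    then show "ereal r \<le> \<phi> (- x)" by (intro le_\<phi>) simp
  qed
qed

lemma \<phi>_sup: "\<phi> (sup_class.sup x y) = max (\<phi> x) (\<phi> y)"
proof (rule antisym)
  show "\<phi> (sup_class.sup x y) \<le> max (\<phi> x) (\<phi> y)"
  proof (rule ccontr)
    assume "\<not> ?thesis"
    then have "max (\<phi> x) (\<phi> y) < \<phi> (sup_class.sup x y)" by (rule not_le_imp_less)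
    then obtain s where s: "max (\<phi> x) (\<phi> y) < ereal s" "ereal s < \<phi> (sup_class.sup x y)"
      using ereal_dense2 by blast
    then have "\<phi> (sup_class.sup x y) \<le> ereal s" by (intro \<phi>_le le_mod_sup \<phi>_lessD) auto
    then show False using s by simp
  qed
qed (auto intro!: \<phi>_mono le_imp_le_mod)

lemma \<phi>_u: "\<phi> u = 1"
  using \<phi>_le[of u 1] le_\<phi>[of 1 u] le_imp_le_mod[of u u] by (simp add: one_ereal_def antisym)

lemma \<phi>_trunc:
  assumes "0 \<le> x"
  shows "\<phi> (t x) = min (\<phi> x) 1"
proof -
  have "inf_class.inf x u \<preceq> t x" using assms k by (intro le_imp_le_mod inf_trunc_le)
  then have "\<phi> (t x) = \<phi> (inf_class.inf x u)"
    using assms trunc_le_mod by (intro antisym \<phi>_mono) auto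
  also have "\<dots> = - \<phi> (sup_class.sup (- x) (- u))"
    by (simp add: \<phi>_uminus[symmetric] uminus_inf_eq_sup[symmetric])
  also have "\<dots> = min (\<phi> x) 1" by (auto simp: \<phi>_sup \<phi>_uminus \<phi>_u max_def min_def not_le intro: antisym less_imp_le)
  finally show ?thesis .
qed

lemma \<phi>_in_spectrum: "\<phi> \<in> spectrum t"
  unfolding spectrum_def
  by (auto simp: \<phi>_scaleR \<phi>_uminus \<phi>_sup \<phi>_trunc scaleR_add_left
      intro!: le_\<phi>[of "_ + _", simplified] le_mod_add dest!: less_\<phi>D)

lemma \<phi>_k: "1 \<le> \<phi> k"
  using \<phi>_mono[OF le_imp_le_mod[OF trunc_le[OF k]]] \<phi>_u by simp

end

text \<open>The third truncation axiom yields a multiple k of g with t k \<noteq> k, and by the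
  second axiom \<open>t (k - t k)\<close> is nonzero. A prime ideal missing it gives a point with
  value at least 1 at k.\<close>

lemma (in truncation) spectrum_separates:
  assumes g: "0 \<le> g" "g \<noteq> 0"
  shows "\<exists>\<phi>\<in>spectrum t. 0 < \<phi> g"
proof -
  obtain n :: nat where n: "n > 0" "real n *\<^sub>R g \<noteq> t (real n *\<^sub>R g)"
    using trunc_multiples[OF g(1)] g(2) by blast
  define k where "k = real n *\<^sub>R g"
  have k: "0 \<le> k" using g by (simp add: k_def scaleR_nonneg_nonneg)
  have kt: "0 \<le> k - t k" "k - t k \<noteq> 0" using trunc_le[OF k] n by (auto simp: k_def)
  obtain P where P: "lideal P" "t (k - t k) \<notin> P"
    "\<And>a b. 0 \<le> a \<Longrightarrow> 0 \<le> b \<Longrightarrow> inf_class.inf a b = 0 \<Longrightarrow> a \<in> P \<or> b \<in> P"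
    using ex_prime_lideal[of "t (k - t k)"] trunc_nonneg[OF kt(1)] trunc_eq_0[OF kt(1)] kt(2) by blast
  interpret prime_quotient t P k by unfold_locales (use P k in auto)
  have "1 \<le> ereal (real n) * \<phi> g" using \<phi>_k \<phi>_scaleR[of "real n" g] n by (simp add: k_def)
  then have "0 < ereal (real n) * \<phi> g" by (rule less_le_trans[rotated]) simp
  then have "0 < \<phi> g" using n by (simp add: ereal_zero_less_0_iff)
  then show ?thesis using \<phi>_in_spectrum by blast
qed

section \<open>Compactifications from families of dense open sets\<close>

definition set_pframe :: "'x set set \<Rightarrow> 'x \<Rightarrow> 'x set pframe" where
  "set_pframe S x = \<lparr>carrier = S, eq = (=), le = (\<subseteq>), point = (\<lambda>U. x \<in> U)\<rparr>"

lemma set_pframe_simps [simp]: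
  "carrier (set_pframe S x) = S" "eq (set_pframe S x) = (=)" "le (set_pframe S x) = (\<subseteq>)"
  "point (set_pframe S x) U \<longleftrightarrow> x \<in> U"
  by (simp_all add: set_pframe_def)

lemma frame_hom_pointI:
  assumes "\<And>A. A \<subseteq> carrier L \<Longrightarrow> p (\<Squnion>\<^bsub>L\<^esub>A) \<longleftrightarrow> (\<exists>a\<in>A. p a)"
    "\<And>x y. x \<in> carrier L \<Longrightarrow> y \<in> carrier L \<Longrightarrow> p (x \<sqinter>\<^bsub>L\<^esub> y) \<longleftrightarrow> p x \<and> p y" "p \<top>\<^bsub>L\<^esub>"
  shows "frame_hom L two p"
  unfolding frame_hom_def
proof (intro conjI ballI allI impI)
  show "p \<in> carrier L \<rightarrow> carrier two" by (simp add: two_def)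
  show "p (\<Squnion>\<^bsub>L\<^esub>A) = \<Squnion>\<^bsub>two\<^esub>(p ` A)" if "A \<subseteq> carrier L" for A
    using assms(1)[OF that] unfolding sup_two by (simp add: image_iff)
qed (use assms(2,3) in \<open>simp_all add: meet_two top_two\<close>)

text \<open>
  \<open>S\<close> below is the intersection of the open sublocales \<open>Y i \<rightarrow> \<O>\<close>, and \<open>j\<close> is its nucleus.
\<close>

locale dense_open_family =
  fixes \<O> :: "'x set set" and X and Y :: "'i \<Rightarrow> 'x set" and x\<^sub>0
  assumes Union: "A \<subseteq> \<O> \<Longrightarrow> \<Union>A \<in> \<O>"
    and Int: "U \<in> \<O> \<Longrightarrow> V \<in> \<O> \<Longrightarrow> U \<inter> V \<in> \<O>"
    and top: "X \<in> \<O>" and sub: "U \<in> \<O> \<Longrightarrow> U \<subseteq> X"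
    and Y: "Y i \<in> \<O>" and dense_Y: "U \<in> \<O> \<Longrightarrow> U \<inter> Y i = {} \<Longrightarrow> U = {}"
    and base_point: "x\<^sub>0 \<in> X" "x\<^sub>0 \<in> Y i"
begin

abbreviation M where "M \<equiv> set_pframe \<O> x\<^sub>0"

definition S where "S = {z \<in> \<O>. \<forall>i. \<forall>u\<in>\<O>. u \<inter> Y i \<subseteq> z \<longrightarrow> u \<subseteq> z}"

abbreviation L where "L \<equiv> set_pframe S x\<^sub>0"

text \<open>The meet, in the lattice of open sets, of all members of S above x. It is a union of
  open sets because an intersection of infinitely many need not be open.\<close>

definition j where "j x = \<Union>{u \<in> \<O>. \<forall>z\<in>S. x \<subseteq> z \<longrightarrow> u \<subseteq> z}"

definition quotient where "quotient = \<lparr>src = M, tgt = L, arr = restrict j \<O>\<rparr>"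

lemma S_open: "z \<in> S \<Longrightarrow> z \<in> \<O>"
  by (simp add: S_def)

lemma SD: "z \<in> S \<Longrightarrow> u \<in> \<O> \<Longrightarrow> u \<inter> Y i \<subseteq> z \<Longrightarrow> u \<subseteq> z"
  by (simp add: S_def)

lemma j_open: "j x \<in> \<O>"
  unfolding j_def by (rule Union) blast

lemma j_least: "z \<in> S \<Longrightarrow> x \<subseteq> z \<Longrightarrow> j x \<subseteq> z"
  by (auto simp: j_def)

lemma j_in_S [simp]: "j x \<in> S"
  unfolding S_def
proof (intro CollectI conjI allI ballI impI j_open)
  fix i u assume u: "u \<in> \<O>" "u \<inter> Y i \<subseteq> j x"
  have "u \<subseteq> z" if z: "z \<in> S" "x \<subseteq> z" for z
    using SD[OF z(1) u(1)] u(2) j_least[OF z] by blast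
  then show "u \<subseteq> j x" using u(1) by (auto simp: j_def)
qed

lemma j_upper: "x \<in> \<O> \<Longrightarrow> x \<subseteq> j x"
  by (auto simp: j_def)

lemma j_mono: "y \<in> \<O> \<Longrightarrow> x \<subseteq> y \<Longrightarrow> j x \<subseteq> j y"
  using j_least[OF j_in_S[of y], of x] j_upper[of y] by auto

lemma j_eq: "z \<in> S \<Longrightarrow> j z = z"
  by (simp add: S_open j_least j_upper subset_antisym)

text \<open>S is closed under Heyting implication from any open b. This is the property of a
  sublocale that makes j preserve binary meets.\<close>

lemma imp_in_S:
  assumes "b \<in> \<O>" "z \<in> S"
  shows "\<Union>{u \<in> \<O>. u \<inter> b \<subseteq> z} \<in> S" (is "?w \<in> S")
  unfolding S_def
proof (intro CollectI conjI allI ballI impI)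
  show "?w \<in> \<O>" by (rule Union) blast
  fix i v assume v: "v \<in> \<O>" "v \<inter> Y i \<subseteq> ?w"
  have "(v \<inter> b) \<inter> Y i \<subseteq> z" using v(2) by blast
  then have "v \<inter> b \<subseteq> z" by (rule SD[OF assms(2) Int[OF v(1) assms(1)]])
  then show "v \<subseteq> ?w" using v by blast
qed

text \<open>From a \<inter> b \<subseteq> z one moves b to the right as an implication in S,
  replaces a by j a, and then does the same with the roles exchanged.\<close>

lemma j_Int:
  assumes "a \<in> \<O>" "b \<in> \<O>"
  shows "j (a \<inter> b) = j a \<inter> j b"
proof
  show "j (a \<inter> b) \<subseteq> j a \<inter> j b" using assms by (simp add: j_mono Int)
  let ?z = "j (a \<inter> b)"
  have ab: "a \<inter> b \<subseteq> ?z" using assms by (intro j_upper Int)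
  have "j a \<subseteq> \<Union>{u \<in> \<O>. u \<inter> b \<subseteq> ?z}"
    using assms ab by (intro j_least imp_in_S) auto
  then have "b \<inter> j a \<subseteq> ?z" by blast
  then have "j b \<subseteq> \<Union>{u \<in> \<O>. u \<inter> j a \<subseteq> ?z}"
    using assms by (intro j_least imp_in_S j_open) auto
  then show "j a \<inter> j b \<subseteq> ?z" by blast
qed

lemma j_Y: "j (Y i) = X"
proof
  show "X \<subseteq> j (Y i)" using j_upper[OF Y] by (intro SD[OF j_in_S top]) auto
qed (rule sub[OF j_open])

lemma top_in_S: "X \<in> S"
  using j_in_S[of "Y undefined"] by (simp add: j_Y)

text \<open>Density of the sets Y i enters here: the bottom of the quotient is the empty set, so j
  is a dense map.\<close>

lemma empty_in_S: "{} \<in> S"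
  using dense_Y Union[of "{}"] by (auto simp: S_def)

text \<open>j does not see the complement of a Y i. For the spectrum this means that identities need
  checking only where two chosen elements are finite.\<close>

lemma j_cong:
  assumes "a \<in> \<O>" "b \<in> \<O>" "a \<inter> Y i \<inter> Y i' = b \<inter> Y i \<inter> Y i'"
  shows "j a = j b"
proof -
  have "j (c \<inter> Y i \<inter> Y i') = j c" if "c \<in> \<O>" for c
    using that sub[OF j_open[of c]] by (simp add: j_Int Y Int j_Y inf_absorb1)
  then show ?thesis using assms by metis
qed

text \<open>The largest open set missing \<open>x\<^sub>0\<close> belongs to S, because
  \<open>x\<^sub>0\<close> lies in every Y i. So j x misses the point whenever x does.\<close>

lemma base_point_j: "x \<in> \<O> \<Longrightarrow> x\<^sub>0 \<in> j x \<longleftrightarrow> x\<^sub>0 \<in> x"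
proof
  let ?z = "\<Union>{u \<in> \<O>. x\<^sub>0 \<notin> u}"
  have zO: "?z \<in> \<O>" by (rule Union) blast
  have z: "?z \<in> S"
    unfolding S_def
  proof (intro CollectI conjI allI ballI impI zO)
    fix i u assume u: "u \<in> \<O>" "u \<inter> Y i \<subseteq> ?z"
    then have "x\<^sub>0 \<notin> u" using base_point(2)[of i] by blast
    then show "u \<subseteq> ?z" using u by blast
  qed
  assume x: "x \<in> \<O>" "x\<^sub>0 \<in> j x"
  show "x\<^sub>0 \<in> x"
  proof (rule ccontr)
    assume "x\<^sub>0 \<notin> x"
    then have "j x \<subseteq> ?z" using x by (intro j_least z) blast
    then show False using x by blast
  qed
qed (use j_upper in blast)

lemma
  shows frame_M: "frame M" and sup_M: "\<And>A. A \<subseteq> \<O> \<Longrightarrow> \<Squnion>\<^bsub>M\<^esub>A = \<Union>A"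
    and meet_M: "\<And>U V. U \<in> \<O> \<Longrightarrow> V \<in> \<O> \<Longrightarrow> U \<sqinter>\<^bsub>M\<^esub> V = U \<inter> V"
    and join_M: "\<And>U V. U \<in> \<O> \<Longrightarrow> V \<in> \<O> \<Longrightarrow> U \<squnion>\<^bsub>M\<^esub> V = U \<union> V"
    and top_M: "\<top>\<^bsub>M\<^esub> = X" and bot_M: "\<bottom>\<^bsub>M\<^esub> = {}"
proof -
  note * = set_frame[of M \<O> X, OF _ _ _ Union Int top sub, simplified]
  show "frame M" "\<top>\<^bsub>M\<^esub> = X" "\<bottom>\<^bsub>M\<^esub> = {}" by (rule *; assumption)+
  show "\<And>A. A \<subseteq> \<O> \<Longrightarrow> \<Squnion>\<^bsub>M\<^esub>A = \<Union>A" by (rule *(2))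
  show "\<And>U V. U \<in> \<O> \<Longrightarrow> V \<in> \<O> \<Longrightarrow> U \<sqinter>\<^bsub>M\<^esub> V = U \<inter> V" by (rule *(3))
  show "\<And>U V. U \<in> \<O> \<Longrightarrow> V \<in> \<O> \<Longrightarrow> U \<squnion>\<^bsub>M\<^esub> V = U \<union> V" by (rule *(4))
qed

lemma pointed_frame_M: "pointed_frame M"
proof -
  have "frame_hom M two (point M)"
    by (rule frame_hom_pointI) (auto simp: sup_M meet_M top_M base_point)
  then show ?thesis using frame_M by (simp add: pointed_frame_def pointed_frame_axioms_def)
qed

lemma Int_in_S: "x \<in> S \<Longrightarrow> y \<in> S \<Longrightarrow> x \<inter> y \<in> S"
  using j_Int[of x y] j_in_S[of "x \<inter> y"] by (simp add: j_eq S_open)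

lemma
  shows frame_L: "frame L" and sup_L: "\<And>A. A \<subseteq> S \<Longrightarrow> \<Squnion>\<^bsub>L\<^esub>A = j (\<Union>A)"
    and meet_L: "\<And>U V. U \<in> S \<Longrightarrow> V \<in> S \<Longrightarrow> U \<sqinter>\<^bsub>L\<^esub> V = U \<inter> V"
    and top_L: "\<top>\<^bsub>L\<^esub> = X" and bot_L: "\<bottom>\<^bsub>L\<^esub> = {}"
proof -
  have UO: "\<Union>A \<in> \<O>" if "A \<subseteq> S" for A using that S_open by (intro Union) blast
  interpret partial_order L
    by unfold_locales auto
  interpret complete_lattice L
  proof
    fix A assume A: "A \<subseteq> carrier L"
    have "least L (j (\<Union>A)) (Upper L A)"
      unfolding least_def Upper_def using A j_upper[OF UO, of A] j_least[of _ "\<Union>A"]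
      by (auto; blast)
    then show "\<exists>s. least L s (Upper L A)" ..
    let ?B = "{z \<in> S. \<forall>a\<in>A. z \<subseteq> a}"
    have "j (\<Union>?B) \<subseteq> a" if "a \<in> A" for a using A that by (intro j_least) auto
    moreover have "z \<subseteq> j (\<Union>?B)" if "z \<in> ?B" for z using that j_upper[OF UO, of ?B] by blast
    moreover have "Lower L A = ?B" using A by (auto simp: Lower_def)
    ultimately have "greatest L (j (\<Union>?B)) (Lower L A)"
      unfolding greatest_def by auto
    then show "\<exists>i. greatest L i (Lower L A)" ..
  qed
  show sup: "\<Squnion>\<^bsub>L\<^esub>A = j (\<Union>A)" if A: "A \<subseteq> S" for A
  proof (rule le_antisym)
    have "\<Union>A \<subseteq> \<Squnion>\<^bsub>L\<^esub>A" using A sup_upper[of A] by auto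
    then show "j (\<Union>A) \<sqsubseteq>\<^bsub>L\<^esub> \<Squnion>\<^bsub>L\<^esub>A" using A sup_closed[of A] by (simp add: j_least)
    show "\<Squnion>\<^bsub>L\<^esub>A \<sqsubseteq>\<^bsub>L\<^esub> j (\<Union>A)" using A j_upper[OF UO[OF A]] by (intro sup_least) auto
  qed (use A sup_closed[of A] in auto)
  show meet: "U \<sqinter>\<^bsub>L\<^esub> V = U \<inter> V" if "U \<in> S" "V \<in> S" for U V
  proof (rule le_antisym)
    show "U \<sqinter>\<^bsub>L\<^esub> V \<sqsubseteq>\<^bsub>L\<^esub> U \<inter> V" using that meet_left[of U V] meet_right[of U V] by auto
    show "U \<inter> V \<sqsubseteq>\<^bsub>L\<^esub> U \<sqinter>\<^bsub>L\<^esub> V" using that Int_in_S by (intro meet_le) auto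
  qed (use that Int_in_S meet_closed[of U V] in auto)
  show "\<top>\<^bsub>L\<^esub> = X"
    using top_closed top_higher[of X] top_in_S sub S_open by auto
  show "\<bottom>\<^bsub>L\<^esub> = {}" using bottom_lower[of "{}"] empty_in_S by auto
  show "frame L"
  proof
    fix x A assume "x \<in> carrier L" "A \<subseteq> carrier L"
    then have x: "x \<in> S" and A: "A \<subseteq> S" by auto
    have *: "(\<lambda>a. x \<sqinter>\<^bsub>L\<^esub> a) ` A = (\<lambda>a. x \<inter> a) ` A" using x A by (auto simp: meet subset_iff)
    have **: "(\<lambda>a. x \<inter> a) ` A \<subseteq> S" using x A Int_in_S by auto
    have "x \<inter> j (\<Union>A) = j (x \<inter> \<Union>A)" using x A UO by (simp add: j_Int S_open j_eq)
    also have "x \<inter> \<Union>A = \<Union>((\<lambda>a. x \<inter> a) ` A)" by blast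
    finally show "x \<sqinter>\<^bsub>L\<^esub> \<Squnion>\<^bsub>L\<^esub>A = \<Squnion>\<^bsub>L\<^esub>((\<lambda>a. x \<sqinter>\<^bsub>L\<^esub> a) ` A)"
      unfolding * using x A ** by (simp add: sup meet)
  qed
qed

lemma j_Union:
  assumes "A \<subseteq> \<O>"
  shows "j (\<Union>A) = j (\<Union>(j ` A))"
proof
  have "\<Union>(j ` A) \<in> \<O>" by (rule Union) (auto simp: j_open)
  then show "j (\<Union>A) \<subseteq> j (\<Union>(j ` A))"
    using j_upper assms by (intro j_mono) blast+
  have "j a \<subseteq> j (\<Union>A)" if "a \<in> A" for a using that Union[OF assms] by (intro j_mono) blast+
  then show "j (\<Union>(j ` A)) \<subseteq> j (\<Union>A)" by (intro j_least) auto
qed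

lemma pointed_frame_L: "pointed_frame L"
proof -
  have UO: "\<Union>A \<in> \<O>" if "A \<subseteq> S" for A using that S_open by (intro Union) blast
  have "frame_hom L two (point L)"
    by (rule frame_hom_pointI) (auto simp: sup_L meet_L top_L base_point base_point_j UO)
  then show ?thesis using frame_L by (simp add: pointed_frame_def pointed_frame_axioms_def)
qed

lemma j_hom: "frame_hom M L j"
  unfolding frame_hom_def
proof (intro conjI ballI allI impI)
  show "j \<top>\<^bsub>M\<^esub> = \<top>\<^bsub>L\<^esub>" by (simp add: top_M top_L j_eq top_in_S)
  fix A assume "A \<subseteq> carrier M"
  then show "j (\<Squnion>\<^bsub>M\<^esub>A) = \<Squnion>\<^bsub>L\<^esub>(j ` A)"
    using j_Union[of A] by (simp add: sup_M sup_L image_subset_iff)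
qed (auto simp: meet_M meet_L j_Int)

lemma compactification_quotient:
  assumes "compact_frame M" "regular_frame M"
  shows "compactification quotient"
proof -
  have "frame_hom M L (restrict j \<O>)"
    using frame_hom_restrict[OF frame_M j_hom] by simp
  then have "restrict j \<O> \<in> pframe_homs M L"
    by (auto simp: pframe_homs_def base_point_j)
  moreover have "restrict j \<O> ` \<O> = S"
  proof (intro equalityI subsetI)
    fix z assume z: "z \<in> S"
    then have "z = restrict j \<O> z" using j_eq S_open by simp
    then show "z \<in> restrict j \<O> ` \<O>" using S_open[OF z] by (rule image_eqI)
  qed auto
  moreover have "x = {}" if "x \<in> \<O>" "j x = {}" for x using j_upper that by blast
  ultimately show ?thesis
    using assms by (simp add: compactification_def quotient_def pointed_frame_M pointed_frame_L bot_L bot_M)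
qed

lemma assoc_sublocale_quotient: "assoc_sublocale quotient = S"
proof -
  have "right_adjoint quotient x = x" if x: "x \<in> S" for x
  proof -
    have "\<Union>{y \<in> \<O>. j y \<subseteq> x} = x"
    proof
      show "\<Union>{y \<in> \<O>. j y \<subseteq> x} \<subseteq> x" using j_upper by blast
      show "x \<subseteq> \<Union>{y \<in> \<O>. j y \<subseteq> x}" using x S_open j_eq by auto
    qed
    moreover have "{y \<in> \<O>. restrict j \<O> y \<subseteq> x} = {y \<in> \<O>. j y \<subseteq> x}" by auto
    ultimately show ?thesis
      by (simp add: right_adjoint_def quotient_def) (simp add: sup_M)
  qed
  then show ?thesis by (simp add: assoc_sublocale_def quotient_def)
qed

lemma open_sublocale_M:
  "y \<in> \<O> \<Longrightarrow> open_sublocale M y = {z \<in> \<O>. \<forall>u\<in>\<O>. u \<inter> y \<subseteq> z \<longrightarrow> u \<subseteq> z}"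
  by (rule Set.set_eqI) (simp add: frame.mem_open_sublocale_iff[OF frame_M] meet_M)

lemma S_eq_Inter: "S = (\<Inter>i. open_sublocale M (Y i))"
  by (auto simp: open_sublocale_M Y S_def)

lemma suitable_quotient:
  assumes "\<And>i. cozero_element M (Y i)"
  shows "suitable quotient"
proof -
  have "open_sublocale M (Y i) \<in> {open_sublocale M y |y. cozero_element M y \<and> S \<subseteq> open_sublocale M y}" for i
  proof -
    have "S \<subseteq> open_sublocale M (Y i)" unfolding S_eq_Inter by (rule INT_lower) simp
    then show ?thesis using assms[of i] by blast
  qed
  then have "\<Inter>{open_sublocale M y |y. cozero_element M y \<and> S \<subseteq> open_sublocale M y}
      \<subseteq> (\<Inter>i. open_sublocale M (Y i))"
    by (intro INT_greatest Inter_lower)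
  then have "S = \<Inter>{open_sublocale M y |y. cozero_element M y \<and> S \<subseteq> open_sublocale M y}"
    unfolding S_eq_Inter[symmetric] by (intro subset_antisym Inter_greatest) auto
  then show ?thesis unfolding suitable_def assoc_sublocale_quotient by (simp add: quotient_def)
qed

end

lemma continuous_on_eval: "continuous_on A (\<lambda>\<phi>::'a \<Rightarrow> ereal. \<phi> g)"
  by (rule continuous_on_subset[OF continuous_on_product_coordinates]) simp

lemma compact_UNIV_fun: "compact (UNIV :: ('a \<Rightarrow> ereal) set)"
proof -
  have "compact_space (euclidean :: ereal topology)"
    by (simp add: compact_space_def compact_UNIV)
  then have "compact_space (product_topology (\<lambda>_::'a. euclidean :: ereal topology) UNIV)"
    by (simp add: compact_space_product_topology)
  then show ?thesis by (simp add: euclidean_product_topology compact_space_def)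
qed

text \<open>All clauses concern finitely many continuous coordinates. In the clause for sums the
  premises are strict, hence open, and the conclusion is not strict, hence closed.\<close>

lemma closed_spectrum: "closed (spectrum t)"
proof -
  note c = continuous_on_eval
  have u: "continuous_on UNIV (\<lambda>\<phi>::'a \<Rightarrow> ereal. - \<phi> g)" for g
    using continuous_on_compose2[OF continuous_uminus_ereal[of UNIV] c] by simp
  have s: "continuous_on UNIV (\<lambda>\<phi>::'a \<Rightarrow> ereal. ereal r * \<phi> g)" for r g
    using c[of UNIV g] unfolding continuous_on_def by (auto intro!: tendsto_cmult_ereal)
  show ?thesis unfolding spectrum_def
    by (intro closed_Collect_conj closed_Collect_all closed_Collect_imp closed_Collect_eq
        closed_Collect_le open_Collect_less open_Collect_const continuous_on_max continuous_on_min
        continuous_on_const c u s)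
qed

lemma compact_spectrum: "compact (spectrum t)"
  using compact_Int_closed[OF compact_UNIV_fun closed_spectrum[of t]] by simp

section \<open>Computing with the points of the spectrum\<close>

context truncation
begin

abbreviation X where "X \<equiv> spectrum t"

lemma
  assumes "\<phi> \<in> X"
  shows spectrum_scaleR: "0 < c \<Longrightarrow> \<phi> (c *\<^sub>R g) = ereal c * \<phi> g"
    and spectrum_uminus: "\<phi> (- g) = - \<phi> g"
    and spectrum_sup: "\<phi> (sup_class.sup g h) = max (\<phi> g) (\<phi> h)"
    and spectrum_superadd: "ereal a < \<phi> g \<Longrightarrow> ereal b < \<phi> h \<Longrightarrow> ereal (a + b) \<le> \<phi> (g + h)"
    and spectrum_trunc: "0 \<le> g \<Longrightarrow> \<phi> (t g) = min (\<phi> g) 1"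
  using assms by (auto simp: spectrum_def simp del: plus_ereal.simps)

lemma spectrum_zero: "\<phi> \<in> X \<Longrightarrow> \<phi> 0 = 0"
  using spectrum_uminus[of \<phi> 0] by (cases "\<phi> 0") auto

lemma spectrum_mono:
  assumes "\<phi> \<in> X" "g \<le> h"
  shows "\<phi> g \<le> \<phi> h"
proof -
  have "\<phi> h = max (\<phi> g) (\<phi> h)" using spectrum_sup[OF assms(1), of g h] assms(2) by (simp add: sup_absorb2)
  then show ?thesis by (metis max.cobounded1)
qed

lemma spectrum_nonneg: "\<phi> \<in> X \<Longrightarrow> 0 \<le> g \<Longrightarrow> 0 \<le> \<phi> g"
  using spectrum_mono[of \<phi> 0 g] by (simp add: spectrum_zero)

lemma spectrum_inf:
  assumes "\<phi> \<in> X"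
  shows "\<phi> (inf_class.inf g h) = min (\<phi> g) (\<phi> h)"
proof -
  have "- \<phi> (inf_class.inf g h) = max (- \<phi> g) (- \<phi> h)"
    using assms by (simp add: spectrum_uminus[symmetric] spectrum_sup[symmetric] uminus_inf_eq_sup)
  then have "\<phi> (inf_class.inf g h) = - max (- \<phi> g) (- \<phi> h)" by (metis ereal_uminus_uminus)
  then show ?thesis by (auto simp: max_def min_def not_le intro: antisym less_imp_le)
qed

lemma spectrum_pos: "\<phi> \<in> X \<Longrightarrow> \<phi> (pos g) = max (\<phi> g) 0"
  by (simp add: spectrum_sup spectrum_zero)

text \<open>The defining clause for sums gives one inequality; applied to - g and - h it gives the
  other. A real value at g keeps every sum defined.\<close>

lemma spectrum_add:
  assumes \<phi>: "\<phi> \<in> X" and g: "\<phi> g = ereal a"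
  shows "\<phi> (g + h) = ereal a + \<phi> h"
proof (rule antisym)
  have le: "ereal a + \<phi> h \<le> \<phi> (g + h)" if g: "\<phi> g = ereal a" for g h a
  proof (rule ereal_le_dense)
    fix r assume "ereal r < ereal a + \<phi> h"
    then have "ereal (r - a) < \<phi> h" by (cases "\<phi> h") auto
    then obtain b where b: "ereal (r - a) < ereal b" "ereal b < \<phi> h" using ereal_dense2 by blast
    then have "ereal (r - b) < \<phi> g" by (simp add: g)
    then show "ereal r \<le> \<phi> (g + h)" using spectrum_superadd[OF \<phi> _ b(2), of "r - b" g] by simp
  qed
  show "ereal a + \<phi> h \<le> \<phi> (g + h)" by (rule le[OF g])
  have "\<phi> (- g) = ereal (- a)" using g \<phi> by (simp add: spectrum_uminus)
  then have "ereal (- a) + \<phi> (- h) \<le> \<phi> (- g + - h)" by (rule le)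
  also have "- g + - h = - (g + h)" by simp
  finally have "ereal (- a) + - \<phi> h \<le> - \<phi> (g + h)" using \<phi> by (simp only: spectrum_uminus)
  then show "\<phi> (g + h) \<le> ereal a + \<phi> h"
    by (cases "\<phi> h"; cases "\<phi> (g + h)") auto
qed

lemma spectrum_trunc_real:
  assumes "\<phi> \<in> X" "0 \<le> g"
  obtains b where "\<phi> (t g) = ereal b" "0 \<le> b" "b \<le> 1" "ereal b = min (\<phi> g) 1"
proof -
  have *: "0 \<le> \<phi> (t g)" "\<phi> (t g) \<le> 1" "\<phi> (t g) = min (\<phi> g) 1"
    using assms spectrum_nonneg[OF assms(1) trunc_nonneg[OF assms(2)]] by (auto simp: spectrum_trunc)
  obtain b where b: "\<phi> (t g) = ereal b" by (cases "\<phi> (t g)") (use *(1,2) in auto)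
  have "0 \<le> b" "b \<le> 1" using *(1,2) unfolding b by (simp_all add: one_ereal_def)
  then show ?thesis using that[OF b] *(3) unfolding b by simp
qed

lemma spectrum_sub_trunc:
  assumes "\<phi> \<in> X" "0 \<le> g"
  shows "0 < \<phi> (g - t g) \<longleftrightarrow> 1 < \<phi> g"
proof -
  obtain b where b: "\<phi> (t g) = ereal b" "0 \<le> b" "b \<le> 1" "ereal b = min (\<phi> g) 1"
    using spectrum_trunc_real[OF assms] .
  have "\<phi> (- t g) = ereal (- b)"
    by (simp only: spectrum_uminus[OF assms(1)] b(1) uminus_ereal.simps)
  then have "\<phi> (- t g + g) = ereal (- b) + \<phi> g" using assms by (intro spectrum_add)
  moreover have "- t g + g = g - t g" by simp
  ultimately have "\<phi> (g - t g) = ereal (- b) + \<phi> g" by simp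
  then show ?thesis using b
    by (cases "\<phi> g") (auto simp: min_def one_ereal_def split: if_splits)
qed

lemma zero_in_spectrum: "(\<lambda>_. 0) \<in> X"
  by (auto simp: spectrum_def zero_ereal_def)

subsection \<open>The open sets of the spectrum\<close>

definition coz where "coz g = {\<phi>\<in>X. 0 < \<phi> g}"
definition con where "con g = {\<phi>\<in>X. \<phi> g < 1}"

definition basics where "basics = coz ` {g. 0 \<le> g} \<union> con ` {g. 0 \<le> g}"

text \<open>With the sets coz and con as a base by definition, join-generation in the snugness
  condition is immediate. The work moves to showing that they form a base
  (\<open>coz_con_Int\<close>) and that all coordinates are continuous
  (\<open>ev_opn\<close>).\<close>

definition opn where "opn = {U. U \<subseteq> X \<and> (\<forall>\<phi>\<in>U. \<exists>B\<in>basics. \<phi> \<in> B \<and> B \<subseteq> U)}"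

definition ev where "ev g U = {\<phi>\<in>X. \<phi> g \<in> U}"

lemma opnI: "U \<subseteq> X \<Longrightarrow> (\<And>\<phi>. \<phi> \<in> U \<Longrightarrow> \<exists>B\<in>basics. \<phi> \<in> B \<and> B \<subseteq> U) \<Longrightarrow> U \<in> opn"
  by (simp add: opn_def)

lemma opnD: "U \<in> opn \<Longrightarrow> U \<subseteq> X"
  by (simp add: opn_def)

lemma opn_basics:
  assumes "U \<in> opn" "\<phi> \<in> U"
  obtains B where "B \<in> basics" "\<phi> \<in> B" "B \<subseteq> U"
  using assms that unfolding opn_def mem_Collect_eq by meson

lemma basics_opn: "B \<in> basics \<Longrightarrow> B \<in> opn"
proof -
  assume B: "B \<in> basics"
  then have "B \<subseteq> X" by (auto simp: basics_def coz_def con_def)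
  then show "B \<in> opn" unfolding opn_def using B by blast
qed

lemma coz_opn: "0 \<le> g \<Longrightarrow> coz g \<in> opn" and con_opn: "0 \<le> g \<Longrightarrow> con g \<in> opn"
  by (auto intro!: basics_opn simp: basics_def)

lemma Union_opn: "A \<subseteq> opn \<Longrightarrow> \<Union>A \<in> opn"
proof -
  assume A: "A \<subseteq> opn"
  show "\<Union>A \<in> opn"
  proof (rule opnI)
    show "\<Union>A \<subseteq> X" using A opnD by auto
    fix \<phi> assume "\<phi> \<in> \<Union>A"
    then obtain U where U: "\<phi> \<in> U" "U \<in> A" by (rule UnionE)
    then have "U \<in> opn" using A by auto
    then obtain B where B: "B \<in> basics" "\<phi> \<in> B" "B \<subseteq> U" using U(1) by (rule opn_basics)
    then have "B \<subseteq> \<Union>A" using U(2) by auto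
    then show "\<exists>B\<in>basics. \<phi> \<in> B \<and> B \<subseteq> \<Union>A" using B by auto
  qed
qed

lemma coz_Int: "coz g \<inter> coz h = coz (inf_class.inf g h)"
  by (auto simp: coz_def spectrum_inf)

lemma con_Int: "con g \<inter> con h = con (sup_class.sup g h)"
  by (auto simp: con_def spectrum_sup)

text \<open>Two coz or two con sets meet in a set of the same kind; only the mixed case needs an
  idea. For 0 < e < \<phi> g take k to be the positive part of t (g/e) - h. The truncated element is
  real valued, so the difference is defined everywhere, and at \<phi> it is 1 - \<phi> h > 0. Where
  k > 0, h lies below t (g/e) \<le> 1, and t (g/e) > h \<ge> 0 forces g > 0.\<close>

lemma coz_con_Int:
  assumes g: "0 \<le> g" and h: "0 \<le> h" and \<phi>: "\<phi> \<in> coz g \<inter> con h"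
  obtains k where "0 \<le> k" "\<phi> \<in> coz k" "coz k \<subseteq> coz g \<inter> con h"
proof -
  have \<phi>X: "\<phi> \<in> X" and \<phi>g: "0 < \<phi> g" and \<phi>h: "\<phi> h < 1" using \<phi> by (auto simp: coz_def con_def)
  obtain e where e: "ereal 0 < ereal e" "ereal e < \<phi> g" using ereal_dense2[of "ereal 0" "\<phi> g"] \<phi>g
    by (auto simp: zero_ereal_def)
  let ?g = "(1 / e) *\<^sub>R g"
  have g': "0 \<le> ?g" using g e by (intro scaleR_nonneg_nonneg) auto
  have "1 < \<phi> ?g"
    using e \<phi>X by (cases "\<phi> g") (auto simp: spectrum_scaleR one_ereal_def field_simps)
  then have \<phi>t: "\<phi> (t ?g) = ereal 1"
    using spectrum_trunc[OF \<phi>X g'] min.absorb2[of 1 "\<phi> ?g"] by (simp add: one_ereal_def[symmetric])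
  let ?k = "pos (t ?g - h)"
  have diff: "\<psi> (t ?g - h) = \<psi> (t ?g) + \<psi> (- h)" if \<psi>: "\<psi> \<in> X" for \<psi>
  proof -
    obtain b where "\<psi> (t ?g) = ereal b" using spectrum_trunc_real[OF \<psi> g'] by blast
    then show ?thesis using spectrum_add[OF \<psi>, of "t ?g" b "- h"] by simp
  qed
  have "0 < \<phi> (t ?g - h)"
    using \<phi>h spectrum_nonneg[OF \<phi>X h] unfolding diff[OF \<phi>X] \<phi>t
    by (cases "\<phi> h") (auto simp: spectrum_uminus[OF \<phi>X] one_ereal_def)
  then have "\<phi> \<in> coz ?k" using \<phi>X by (simp add: coz_def spectrum_pos)
  moreover have "coz ?k \<subseteq> coz g \<inter> con h"
  proof
    fix \<psi> assume "\<psi> \<in> coz ?k"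
    then have \<psi>: "\<psi> \<in> X" "0 < \<psi> (t ?g - h)" by (auto simp: coz_def spectrum_pos less_max_iff_disj)
    obtain b where b: "\<psi> (t ?g) = ereal b" "0 \<le> b" "b \<le> 1" "ereal b = min (\<psi> ?g) 1"
      using spectrum_trunc_real[OF \<psi>(1) g'] .
    have "0 < ereal b + - \<psi> h"
      using \<psi>(2) by (simp only: diff[OF \<psi>(1)] b(1) spectrum_uminus[OF \<psi>(1)])
    then have lt: "\<psi> h < ereal b" by (cases "\<psi> h") auto
    then have "\<psi> h < 1" using b by (metis ereal_less_eq(3) less_le_trans one_ereal_def)
    moreover have "0 < ereal b" using lt spectrum_nonneg[OF \<psi>(1) h] by (rule le_less_trans[rotated])
    then have "0 < \<psi> ?g" using b(4) by simp
    then have "0 < \<psi> g" using \<psi>(1) e by (simp add: spectrum_scaleR ereal_zero_less_0_iff)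
    ultimately show "\<psi> \<in> coz g \<inter> con h" using \<psi> by (simp add: coz_def con_def)
  qed
  ultimately show ?thesis using that[of ?k] by simp
qed

lemma Int_opn:
  assumes "U \<in> opn" "V \<in> opn"
  shows "U \<inter> V \<in> opn"
proof -
  have "\<exists>B\<in>basics. \<phi> \<in> B \<and> B \<subseteq> B1 \<inter> B2"
    if B: "B1 \<in> basics" "B2 \<in> basics" "\<phi> \<in> B1 \<inter> B2" for B1 B2 \<phi>
  proof -
    from B obtain g h where gh: "0 \<le> g" "0 \<le> h" "B1 = coz g \<or> B1 = con g" "B2 = coz h \<or> B2 = con h"
      by (auto simp: basics_def)
    then have nn: "0 \<le> inf_class.inf g h" "0 \<le> sup_class.sup g h" by (auto intro: le_supI1)
    from gh consider "B1 = coz g" "B2 = coz h" | "B1 = coz g" "B2 = con h"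
      | "B1 = con g" "B2 = coz h" | "B1 = con g" "B2 = con h" by blast
    then show ?thesis
    proof cases
      case 1
      then show ?thesis using B nn by (intro bexI[of _ "coz (inf_class.inf g h)"]) (auto simp: coz_Int basics_def)
    next
      case 2
      then have "\<phi> \<in> coz g \<inter> con h" using B(3) by simp
      then obtain k where "0 \<le> k" "\<phi> \<in> coz k" "coz k \<subseteq> coz g \<inter> con h"
        using coz_con_Int[OF gh(1,2)] by blast
      then have "0 \<le> k" "\<phi> \<in> coz k" "coz k \<subseteq> B1 \<inter> B2" using 2 by simp_all
      then show ?thesis by (auto simp: basics_def)
    next
      case 3
      then have "\<phi> \<in> coz h \<inter> con g" using B(3) by simp
      then obtain k where "0 \<le> k" "\<phi> \<in> coz k" "coz k \<subseteq> coz h \<inter> con g"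
        using coz_con_Int[OF gh(2,1)] by blast
      moreover have "B1 \<inter> B2 = coz h \<inter> con g" using 3 by auto
      ultimately have "0 \<le> k" "\<phi> \<in> coz k" "coz k \<subseteq> B1 \<inter> B2" by simp_all
      then show ?thesis by (auto simp: basics_def)
    next
      case 4
      then show ?thesis using B nn by (intro bexI[of _ "con (sup_class.sup g h)"]) (auto simp: con_Int basics_def)
    qed
  qed
  note * = this
  show ?thesis
  proof (rule opnI)
    show "U \<inter> V \<subseteq> X" using opnD[OF assms(1)] by auto
    fix \<phi> assume \<phi>: "\<phi> \<in> U \<inter> V"
    then obtain B1 where B1: "B1 \<in> basics" "\<phi> \<in> B1" "B1 \<subseteq> U" using opn_basics[OF assms(1)] by auto
    obtain B2 where B2: "B2 \<in> basics" "\<phi> \<in> B2" "B2 \<subseteq> V" using opn_basics[OF assms(2)] \<phi> by auto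
    obtain B where "B \<in> basics" "\<phi> \<in> B" "B \<subseteq> B1 \<inter> B2" using *[OF B1(1) B2(1), of \<phi>] B1(2) B2(2) by blast
    then show "\<exists>B\<in>basics. \<phi> \<in> B \<and> B \<subseteq> U \<inter> V" using B1(3) B2(3) by (intro bexI[of _ B]) auto
  qed
qed

lemma con_zero: "con 0 = X"
  by (auto simp: con_def spectrum_zero)

lemma top_opn: "X \<in> opn"
  using con_opn[of 0] by (simp add: con_zero)

lemma empty_opn: "{} \<in> opn"
  by (simp add: opn_def)

lemma ev_greaterThan: "ev g {ereal a<..} \<in> opn"
proof -
  consider "a < 0" | "a = 0" | "0 < a" by linarith
  then show ?thesis
  proof cases
    case 1
    define b where "b = - a"
    have b: "0 < b" "a = - b" using 1 by (auto simp: b_def)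
    let ?k = "(1 / b) *\<^sub>R pos (- g)"
    have "\<phi> ?k < 1 \<longleftrightarrow> ereal a < \<phi> g" if "\<phi> \<in> X" for \<phi>
      using b that by (cases "\<phi> g") (auto simp: spectrum_scaleR spectrum_pos spectrum_uminus
          one_ereal_def zero_ereal_def max_def field_simps)
    then have "ev g {ereal a<..} = con ?k" by (auto simp: ev_def con_def)
    moreover have "0 \<le> ?k" using b by (intro scaleR_nonneg_nonneg) auto
    ultimately show ?thesis using con_opn by simp
  next
    case 2
    have "ev g {ereal a<..} = coz (pos g)"
      using 2 by (auto simp: ev_def coz_def spectrum_pos zero_ereal_def[symmetric] less_max_iff_disj)
    then show ?thesis using coz_opn by simp
  next
    case 3
    let ?k = "(1 / a) *\<^sub>R pos g"
    have k: "0 \<le> ?k" using 3 by (intro scaleR_nonneg_nonneg) auto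
    have "1 < \<phi> ?k \<longleftrightarrow> ereal a < \<phi> g" if "\<phi> \<in> X" for \<phi>
      using 3 that by (cases "\<phi> g") (auto simp: spectrum_scaleR spectrum_pos
          one_ereal_def zero_ereal_def max_def field_simps)
    then have "ev g {ereal a<..} = coz (?k - t ?k)"
      using k by (auto simp: ev_def coz_def spectrum_sub_trunc)
    then show ?thesis using coz_opn trunc_le[OF k] by simp
  qed
qed

lemma ev_uminus: "ev (- g) U = {\<phi>\<in>X. - \<phi> g \<in> U}"
  unfolding ev_def using spectrum_uminus by (intro Collect_cong conj_cong) simp_all

lemma ev_Int: "ev g (U \<inter> V) = ev g U \<inter> ev g V"
  by (auto simp: ev_def)

lemma ev_Union: "ev g (\<Union>A) = \<Union>(ev g ` A)"
  by (auto simp: ev_def)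

lemma ev_UNIV: "ev g UNIV = X"
  by (auto simp: ev_def)

lemma ev_opn:
  assumes "open U"
  shows "ev g U \<in> opn"
proof -
  have up: "ev h {a<..} \<in> opn" for h a
  proof (cases a)
    case MInf
    have "{-\<infinity><..} = \<Union>(range (\<lambda>a. {ereal a<..}))"
    proof (rule Set.set_eqI)
      fix x :: ereal
      show "x \<in> {-\<infinity><..} \<longleftrightarrow> x \<in> \<Union>(range (\<lambda>a. {ereal a<..}))"
        using ereal_dense2[of "-\<infinity>" x] by (auto intro: less_trans[of "-\<infinity>" "ereal _"])
    qed
    then have "ev h {a<..} = \<Union>(ev h ` range (\<lambda>a. {ereal a<..}))" unfolding MInf by (simp only: ev_Union)
    then show ?thesis using ev_greaterThan by (auto intro!: Union_opn)
  next
    case PInf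
    then have "ev h {a<..} = {}" by (auto simp: ev_def)
    then show ?thesis by (simp add: empty_opn)
  qed (simp add: ev_greaterThan)
  have down: "ev g {..<a} \<in> opn" for a
  proof -
    have "ev g {..<a} = ev (- g) {- a<..}" unfolding ev_uminus unfolding ev_def by simp
    then show ?thesis using up by simp
  qed
  have "generate_topology (range (\<lambda>a. {..<a}) \<union> range (\<lambda>a. {a<..})) U"
    using assms by (simp add: open_generated_order)
  then show ?thesis
  proof induction
    case UNIV then show ?case by (simp add: ev_UNIV top_opn)
  next
    case (Int a b) then show ?case by (simp add: ev_Int Int_opn)
  next
    case (UN K) then show ?case unfolding ev_Union by (intro Union_opn) auto
  next
    case (Basis s) then show ?case using up down by auto
  qed
qed

end

section \<open>Existence of the representation\<close>

text \<open>Cozero elements are defined through the frame of reals without a point; this transfers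
  them to the pointed version.\<close>

lemma frame_hom_opens_iff: "frame_hom (opens :: 'x::topological_space set gorder) M f \<longleftrightarrow> frame_hom (opens_at p) M f"
proof -
  note * = set_frame[of "opens :: 'x set gorder" "{U. open U}" UNIV]
  have o [simp]: "carrier (opens :: 'x set gorder) = {U. open U}" by (simp add: opens_def)
  have "\<top>\<^bsub>opens\<^esub> = (UNIV :: 'x set)" by (rule *(5)) (auto simp: opens_def)
  moreover have "\<Squnion>\<^bsub>opens\<^esub>A = \<Union>A" if "\<forall>U\<in>A. open U" for A :: "'x set set"
    by (rule *(2)) (use that in \<open>auto simp: opens_def\<close>)
  moreover have "U \<sqinter>\<^bsub>opens\<^esub> V = U \<inter> V" if "open U" "open V" for U V :: "'x set"
    by (rule *(3)) (use that in \<open>auto simp: opens_def\<close>)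
  ultimately show ?thesis
    unfolding frame_hom_def by (auto simp: top_opens_at meet_opens_at sup_opens_at subset_iff)
qed

context truncation
begin

text \<open>A nonempty open set on which g is infinite contains a basic one. It is no con, as every
  con contains the zero map. On coz h, let k be the absolute value of g: then n t h \<le> k for all
  n, on coz h because k is infinite there and elsewhere because t h vanishes. The archimedean
  property gives t h = 0, so coz h is empty.\<close>

lemma dense_finite:
  assumes U: "U \<in> opn" "U \<inter> ev g {-\<infinity><..<\<infinity>} = {}"
  shows "U = {}"
proof (rule ccontr)
  assume "U \<noteq> {}"
  then obtain \<phi> where \<phi>: "\<phi> \<in> U" by auto
  obtain B where B: "B \<in> basics" "\<phi> \<in> B" "B \<subseteq> U" using opn_basics[OF U(1) \<phi>] .
  have inf: "\<psi> g = \<infinity> \<or> \<psi> g = -\<infinity>" if "\<psi> \<in> B" for \<psi>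
  proof -
    have "\<psi> \<in> U" using that B(3) by auto
    then have "\<psi> \<in> X" "\<psi> \<notin> ev g {-\<infinity><..<\<infinity>}" using U opnD by auto
    then show ?thesis by (cases "\<psi> g") (auto simp: ev_def)
  qed
  from B(1) consider h where "0 \<le> h" "B = coz h" | h where "0 \<le> h" "B = con h"
    by (auto simp: basics_def)
  then show False
  proof cases
    case 2
    then have "(\<lambda>_. 0) \<in> B" using zero_in_spectrum by (simp add: con_def)
    then show False using inf by force
  next
    case (1 h)
    define k where "k = sup_class.sup (pos g) (pos (- g))"
    have k: "0 \<le> k" by (auto simp: k_def intro: le_supI1)
    have \<psi>k: "\<psi> k = max (max (\<psi> g) 0) (max (- \<psi> g) 0)" if "\<psi> \<in> X" for \<psi>
      using that by (simp add: k_def spectrum_sup spectrum_zero spectrum_uminus)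
    have "real n *\<^sub>R t h \<le> k" for n
    proof (rule ccontr)
      assume "\<not> real n *\<^sub>R t h \<le> k"
      then have "pos (real n *\<^sub>R t h - k) \<noteq> 0"
        by (metis diff_le_0_iff_le sup_ge1)
      then obtain \<psi> where \<psi>: "\<psi> \<in> X" "0 < \<psi> (pos (real n *\<^sub>R t h - k))"
        using spectrum_separates by (metis sup_ge2)
      then have pos: "0 < \<psi> (real n *\<^sub>R t h - k)" by (simp add: spectrum_pos less_max_iff_disj)
      obtain b where b: "\<psi> (t h) = ereal b" "0 \<le> b" "b \<le> 1" "ereal b = min (\<psi> h) 1"
        using spectrum_trunc_real[OF \<psi>(1) 1(1)] by blast
      have "\<psi> (real n *\<^sub>R t h) = ereal (real n * b)"
        using \<psi>(1) b(1) by (cases "n = 0") (simp_all add: spectrum_zero spectrum_scaleR zero_ereal_def)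
      then have "\<psi> (real n *\<^sub>R t h + - k) = ereal (real n * b) + \<psi> (- k)"
        by (rule spectrum_add[OF \<psi>(1)])
      then have lt: "0 < ereal (real n * b) + - \<psi> k" using pos \<psi>(1) by (simp add: spectrum_uminus)
      show False
      proof (cases "0 < \<psi> h")
        case True
        then have "\<psi> \<in> B" using 1 \<psi>(1) by (simp add: coz_def)
        then have "\<psi> k = \<infinity>" using inf[of \<psi>] unfolding \<psi>k[OF \<psi>(1)] by (elim disjE[OF inf]) simp_all
        then show False using lt by simp
      next
        case False
        then have "\<psi> h = 0" using spectrum_nonneg[OF \<psi>(1) 1(1)] by auto
        then have "b = 0" using b(4) by (simp add: min_def zero_ereal_def)
        then show False using lt spectrum_nonneg[OF \<psi>(1) k] by (cases "\<psi> k") (auto simp: zero_ereal_def)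
      qed
    qed
    then have "t h = 0" by (intro archimedean[OF trunc_nonneg[OF 1(1)] k])
    then have "h = 0" using trunc_eq_0 1(1) by blast
    then show False using B(2) 1(2) spectrum_zero[of \<phi>] by (auto simp: coz_def)
  qed
qed

sublocale sp: dense_open_family opn X "\<lambda>g. ev g {-\<infinity><..<\<infinity>}" "\<lambda>_. 0"
proof
  show "(\<lambda>_. 0) \<in> ev i {-\<infinity><..<\<infinity>}" for i using zero_in_spectrum by (simp add: ev_def)
qed (fact Union_opn Int_opn top_opn opnD zero_in_spectrum dense_finite
  | rule ev_opn, simp)+

lemma basics_relatively_open: "B \<in> basics \<Longrightarrow> \<exists>W. open W \<and> B = X \<inter> W"
proof -
  assume "B \<in> basics"
  then consider g where "B = coz g" | g where "B = con g" by (auto simp: basics_def)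
  then show ?thesis
  proof cases
    case 1
    then have "B = X \<inter> {\<phi>. 0 < \<phi> g}" by (auto simp: coz_def)
    moreover have "open {\<phi>::'a \<Rightarrow> ereal. 0 < \<phi> g}"
      by (intro open_Collect_less continuous_on_const continuous_on_eval)
    ultimately show ?thesis by blast
  next
    case 2
    then have "B = X \<inter> {\<phi>. \<phi> g < 1}" by (auto simp: con_def)
    moreover have "open {\<phi>::'a \<Rightarrow> ereal. \<phi> g < 1}"
      by (intro open_Collect_less continuous_on_const continuous_on_eval)
    ultimately show ?thesis by blast
  qed
qed

text \<open>Compactness of X concerns open sets of the product space. They enter as those whose
  trace on X lies inside a member of the given cover, and each of the finitely many selected is then
  exchanged for such a member.\<close>

lemma compact_frame_spectrum: "compact_frame sp.M"
  unfolding compact_frame_def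
proof (intro allI impI)
  fix A assume "A \<subseteq> carrier sp.M" "\<Squnion>\<^bsub>sp.M\<^esub>A = \<top>\<^bsub>sp.M\<^esub>"
  then have A: "A \<subseteq> opn" "\<Union>A = X" by (simp_all add: sp.sup_M sp.top_M)
  let ?C = "{W. open W \<and> (\<exists>U\<in>A. X \<inter> W \<subseteq> U)}"
  have "X \<subseteq> \<Union>?C"
  proof
    fix \<phi> assume \<phi>: "\<phi> \<in> X"
    then obtain U where U: "U \<in> A" "\<phi> \<in> U" using A(2) by auto
    then have "U \<in> opn" using A(1) by auto
    then obtain B where B: "B \<in> basics" "\<phi> \<in> B" "B \<subseteq> U" using U(2) by (rule opn_basics)
    obtain W where W: "open W" "B = X \<inter> W" using basics_relatively_open[OF B(1)] by auto
    then have "W \<in> ?C" using B(3) U(1) by auto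
    then show "\<phi> \<in> \<Union>?C" using W(2) B(2) by auto
  qed
  then obtain D where D: "D \<subseteq> ?C" "finite D" "X \<subseteq> \<Union>D"
    by (rule compactE[OF compact_spectrum[of t]]) blast+
  then have "\<forall>W\<in>D. \<exists>U\<in>A. X \<inter> W \<subseteq> U" by auto
  then obtain f where f: "\<forall>W\<in>D. f W \<in> A \<and> X \<inter> W \<subseteq> f W" by (auto simp: Bex_def dest: bchoice)
  have fA: "f ` D \<subseteq> A" using f by auto
  have "\<Union>(f ` D) = X"
  proof
    show "\<Union>(f ` D) \<subseteq> X" using fA A(2) by auto
    show "X \<subseteq> \<Union>(f ` D)"
    proof
      fix \<phi> assume "\<phi> \<in> X"
      then obtain W where "W \<in> D" "\<phi> \<in> X \<inter> W" using D(3) by auto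
      then show "\<phi> \<in> \<Union>(f ` D)" using f by auto
    qed
  qed
  moreover have "f ` D \<subseteq> opn" using fA A(1) by (rule subset_trans)
  ultimately have "\<Squnion>\<^bsub>sp.M\<^esub>(f ` D) = \<top>\<^bsub>sp.M\<^esub>" by (simp add: sp.sup_M sp.top_M)
  then show "\<exists>F\<subseteq>A. finite F \<and> \<Squnion>\<^bsub>sp.M\<^esub>F = \<top>\<^bsub>sp.M\<^esub>" using fA D(2) by (intro exI[of _ "f ` D"]) simp
qed

text \<open>A real level strictly between the value of g at \<phi> and the bound defining the basic
  set splits X: the ray on the side of \<phi> is the neighbourhood, and the opposite ray witnesses
  that it is rather below.\<close>

lemma regular_frame_spectrum: "regular_frame sp.M"
  unfolding regular_frame_def
proof
  interpret fr: frame sp.M by (rule sp.frame_M)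
  fix U assume "U \<in> carrier sp.M"
  then have U: "U \<in> opn" by simp
  let ?R = "{V \<in> carrier sp.M. rather_below sp.M V U}"
  have "\<Union>?R = U"
  proof
    show "\<Union>?R \<subseteq> U" using U fr.rather_below_le[of _ U] by auto
    show "U \<subseteq> \<Union>?R"
    proof
      fix \<phi> assume \<phi>: "\<phi> \<in> U"
      obtain B where B: "B \<in> basics" "\<phi> \<in> B" "B \<subseteq> U" using opn_basics[OF U \<phi>] .
      have I: "\<phi> \<in> \<Union>?R"
        if VW: "V \<in> opn" "W \<in> opn" "W \<inter> V = {}" "X \<subseteq> W \<union> B" "\<phi> \<in> V" for V W
      proof -
        have "W \<union> U = X" using VW(2,4) B(3) opnD[OF U] opnD[OF VW(2)] by auto
        then have "rather_below sp.M V U"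
          using VW U by (intro fr.rather_belowI[of _ _ W]) (simp_all add: sp.meet_M sp.join_M sp.top_M sp.bot_M)
        then show ?thesis using VW by auto
      qed
      from B(1) consider g where "B = coz g" | g where "B = con g" by (auto simp: basics_def)
      then show "\<phi> \<in> \<Union>?R"
      proof cases
        case (1 g)
        then have "ereal 0 < \<phi> g" using B(2) by (simp add: coz_def zero_ereal_def[symmetric])
        then obtain e where e: "ereal 0 < ereal e" "ereal e < \<phi> g" using ereal_dense2 by blast
        show ?thesis
        proof (rule I[of "ev g {ereal e<..}" "ev g {..<ereal e}"])
          show "X \<subseteq> ev g {..<ereal e} \<union> B"
          proof
            fix \<psi> assume "\<psi> \<in> X"
            then show "\<psi> \<in> ev g {..<ereal e} \<union> B"
              using 1 e(1) by (cases "\<psi> g") (auto simp: ev_def coz_def)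
          qed
          show "\<phi> \<in> ev g {ereal e<..}" using e(2) \<phi> opnD[OF U] by (auto simp: ev_def)
        qed (simp add: ev_opn, simp add: ev_opn, auto simp: ev_def)
      next
        case (2 g)
        then have "\<phi> g < ereal 1" using B(2) by (simp add: con_def one_ereal_def[symmetric])
        then obtain e where e: "\<phi> g < ereal e" "ereal e < ereal 1" using ereal_dense2 by blast
        show ?thesis
        proof (rule I[of "ev g {..<ereal e}" "ev g {ereal e<..}"])
          show "X \<subseteq> ev g {ereal e<..} \<union> B"
          proof
            fix \<psi> assume "\<psi> \<in> X"
            then show "\<psi> \<in> ev g {ereal e<..} \<union> B"
              using 2 e(2) by (cases "\<psi> g") (auto simp: ev_def con_def one_ereal_def)
          qed
          show "\<phi> \<in> ev g {..<ereal e}" using e(1) \<phi> opnD[OF U] by (auto simp: ev_def)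
        qed (simp add: ev_opn, simp add: ev_opn, auto simp: ev_def)
      qed
    qed
  qed
  moreover have "\<Squnion>\<^bsub>sp.M\<^esub>?R = \<Union>?R" by (rule sp.sup_M) auto
  ultimately show "U = \<Squnion>\<^bsub>sp.M\<^esub>?R" by (simp only:)
qed

lemma ev_hom: "frame_hom (opens_at p) sp.M (ev g)"
  by (rule frame_hom_opensI[OF sp.frame_M])
    (auto simp: ev_opn sp.top_M ev_UNIV sp.meet_M ev_Int sp.sup_M ev_Union image_subset_iff)

text \<open>The function 1/(\<bar>x\<bar> + 1) is real valued and continuous on the extended line
  and vanishes exactly at the two infinite points.\<close>

lemma cozero_finite: "cozero_element sp.M (ev g {-\<infinity><..<\<infinity>})"
proof -
  define w where "w x = real_of_ereal (inverse (\<bar>x\<bar> + 1))" for x :: ereal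
  have 1: "continuous_on UNIV (\<lambda>x::ereal. \<bar>x\<bar> + 1)"
    unfolding continuous_on_def
  proof
    fix x :: ereal
    have "((\<lambda>x. \<bar>x\<bar>) \<longlongrightarrow> \<bar>x\<bar>) (at x)"
      using continuous_ereal_abs by (auto simp: continuous_on_def)
    then show "((\<lambda>x. \<bar>x\<bar> + 1) \<longlongrightarrow> \<bar>x\<bar> + 1) (at x within UNIV)"
      by (intro tendsto_cadd_ereal) auto
  qed
  have 2: "continuous_on UNIV (\<lambda>x::ereal. inverse (\<bar>x\<bar> + 1))"
    by (rule continuous_on_compose2[OF continuous_on_inverse_ereal 1]) auto
  have fin: "inverse (\<bar>x\<bar> + 1) \<in> UNIV - {\<infinity>, -\<infinity>}" for x :: ereal
    by (cases x) auto
  have w: "continuous_on UNIV w"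
    unfolding w_def by (rule continuous_on_compose2[OF continuous_on_real 2]) (rule image_subsetI, rule fin)
  have w0: "w x \<noteq> 0 \<longleftrightarrow> x \<in> {-\<infinity><..<\<infinity>}" for x by (cases x) (auto simp: w_def)
  have op: "open (w -` V)" if "open V" for V using w that by (simp add: continuous_on_open_vimage)
  have "frame_hom O_real O_ereal (\<lambda>V. w -` V)"
  proof (rule frame_hom_opensI[OF frame_opens_at])
    fix A :: "real set set" assume "\<forall>U\<in>A. open U"
    then have "\<Squnion>\<^bsub>O_ereal\<^esub>((\<lambda>V. w -` V) ` A) = \<Union>((\<lambda>V. w -` V) ` A)"
      by (intro sup_opens_at ballI) (elim imageE, simp add: op)
    then show "w -` \<Union>A = \<Squnion>\<^bsub>O_ereal\<^esub>((\<lambda>V. w -` V) ` A)" by (simp only: vimage_Union)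
  qed (simp_all add: op top_opens_at meet_opens_at)
  then have "frame_hom O_real sp.M (\<lambda>V. ev g (w -` V))"
    by (rule frame_hom_compose[OF _ ev_hom])
  moreover have "w -` (UNIV - {0}) = {-\<infinity><..<\<infinity>}"
    by (rule Set.set_eqI) (simp only: vimage_eq Diff_iff UNIV_I singleton_iff simp_thms w0)
  ultimately show ?thesis
    unfolding cozero_element_def frame_hom_opens_iff[where p=0]
    by (intro exI[of _ "\<lambda>V. ev g (w -` V)"]) simp
qed

lemma compactification_spectrum: "compactification sp.quotient"
  by (rule sp.compactification_quotient[OF compact_frame_spectrum regular_frame_spectrum])

sublocale spc: frame_compactification sp.quotient
  by unfold_locales (rule compactification_spectrum)

lemma suitable_spectrum: "suitable sp.quotient"
  by (rule sp.suitable_quotient[OF cozero_finite])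

subsection \<open>The embedding\<close>

text \<open>The image of V under \<open>ereal\<close> leaves out the infinite values; applying
  \<open>sp.j\<close> gives a member of S, for which those values do not count.\<close>

definition \<mu> where "\<mu> g = restrict (\<lambda>V. sp.j (ev g (ereal ` V))) {V. open V}"

lemma \<mu>_eq: "open V \<Longrightarrow> \<mu> g V = sp.j (ev g (ereal ` V))"
  by (simp add: \<mu>_def)

lemma \<mu>_in_S: "open V \<Longrightarrow> \<mu> g V \<in> sp.S"
  by (simp add: \<mu>_eq)

lemma \<mu>_ext: "\<mu> g \<in> extensional {V. open V}"
  by (simp add: \<mu>_def)

lemma ev_ereal_opn: "open V \<Longrightarrow> ev g (ereal ` V) \<in> opn"
  by (intro ev_opn open_ereal)

lemma \<mu>_hom: "frame_hom O_real sp.L (\<mu> g)"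
proof -
  have "frame_hom O_real sp.L (\<lambda>V. sp.j (ev g (ereal ` V)))"
  proof (rule frame_hom_opensI[OF sp.frame_L])
    have "ereal ` UNIV = {-\<infinity><..<\<infinity>}"
    proof (rule Set.set_eqI)
      fix x show "x \<in> ereal ` UNIV \<longleftrightarrow> x \<in> {-\<infinity><..<\<infinity>}" by (cases x) auto
    qed
    then show "sp.j (ev g (ereal ` UNIV)) = \<top>\<^bsub>sp.L\<^esub>" by (simp only: sp.j_Y sp.top_L)
    fix U V :: "real set" assume UV: "open U" "open V"
    have "ereal ` (U \<inter> V) = ereal ` U \<inter> ereal ` V" by auto
    then show "sp.j (ev g (ereal ` (U \<inter> V))) = sp.j (ev g (ereal ` U)) \<sqinter>\<^bsub>sp.L\<^esub> sp.j (ev g (ereal ` V))"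
      using UV by (simp add: ev_Int sp.j_Int ev_ereal_opn sp.meet_L)
  next
    fix A :: "real set set" assume A: "\<forall>U\<in>A. open U"
    have "ev g (ereal ` \<Union>A) = \<Union>((\<lambda>V. ev g (ereal ` V)) ` A)" by (auto simp: ev_def)
    moreover have "(\<lambda>V. ev g (ereal ` V)) ` A \<subseteq> opn" using A ev_ereal_opn by auto
    ultimately have "sp.j (ev g (ereal ` \<Union>A)) = sp.j (\<Union>(sp.j ` (\<lambda>V. ev g (ereal ` V)) ` A))"
      using sp.j_Union by simp
    then show "sp.j (ev g (ereal ` \<Union>A)) = \<Squnion>\<^bsub>sp.L\<^esub>((\<lambda>V. sp.j (ev g (ereal ` V))) ` A)"
      by (subst sp.sup_L) (auto simp: image_image)
  qed simp
  then show ?thesis using frame_hom_restrict[OF frame_opens_at] by (fastforce simp: \<mu>_def)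
qed

lemma base_point_ev: "(\<lambda>_. 0) \<in> ev g U \<longleftrightarrow> 0 \<in> U"
  using zero_in_spectrum by (simp add: ev_def)

lemma \<mu>_in_R0: "\<mu> g \<in> R0 sp.L"
proof -
  have "0 \<in> ereal ` V \<longleftrightarrow> 0 \<in> V" for V by (auto simp: zero_ereal_def)
  then have "(\<lambda>_. 0) \<in> \<mu> g V \<longleftrightarrow> 0 \<in> V" if "open V" for V
    using that by (simp add: \<mu>_eq sp.base_point_j ev_ereal_opn base_point_ev)
  then show ?thesis using \<mu>_hom[of g] by (simp add: R0_def pframe_homs_def \<mu>_ext)
qed

lemma \<mu>_opens_morphism: "opens_morphism sp.L 0 (\<mu> g)"
  using sp.frame_L \<mu>_hom by (simp add: opens_morphism_def opens_morphism_axioms_def)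

text \<open>U and its finite part differ only at infinite values of g, so \<open>sp.j\<close>
  identifies their preimages.\<close>

lemma extends_\<mu>: "extends sp.quotient (restrict (ev g) {U. open U}) (\<mu> g)"
proof (rule spc.extendsI)
  show "frame_hom O_ereal (src sp.quotient) (ev g)" using ev_hom by (simp add: sp.quotient_def)
  show "point (src sp.quotient) (ev g U) \<longleftrightarrow> 0 \<in> U" for U
    by (simp add: sp.quotient_def base_point_ev)
  show "\<mu> g UNIV = \<top>\<^bsub>tgt sp.quotient\<^esub>"
    using \<mu>_hom[of g] by (simp add: sp.quotient_def frame_hom_def top_opens_at)
  fix U :: "ereal set" assume U: "open U"
  have "ev g U \<inter> ev g {-\<infinity><..<\<infinity>} = ev g (ereal ` ereal -` U) \<inter> ev g {-\<infinity><..<\<infinity>}"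
  proof (rule Set.set_eqI)
    fix \<phi> show "\<phi> \<in> ev g U \<inter> ev g {-\<infinity><..<\<infinity>} \<longleftrightarrow>
      \<phi> \<in> ev g (ereal ` ereal -` U) \<inter> ev g {-\<infinity><..<\<infinity>}"
      by (cases "\<phi> g") (auto simp: ev_def)
  qed
  then have "sp.j (ev g U) = sp.j (ev g (ereal ` ereal -` U))"
    by (intro sp.j_cong[OF ev_opn[OF U] ev_ereal_opn[OF open_ereal_vimage[OF U]], of g g]) simp
  then show "arr sp.quotient (ev g U) = \<mu> g (ereal -` U)"
    using U by (simp add: \<mu>_eq open_ereal_vimage sp.quotient_def ev_opn)
qed

lemma extension_\<mu>: "open U \<Longrightarrow> extension sp.quotient (\<mu> g) U = ev g U"
  using spc.extension_eq[OF extends_\<mu>[of g]] by simp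

text \<open>The hypothesis speaks only of points where g is real. By \<open>sp.j_cong\<close>, used
  with the finite parts of g and k, the remaining points do not matter.\<close>

lemma lift1_\<mu>:
  assumes w: "continuous_on UNIV w"
    and k: "\<And>\<phi> a. \<phi> \<in> X \<Longrightarrow> \<phi> g = ereal a \<Longrightarrow> \<phi> k = ereal (w a)"
  shows "R0_lift1 sp.L w (\<mu> g) = \<mu> k"
proof (rule extensionalityI[OF R0_lift1_extensional \<mu>_ext])
  fix V :: "real set" assume "V \<in> {U. open U}"
  then have V: "open V" "open (w -` V)" using w by (auto simp: continuous_on_open_vimage)
  have "ev g (ereal ` (w -` V)) \<inter> ev g {-\<infinity><..<\<infinity>} \<inter> ev k {-\<infinity><..<\<infinity>} =
      ev k (ereal ` V) \<inter> ev g {-\<infinity><..<\<infinity>} \<inter> ev k {-\<infinity><..<\<infinity>}"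
  proof (rule Set.set_eqI)
    fix \<phi> show "\<phi> \<in> ev g (ereal ` (w -` V)) \<inter> ev g {-\<infinity><..<\<infinity>} \<inter> ev k {-\<infinity><..<\<infinity>} \<longleftrightarrow>
        \<phi> \<in> ev k (ereal ` V) \<inter> ev g {-\<infinity><..<\<infinity>} \<inter> ev k {-\<infinity><..<\<infinity>}"
      using k[of \<phi>] by (cases "\<phi> g") (auto simp: ev_def)
  qed
  then have "sp.j (ev g (ereal ` (w -` V))) = sp.j (ev k (ereal ` V))"
    by (rule sp.j_cong[OF ev_ereal_opn[OF V(2)] ev_ereal_opn[OF V(1)]])
  then show "R0_lift1 sp.L w (\<mu> g) V = \<mu> k V"
    using V by (simp add: \<mu>_eq R0_lift1_eq[OF \<mu>_opens_morphism w V(1)])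
qed

lemma lift2_\<mu>:
  assumes w: "continuous_on UNIV (\<lambda>(x, y). w x y)"
    and k: "\<And>\<phi> a b. \<phi> \<in> X \<Longrightarrow> \<phi> g = ereal a \<Longrightarrow> \<phi> h = ereal b \<Longrightarrow> \<phi> k = ereal (w a b)"
  shows "R0_lift2 sp.L w (\<mu> g) (\<mu> h) = \<mu> k"
proof (rule extensionalityI[OF _ \<mu>_ext])
  show "R0_lift2 sp.L w (\<mu> g) (\<mu> h) \<in> extensional {V. open V}" by (simp add: R0_lift2_def)
  interpret L: frame sp.L by (rule sp.frame_L)
  interpret g: opens_morphism sp.L 0 "\<mu> g" by (rule \<mu>_opens_morphism)
  interpret h: opens_morphism sp.L 0 "\<mu> h" by (rule \<mu>_opens_morphism)
  fix V :: "real set" assume "V \<in> {U. open U}"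
  then have V: "open V" by simp
  let ?A = "{\<mu> g U \<sqinter>\<^bsub>sp.L\<^esub> \<mu> h U' |U U'. open U \<and> open U' \<and> (\<lambda>(x, y). w x y) ` (U \<times> U') \<subseteq> V}"
  have box: "\<mu> g U \<sqinter>\<^bsub>sp.L\<^esub> \<mu> h U' = sp.j (ev g (ereal ` U) \<inter> ev h (ereal ` U'))" if "open U" "open U'" for U U'
    using that by (simp add: \<mu>_eq sp.meet_L sp.j_Int ev_ereal_opn)
  have "\<Squnion>\<^bsub>sp.L\<^esub>?A = \<mu> k V"
  proof (rule L.sup_eqI)
    show "a \<sqsubseteq>\<^bsub>sp.L\<^esub> \<mu> k V" if "a \<in> ?A" for a
    proof -
      from that obtain U U' where U: "open U" "open U'" "(\<lambda>(x, y). w x y) ` (U \<times> U') \<subseteq> V"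
        and "a = \<mu> g U \<sqinter>\<^bsub>sp.L\<^esub> \<mu> h U'" by blast
      then have a: "a = sp.j (ev g (ereal ` U) \<inter> ev h (ereal ` U'))" using box by simp
      have "\<phi> k \<in> ereal ` V"
        if "\<phi> \<in> X" "\<phi> g = ereal x" "\<phi> h = ereal y" "x \<in> U" "y \<in> U'" for \<phi> x y
        using that k[OF that(1-3)] U(3) by auto
      then have "ev g (ereal ` U) \<inter> ev h (ereal ` U') \<subseteq> ev k (ereal ` V)" by (auto simp: ev_def)
      then show ?thesis unfolding a using V by (simp add: \<mu>_eq sp.j_mono ev_ereal_opn)
    qed
    show "\<mu> k V \<sqsubseteq>\<^bsub>sp.L\<^esub> y" if y: "y \<in> carrier sp.L" and ub: "\<And>a. a \<in> ?A \<Longrightarrow> a \<sqsubseteq>\<^bsub>sp.L\<^esub> y" for y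
    proof -
      have yS: "y \<in> sp.S" using y by simp
      \<comment> \<open>At a point where g and h are both real, their pair of values lies in an open
        box inside the preimage of V, and the corresponding meet is one of those below y.\<close>
      have "ev k (ereal ` V) \<inter> ev g {-\<infinity><..<\<infinity>} \<inter> ev h {-\<infinity><..<\<infinity>} \<subseteq> y"
      proof
        fix \<phi> assume \<phi>: "\<phi> \<in> ev k (ereal ` V) \<inter> ev g {-\<infinity><..<\<infinity>} \<inter> ev h {-\<infinity><..<\<infinity>}"
        then have \<phi>X: "\<phi> \<in> X" and kV: "\<phi> k \<in> ereal ` V" by (auto simp: ev_def)
        obtain a where a: "\<phi> g = ereal a" using \<phi> by (cases "\<phi> g") (auto simp: ev_def)
        obtain b where b: "\<phi> h = ereal b" using \<phi> by (cases "\<phi> h") (auto simp: ev_def)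
        have "(a, b) \<in> (\<lambda>(x, y). w x y) -` V" using kV k[OF \<phi>X a b] by auto
        moreover have "open ((\<lambda>(x, y). w x y) -` V)"
          using w V by (simp add: continuous_on_open_vimage)
        ultimately obtain U U' where U: "open U" "open U'" "a \<in> U" "b \<in> U'"
            "U \<times> U' \<subseteq> (\<lambda>(x, y). w x y) -` V"
          by (elim open_prod_elim) auto
        have sub: "(\<lambda>(x, y). w x y) ` (U \<times> U') \<subseteq> V" using U(5) by auto
        have "\<mu> g U \<sqinter>\<^bsub>sp.L\<^esub> \<mu> h U' \<sqsubseteq>\<^bsub>sp.L\<^esub> y"
          by (rule ub, rule CollectI, intro exI conjI, rule refl) (fact U sub)+
        then have "sp.j (ev g (ereal ` U) \<inter> ev h (ereal ` U')) \<subseteq> y" using U by (simp add: box)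
        moreover have "ev g (ereal ` U) \<inter> ev h (ereal ` U') \<subseteq> sp.j (ev g (ereal ` U) \<inter> ev h (ereal ` U'))"
          using U by (intro sp.j_upper Int_opn ev_ereal_opn)
        moreover have "\<phi> \<in> ev g (ereal ` U) \<inter> ev h (ereal ` U')" using \<phi>X a b U by (auto simp: ev_def)
        ultimately show "\<phi> \<in> y" by (meson subsetD)
      qed
      \<comment> \<open>Membership of y in S removes first the restriction to h finite and then the
        one to g finite.\<close>
      then have "ev k (ereal ` V) \<inter> ev g {-\<infinity><..<\<infinity>} \<subseteq> y"
        by (rule sp.SD[OF yS Int_opn[OF ev_ereal_opn[OF V] sp.Y]])
      then have "ev k (ereal ` V) \<subseteq> y"
        by (rule sp.SD[OF yS ev_ereal_opn[OF V]])
      then show ?thesis using V yS by (simp add: \<mu>_eq sp.j_least)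
    qed
  qed (use V in \<open>auto simp: box \<mu>_in_S\<close>)
  then show "R0_lift2 sp.L w (\<mu> g) (\<mu> h) V = \<mu> k V" using V by (simp add: R0_lift2_def)
qed

lemma \<mu>_add: "R0_add sp.L (\<mu> g) (\<mu> h) = \<mu> (g + h)"
  by (rule lift2_\<mu>) (auto simp: case_prod_unfold spectrum_add intro!: continuous_intros)

lemma \<mu>_sup: "R0_sup sp.L (\<mu> g) (\<mu> h) = \<mu> (sup_class.sup g h)"
  by (rule lift2_\<mu>) (auto simp: case_prod_unfold spectrum_sup intro!: continuous_intros)

lemma \<mu>_inf: "R0_inf sp.L (\<mu> g) (\<mu> h) = \<mu> (inf_class.inf g h)"
  by (rule lift2_\<mu>) (auto simp: case_prod_unfold spectrum_inf intro!: continuous_intros)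

lemma \<mu>_scaleR: "R0_scale sp.L c (\<mu> g) = \<mu> (c *\<^sub>R g)"
proof (rule lift1_\<mu>)
  fix \<phi> a assume \<phi>: "\<phi> \<in> X" "\<phi> g = ereal a"
  consider "0 < c" | "c = 0" | "0 < - c" by linarith
  then show "\<phi> (c *\<^sub>R g) = ereal (c * a)"
  proof cases
    case 3
    have "c *\<^sub>R g = - ((- c) *\<^sub>R g)" by simp
    also have "\<phi> \<dots> = - (ereal (- c) * ereal a)"
      by (simp only: spectrum_uminus[OF \<phi>(1)] spectrum_scaleR[OF \<phi>(1) 3] \<phi>(2))
    finally show ?thesis by simp
  qed (use \<phi> in \<open>simp_all add: spectrum_scaleR spectrum_zero zero_ereal_def\<close>)
qed (intro continuous_intros)

lemma \<mu>_trunc: "0 \<le> g \<Longrightarrow> R0_trunc sp.L (\<mu> g) = \<mu> (t g)"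
  by (rule lift1_\<mu>) (auto simp: spectrum_trunc one_ereal_def intro!: continuous_intros)

text \<open>Closure is required under min x 1 for all elements, while t acts on positive ones only.
  The gap is bridged by writing min x 1 as the truncated positive part minus the negative
  part.\<close>

lemma \<mu>_trunc_general: "R0_trunc sp.L (\<mu> g) = \<mu> (t (pos g) - pos (- g))"
proof (rule lift1_\<mu>)
  fix \<phi> a assume \<phi>: "\<phi> \<in> X" "\<phi> g = ereal a"
  have 1: "\<phi> (t (pos g)) = ereal (min (max a 0) 1)"
    using \<phi> by (simp add: spectrum_trunc spectrum_pos one_ereal_def zero_ereal_def)
  have 2: "\<phi> (- pos (- g)) = ereal (- max (- a) 0)"
    using \<phi> by (simp add: spectrum_uminus spectrum_pos) (simp add: max_def zero_ereal_def)
  have "\<phi> (t (pos g) + - pos (- g)) = ereal (min (max a 0) 1 + - max (- a) 0)"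
    by (simp only: spectrum_add[OF \<phi>(1) 1] 2 plus_ereal.simps)
  then show "\<phi> (t (pos g) - pos (- g)) = ereal (min a 1)" by (simp add: min_def max_def split: if_splits)
qed (intro continuous_intros)

lemma R0_zero_\<mu>: "R0_zero sp.L = \<mu> 0"
proof (rule extensionalityI[OF _ \<mu>_ext])
  fix V :: "real set" assume "V \<in> {U. open U}"
  then have V: "open V" by simp
  have "ev 0 (ereal ` V) = (if 0 \<in> V then X else {})"
    by (auto simp: ev_def spectrum_zero zero_ereal_def)
  then show "R0_zero sp.L V = \<mu> 0 V"
    using V by (simp add: R0_zero_def \<mu>_eq sp.top_L sp.bot_L sp.j_eq sp.top_in_S sp.empty_in_S)
qed (simp add: R0_zero_def)

text \<open>A point where \<open>pos (g - h)\<close> is positive may make h infinite. Density of the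
  finite part of h moves it to a point with h real. There g and h have equal values, since the
  extensions of equal homomorphisms agree, and the difference vanishes.\<close>

lemma \<mu>_inj: "inj \<mu>"
proof (rule injI)
  have le: "g \<le> h" if eq: "\<mu> g = \<mu> h" for g h
  proof (rule ccontr)
    assume "\<not> g \<le> h"
    then have "pos (g - h) \<noteq> 0" by (metis diff_le_0_iff_le sup_ge1)
    then obtain \<phi> where "\<phi> \<in> X" "0 < \<phi> (pos (g - h))" using spectrum_separates by (metis sup_ge2)
    then have "\<phi> \<in> coz (pos (g - h))" by (simp add: coz_def)
    then have "coz (pos (g - h)) \<inter> ev h {-\<infinity><..<\<infinity>} \<noteq> {}"
      using dense_finite[OF coz_opn, of "pos (g - h)" h] by auto
    then obtain \<psi> where \<psi>: "\<psi> \<in> X" "0 < \<psi> (pos (g - h))" "\<psi> h \<in> {-\<infinity><..<\<infinity>}"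
      by (auto simp: coz_def ev_def)
    then obtain b where b: "\<psi> h = ereal b" by (cases "\<psi> h") auto
    have ev: "ev g U = ev h U" if "open U" for U using extension_\<mu>[OF that] eq by metis
    have "\<psi> g = \<psi> h"
    proof (rule antisym)
      show "\<psi> g \<le> \<psi> h" using ev[of "{\<psi> h<..}"] \<psi>(1) by (fastforce simp: ev_def)
      show "\<psi> h \<le> \<psi> g" using ev[of "{..<\<psi> h}"] \<psi>(1) by (fastforce simp: ev_def)
    qed
    then have "\<psi> (g + - h) = ereal b + - ereal b"
      using b spectrum_add[OF \<psi>(1), of g b "- h"] by (simp add: spectrum_uminus[OF \<psi>(1)])
    then show False using \<psi>(1,2) by (simp add: spectrum_pos)
  qed
  fix g h assume "\<mu> g = \<mu> h"
  then show "g = h" using le[of g h] le[of h g] by simp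
qed

lemma truncated_\<mu>: "0 \<le> g \<Longrightarrow> \<mu> (t g) \<in> truncated_elements sp.L (range \<mu>)"
  by (auto simp: truncated_elements_def R0_nonneg_def R0_zero_\<mu> \<mu>_sup sup_absorb1 \<mu>_trunc[symmetric])

lemma coz_element_\<mu>: "0 \<le> g \<Longrightarrow> coz_element sp.quotient (\<mu> (t g)) = coz g"
proof -
  assume "0 \<le> g"
  then have "ev (t g) {0<..} = coz g" by (auto simp: ev_def coz_def spectrum_trunc)
  then show ?thesis using extension_\<mu>[of "{0<..}" "t g"] by (simp add: coz_element_def)
qed

lemma con_element_\<mu>: "0 \<le> g \<Longrightarrow> con_element sp.quotient (\<mu> (t g)) = con g"
proof -
  assume "0 \<le> g"
  then have "ev (t g) {..<1} = con g" by (auto simp: ev_def con_def spectrum_trunc min_less_iff_disj)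
  then show ?thesis using extension_\<mu>[of "{..<1}" "t g"] by (simp add: con_element_def)
qed

lemma snugly_embedded_spectrum: "snugly_embedded sp.quotient (range \<mu>)"
  unfolding snugly_embedded_def
proof (intro conjI ballI)
  show "range \<mu> \<subseteq> E0 sp.quotient"
    using \<mu>_in_R0 extends_\<mu> by (auto simp: E0_def sp.quotient_def)
  show "R0_closed (tgt sp.quotient) (range \<mu>)"
    by (auto simp: sp.quotient_def R0_closed_def R0_zero_\<mu> \<mu>_add \<mu>_sup \<mu>_inf \<mu>_scaleR \<mu>_trunc_general)
  have "range \<mu> \<noteq> {}" by simp
  show "assoc_sublocale sp.quotient =
      (\<Inter>g\<in>range \<mu>. open_sublocale (src sp.quotient) (extension sp.quotient g {-\<infinity><..<\<infinity>}))"
    by (simp add: sp.assoc_sublocale_quotient sp.S_eq_Inter extension_\<mu>) (simp add: sp.quotient_def)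
  fix x assume "x \<in> carrier (src sp.quotient)"
  then have x: "x \<in> opn" by (simp add: sp.quotient_def)
  let ?T = "truncated_elements (tgt sp.quotient) (range \<mu>)"
  let ?A = "{B \<in> basics. B \<subseteq> x}"
  have "B \<in> coz_element sp.quotient ` ?T \<union> con_element sp.quotient ` ?T" if "B \<in> basics" for B
  proof -
    from that obtain g where g: "0 \<le> g" "B = coz g \<or> B = con g" by (auto simp: basics_def)
    have "\<mu> (t g) \<in> ?T" using truncated_\<mu>[OF g(1)] by (simp add: sp.quotient_def)
    then show ?thesis using g coz_element_\<mu>[OF g(1)] con_element_\<mu>[OF g(1)] by blast
  qed
  then have "?A \<subseteq> coz_element sp.quotient ` ?T \<union> con_element sp.quotient ` ?T" by blast
  moreover have "\<Union>?A = x"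
  proof
    show "x \<subseteq> \<Union>?A"
    proof
      fix \<phi> assume "\<phi> \<in> x"
      then obtain B where "B \<in> basics" "\<phi> \<in> B" "B \<subseteq> x" using opn_basics[OF x] by blast
      then show "\<phi> \<in> \<Union>?A" by auto
    qed
  qed auto
  moreover have "?A \<subseteq> opn" using basics_opn by auto
  ultimately show "\<exists>A\<subseteq>coz_element sp.quotient ` ?T \<union> con_element sp.quotient ` ?T. x = \<Squnion>\<^bsub>src sp.quotient\<^esub>A"
    using sp.sup_M[of ?A] by (intro exI[of _ ?A]) (simp add: sp.quotient_def)
qed

lemma trunc_representation_spectrum: "trunc_representation t sp.quotient (range \<mu>) \<mu>"
proof -
  have "trunc_iso_onto t (tgt sp.quotient) (range \<mu>) \<mu>"
    using \<mu>_inj by (simp add: trunc_iso_onto_def sp.quotient_def bij_betw_def \<mu>_add \<mu>_sup \<mu>_inf \<mu>_scaleR \<mu>_trunc)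
  then show ?thesis
    by (simp add: trunc_representation_def compactification_spectrum suitable_spectrum snugly_embedded_spectrum)
qed

end

theorem theorem3p3p2:
  fixes t :: "'a::{ordered_real_vector, lattice} \<Rightarrow> 'a"
    and u :: "'b::{ordered_real_vector, lattice} \<Rightarrow> 'b"
  assumes "trunc t"
  shows
    "(\<exists>(q :: ('a rep_carrier, 'a rep_carrier) pframe_arrow) Ghat \<mu>.
        trunc_representation t q Ghat \<mu>)
     \<and>
     (\<forall>(q :: ('m, 'l) pframe_arrow) Ghat \<mu> (q1 :: ('n, 'k) pframe_arrow) Ghat1 \<mu>1.
        trunc_representation t q Ghat \<mu> \<longrightarrow> trunc_representation t q1 Ghat1 \<mu>1 \<longrightarrow>
        (\<exists>lm \<in> compactification_isos q q1.
           \<forall>g. compose (carrier O_real) (snd lm) (\<mu> g) = \<mu>1 g))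
     \<and>
     (\<forall>\<theta> (q :: ('m, 'l) pframe_arrow) Ghat \<mu> (r :: ('n, 'k) pframe_arrow) Hhat \<mu>H.
        trunc u \<longrightarrow> trunc_hom t u \<theta> \<longrightarrow>
        trunc_representation t q Ghat \<mu> \<longrightarrow> trunc_representation u r Hhat \<mu>H \<longrightarrow>
        (\<exists>!lm. lm \<in> compactification_homs q r \<and>
           (\<forall>g. E0_map lm (\<mu> g) = \<mu>H (\<theta> g))))"
proof (intro conjI allI impI)
  interpret truncation t using assms by (simp add: truncation_def)
  show "\<exists>(q :: ('a rep_carrier, 'a rep_carrier) pframe_arrow) Ghat \<mu>. trunc_representation t q Ghat \<mu>"
    using trunc_representation_spectrum by blast
next
  fix q :: "('m, 'l) pframe_arrow" and Ghat \<mu> and q1 :: "('n, 'k) pframe_arrow" and Ghat1 \<mu>1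
  assume rep: "trunc_representation t q Ghat \<mu>" "trunc_representation t q1 Ghat1 \<mu>1"
  show "\<exists>lm\<in>compactification_isos q q1. \<forall>g. compose (carrier O_real) (snd lm) (\<mu> g) = \<mu>1 g"
    by (rule representation_unique[OF rep[THEN representationI[OF assms]]])
next
  fix \<theta> and q :: "('m, 'l) pframe_arrow" and Ghat \<mu> and r :: "('n, 'k) pframe_arrow" and Hhat \<mu>H
  assume u: "trunc u" and hom: "trunc_hom t u \<theta>"
    and rep: "trunc_representation t q Ghat \<mu>" "trunc_representation u r Hhat \<mu>H"
  show "\<exists>!lm. lm \<in> compactification_homs q r \<and> (\<forall>g. E0_map lm (\<mu> g) = \<mu>H (\<theta> g))"
    by (rule representation_functorial[OF representationI[OF assms rep(1)] representationI[OF u rep(2)] hom])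
qed

end
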